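(* Let $(\pi,\phi,\gamma)$ be an admissible triple over $\mathbb{R}$, let $G$ be the target group of $\gamma$, and let $A$ be a square matrix over $\mathbb{C}\pi$. For $\xi\in H^1(G;\mathbb{R})$ let $$V_\xi(t)=\mathrm{det}^{\mathtt r}_{\mathcal{N}(G)}\left(\kappa(\phi+\gamma^*\xi,\gamma,t)(A)\right),\quad t\in\mathbb{R}_+.$$ Suppose that $G$ is finitely generated and residually finite. Then, if $V_\xi$ is constantly zero for some $\xi\in H^1(G;\mathbb{R})$, it is constantly zero for every $\xi\in H^1(G;\mathbb{R})$. Apart from that exception, for all $\xi,\eta\in H^1(G;\mathbb{R})$, $$\left|\deg^{\mathtt b}(V_\xi)-\deg^{\mathtt b}(V_\eta)\right|\le 2R(A,\gamma^*(\xi-\eta)).$$ In particular, $\xi\mapsto\deg^{\mathtt b}(V_\xi)$ defines a Lipschitz continuous function on $H^1(G;\mathbb{R})$ valued in $[0,+\infty)$.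
   Context: $\mathbb{R}_+=(0,+\infty)$. A triple $(\pi,\phi,\gamma)$, with $\pi$ a countable group, $\phi\in\mathrm{Hom}(\pi,\mathbb{R})$ and $\gamma:\pi\to G$ a homomorphism to a countable group, is admissible over $\mathbb{R}$ if $\phi=\psi\circ\gamma$ for some homomorphism $\psi:G\to\mathbb{R}$. For $\xi\in H^1(G;\mathbb{R})=\mathrm{Hom}(G,\mathbb{R})$, $\gamma^*\xi=\xi\circ\gamma$. For $t\in\mathbb{R}_+$, $\kappa(\phi,\gamma,t):\mathrm{Mat}_{p\times p}(\mathbb{C}\pi)\to\mathrm{Mat}_{p\times p}(\mathbb{C}G)$ is obtained by applying entrywise the $\mathbb{C}$-linear extension of $g\mapsto t^{\phi(g)}\gamma(g)$. Write a $p\times p$ matrix $A$ over $\mathbb{C}\pi$ uniquely as a finite sum $A=\sum_{g\in\pi}g\cdot A_g$ with $A_g\in\mathrm{Mat}_{p\times p}(\mathbb{C})$. For $\psi\in\mathrm{Hom}(\pi,\mathbb{R})$ set $R(A,\psi)=p\cdot\left(\max_{A_g\ne0}\psi(g)-\min_{A_g\ne0}\psi(g)\right)$ (and $R(0,\psi)=0$). For a countable discrete group $G$, a $p\times p$ matrix $B$ over $\mathbb{C}G\subset\mathcal{N}(G)$ (group von Neumann algebra) is viewed as a bounded operator on $\ell^2(G)^{\oplus p}$. Its Fuglede–Kadison determinant is $\det_{\mathcal N(G)}(B)=\exp\int_{(0,\infty)}\log\lambda\,dF_B(\lambda)$, with $F_B$ the spectral density function of $|B|$; $B$ is of determinant class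 if the integral is $>-\infty$. The regular Fuglede–Kadison determinant is $\det^{\mathtt r}_{\mathcal N(G)}(B)=\det_{\mathcal N(G)}(B)$ if $B$ is full rank (injective) and of determinant class, and $0$ otherwise. Growth bound degree: $\deg^{\mathtt b}_{+\infty}(f)=\inf\{D\in\mathbb{R}:\lim_{t\to+\infty}f(t)t^{-D}=0\}$, $\deg^{\mathtt b}_{0+}(f)=\sup\{D\in\mathbb{R}:\lim_{t\to0+}f(t)t^{-D}=0\}$; if both exist in $\mathbb{R}$, $\deg^{\mathtt b}(f)=\deg^{\mathtt b}_{+\infty}(f)-\deg^{\mathtt b}_{0+}(f)$. *)

theory Defs
  imports
    "HOL-Analysis.Analysis"
    "HOL-Algebra.Coset"
    "HOL-Algebra.Generated_Groups"
    "HOL-Library.Poly_Mapping"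
    "Jordan_Normal_Form.Matrix"
begin

section \<open>Groups and real cohomology classes\<close>

definition additive_real :: "real monoid"
  where "additive_real = \<lparr>carrier = UNIV, mult = (+), one = 0\<rparr>"

text \<open>Homomorphisms are normalised to vanish off the carrier, so that the linear structure is
  pointwise and equality is equality of functions.\<close>

definition H1 :: "('g, 'm) monoid_scheme \<Rightarrow> ('g \<Rightarrow> real) set"
  where "H1 G = {\<xi> \<in> hom G additive_real. \<forall>g. g \<notin> carrier G \<longrightarrow> \<xi> g = 0}"

definition norm_on_H1 :: "('g, 'm) monoid_scheme \<Rightarrow> (('g \<Rightarrow> real) \<Rightarrow> real) \<Rightarrow> bool"
  where "norm_on_H1 G N \<longleftrightarrow>
    (\<forall>\<xi>\<in>H1 G. 0 \<le> N \<xi> \<and> (N \<xi> = 0 \<longleftrightarrow> \<xi> = (\<lambda>_. 0))) \<and>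
    (\<forall>\<xi>\<in>H1 G. \<forall>c. N (\<lambda>g. c * \<xi> g) = \<bar>c\<bar> * N \<xi>) \<and>
    (\<forall>\<xi>\<in>H1 G. \<forall>\<eta>\<in>H1 G. N (\<lambda>g. \<xi> g + \<eta> g) \<le> N \<xi> + N \<eta>)"

definition finitely_generated_group :: "('g, 'm) monoid_scheme \<Rightarrow> bool"
  where "finitely_generated_group G \<longleftrightarrow>
    group G \<and> (\<exists>S. finite S \<and> S \<subseteq> carrier G \<and> generate G S = carrier G)"

definition residually_finite_group :: "('g, 'm) monoid_scheme \<Rightarrow> bool"
  where "residually_finite_group G \<longleftrightarrow>
    group G \<and> (\<forall>g \<in> carrier G - {\<one>\<^bsub>G\<^esub>}. \<exists>N. N \<lhd> G \<and> finite (carrier (G Mod N)) \<and> g \<notin> N)"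

definition admissible_triple ::
  "('a, 'm) monoid_scheme \<Rightarrow> ('a \<Rightarrow> real) \<Rightarrow> ('g, 'n) monoid_scheme \<Rightarrow> ('a \<Rightarrow> 'g) \<Rightarrow> bool"
  where "admissible_triple \<pi> \<phi> G \<gamma> \<longleftrightarrow>
    group \<pi> \<and> countable (carrier \<pi>) \<and> group G \<and> countable (carrier G) \<and>
    \<phi> \<in> hom \<pi> additive_real \<and> \<gamma> \<in> hom \<pi> G \<and>
    (\<exists>\<psi> \<in> hom G additive_real. \<forall>g\<in>carrier \<pi>. \<phi> g = \<psi> (\<gamma> g))"

section \<open>Matrices over complex group rings\<close>

text \<open>An element of the group ring is a finitely supported function \<open>'a \<Rightarrow>\<^sub>0 complex\<close> whose
  support lies in the carrier of the group.\<close>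

definition group_ring_mat :: "('a, 'm) monoid_scheme \<Rightarrow> nat \<Rightarrow> ('a \<Rightarrow>\<^sub>0 complex) mat set"
  where "group_ring_mat \<pi> p =
    {A \<in> carrier_mat p p. \<forall>i<p. \<forall>j<p. Poly_Mapping.keys (A $$ (i, j)) \<subseteq> carrier \<pi>}"

definition kappa_elem :: "('a \<Rightarrow> real) \<Rightarrow> ('a \<Rightarrow> 'g) \<Rightarrow> real \<Rightarrow> ('a \<Rightarrow>\<^sub>0 complex) \<Rightarrow> ('g \<Rightarrow>\<^sub>0 complex)"
  where "kappa_elem \<phi> \<gamma> t a =
    (\<Sum>g\<in>Poly_Mapping.keys a.
       Poly_Mapping.single (\<gamma> g) (Poly_Mapping.lookup a g * complex_of_real (t powr \<phi> g)))"

definition kappa ::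
  "('a \<Rightarrow> real) \<Rightarrow> ('a \<Rightarrow> 'g) \<Rightarrow> real \<Rightarrow> ('a \<Rightarrow>\<^sub>0 complex) mat \<Rightarrow> ('g \<Rightarrow>\<^sub>0 complex) mat"
  where "kappa \<phi> \<gamma> t A = map_mat (kappa_elem \<phi> \<gamma> t) A"

text \<open>The coefficient matrix \<open>A\<^sub>g\<close> in \<open>A = \<Sum>\<^sub>g g \<cdot> A\<^sub>g\<close>.\<close>

definition coeff_mat :: "('a \<Rightarrow>\<^sub>0 complex) mat \<Rightarrow> 'a \<Rightarrow> complex mat"
  where "coeff_mat A g = map_mat (\<lambda>a. Poly_Mapping.lookup a g) A"

definition mat_support :: "nat \<Rightarrow> ('a \<Rightarrow>\<^sub>0 complex) mat \<Rightarrow> 'a set"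
  where "mat_support p A = {g. coeff_mat A g \<noteq> 0\<^sub>m p p}"

definition R_width :: "nat \<Rightarrow> ('a \<Rightarrow>\<^sub>0 complex) mat \<Rightarrow> ('a \<Rightarrow> real) \<Rightarrow> real"
  where "R_width p A \<psi> =
    (if mat_support p A = {} then 0
     else real p * (Max (\<psi> ` mat_support p A) - Min (\<psi> ` mat_support p A)))"

section \<open>The Hilbert space of square summable functions on a set\<close>

definition ell2 :: "'x set \<Rightarrow> ('x \<Rightarrow> complex) set"
  where "ell2 X = {x. (\<forall>s. s \<notin> X \<longrightarrow> x s = 0) \<and> (\<lambda>s. (cmod (x s))\<^sup>2) summable_on X}"

definition ell2_inner :: "'x set \<Rightarrow> ('x \<Rightarrow> complex) \<Rightarrow> ('x \<Rightarrow> complex) \<Rightarrow> complex"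
  where "ell2_inner X x y = (\<Sum>\<^sub>\<infinity>s\<in>X. x s * cnj (y s))"

definition ell2_norm :: "'x set \<Rightarrow> ('x \<Rightarrow> complex) \<Rightarrow> real"
  where "ell2_norm X x = sqrt (\<Sum>\<^sub>\<infinity>s\<in>X. (cmod (x s))\<^sup>2)"

text \<open>Operators are taken extensional, so that the adjoint and the absolute value below are unique
  as functions.\<close>

definition bounded_ops :: "'x set \<Rightarrow> (('x \<Rightarrow> complex) \<Rightarrow> ('x \<Rightarrow> complex)) set"
  where "bounded_ops X = {T \<in> ell2 X \<rightarrow>\<^sub>E ell2 X.
    (\<forall>x\<in>ell2 X. \<forall>y\<in>ell2 X. T (\<lambda>s. x s + y s) = (\<lambda>s. T x s + T y s)) \<and>
    (\<forall>c. \<forall>x\<in>ell2 X. T (\<lambda>s. c * x s) = (\<lambda>s. c * T x s)) \<and>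
    (\<exists>K. \<forall>x\<in>ell2 X. ell2_norm X (T x) \<le> K * ell2_norm X x)}"

definition adjoint_op ::
  "'x set \<Rightarrow> (('x \<Rightarrow> complex) \<Rightarrow> ('x \<Rightarrow> complex)) \<Rightarrow> (('x \<Rightarrow> complex) \<Rightarrow> ('x \<Rightarrow> complex))"
  where "adjoint_op X B = (THE C. C \<in> bounded_ops X \<and>
    (\<forall>x\<in>ell2 X. \<forall>y\<in>ell2 X. ell2_inner X (B x) y = ell2_inner X x (C y)))"

definition positive_op :: "'x set \<Rightarrow> (('x \<Rightarrow> complex) \<Rightarrow> ('x \<Rightarrow> complex)) \<Rightarrow> bool"
  where "positive_op X T \<longleftrightarrow> T \<in> bounded_ops X \<and> (\<forall>x\<in>ell2 X. ell2_inner X (T x) x \<in> \<real>\<^sub>\<ge>\<^sub>0)"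

text \<open>\<open>|B|\<close> is the positive square root of \<open>B\<^sup>*B\<close>.\<close>

definition abs_op ::
  "'x set \<Rightarrow> (('x \<Rightarrow> complex) \<Rightarrow> ('x \<Rightarrow> complex)) \<Rightarrow> (('x \<Rightarrow> complex) \<Rightarrow> ('x \<Rightarrow> complex))"
  where "abs_op X B = (THE T. positive_op X T \<and> (\<forall>x\<in>ell2 X. T (T x) = adjoint_op X B (B x)))"

definition closed_subspace :: "'x set \<Rightarrow> ('x \<Rightarrow> complex) set \<Rightarrow> bool"
  where "closed_subspace X L \<longleftrightarrow> L \<subseteq> ell2 X \<and> (\<lambda>_. 0) \<in> L \<and>
    (\<forall>x\<in>L. \<forall>y\<in>L. (\<lambda>s. x s + y s) \<in> L) \<and>
    (\<forall>c. \<forall>x\<in>L. (\<lambda>s. c * x s) \<in> L) \<and>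
    (\<forall>u. \<forall>x\<in>ell2 X. (\<forall>n::nat. u n \<in> L) \<longrightarrow>
       (\<lambda>n. ell2_norm X (\<lambda>s. u n s - x s)) \<longlonglongrightarrow> 0 \<longrightarrow> x \<in> L)"

definition proj_onto :: "'x set \<Rightarrow> ('x \<Rightarrow> complex) set \<Rightarrow> ('x \<Rightarrow> complex) \<Rightarrow> ('x \<Rightarrow> complex)"
  where "proj_onto X L x = (THE y. y \<in> L \<and> (\<forall>z\<in>L. ell2_inner X (\<lambda>s. x s - y s) z = 0))"

section \<open>Fuglede--Kadison determinants\<close>

text \<open>\<open>\<ell>\<^sup>2(G)\<^bsup>\<oplus>p\<^esup>\<close> is realised as \<open>\<ell>\<^sup>2({0..<p} \<times> G)\<close>. A matrix over \<open>\<complex>G\<close> acts on columns by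
  convolution from the left, that is \<open>(B x)\<^sub>i = \<Sum>\<^sub>j B\<^sub>i\<^sub>j \<cdot> x\<^sub>j\<close>; it therefore commutes with the
  right translations by elements of \<open>G\<close>, and these are the symmetries that define Hilbert
  submodules. Letting matrices act from the right and \<open>G\<close> from the left instead yields the same
  determinants.\<close>

definition l2_index :: "('g, 'n) monoid_scheme \<Rightarrow> nat \<Rightarrow> (nat \<times> 'g) set"
  where "l2_index G p = {..<p} \<times> carrier G"

definition mat_op ::
  "('g, 'n) monoid_scheme \<Rightarrow> nat \<Rightarrow> ('g \<Rightarrow>\<^sub>0 complex) mat \<Rightarrow>
   ((nat \<times> 'g \<Rightarrow> complex) \<Rightarrow> (nat \<times> 'g \<Rightarrow> complex))"
  where "mat_op G p B = (\<lambda>x\<in>ell2 (l2_index G p). \<lambda>(i, h).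
    if (i, h) \<in> l2_index G p
    then \<Sum>j<p. \<Sum>g\<in>Poly_Mapping.keys (B $$ (i, j)).
           Poly_Mapping.lookup (B $$ (i, j)) g * x (j, inv\<^bsub>G\<^esub> g \<otimes>\<^bsub>G\<^esub> h)
    else 0)"

definition right_translate ::
  "('g, 'n) monoid_scheme \<Rightarrow> nat \<Rightarrow> 'g \<Rightarrow> (nat \<times> 'g \<Rightarrow> complex) \<Rightarrow> (nat \<times> 'g \<Rightarrow> complex)"
  where "right_translate G p k x =
    (\<lambda>(i, h). if (i, h) \<in> l2_index G p then x (i, h \<otimes>\<^bsub>G\<^esub> k) else 0)"

definition hilbert_submodule ::
  "('g, 'n) monoid_scheme \<Rightarrow> nat \<Rightarrow> (nat \<times> 'g \<Rightarrow> complex) set \<Rightarrow> bool"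
  where "hilbert_submodule G p L \<longleftrightarrow> closed_subspace (l2_index G p) L \<and>
    (\<forall>k\<in>carrier G. \<forall>x\<in>L. right_translate G p k x \<in> L)"

definition unit_vec_l2 :: "('g, 'n) monoid_scheme \<Rightarrow> nat \<Rightarrow> (nat \<times> 'g \<Rightarrow> complex)"
  where "unit_vec_l2 G i = (\<lambda>s. if s = (i, \<one>\<^bsub>G\<^esub>) then 1 else 0)"

text \<open>The von Neumann dimension: the von Neumann trace of the orthogonal projection.\<close>

definition vN_dim :: "('g, 'n) monoid_scheme \<Rightarrow> nat \<Rightarrow> (nat \<times> 'g \<Rightarrow> complex) set \<Rightarrow> real"
  where "vN_dim G p L =
    (\<Sum>i<p. Re (ell2_inner (l2_index G p)
                  (proj_onto (l2_index G p) L (unit_vec_l2 G i)) (unit_vec_l2 G i)))"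

text \<open>Lueck's definition of the spectral density function of an operator \<open>T\<close>. For \<open>c < 0\<close> only the
  zero submodule qualifies, so the function is extended by zero to the negative axis, as needed for
  its Stieltjes measure.\<close>

definition spectral_density ::
  "('g, 'n) monoid_scheme \<Rightarrow> nat \<Rightarrow> ((nat \<times> 'g \<Rightarrow> complex) \<Rightarrow> (nat \<times> 'g \<Rightarrow> complex)) \<Rightarrow> real \<Rightarrow> real"
  where "spectral_density G p T c =
    Sup {vN_dim G p L | L. hilbert_submodule G p L \<and>
           (\<forall>x\<in>L. ell2_norm (l2_index G p) (T x) \<le> c * ell2_norm (l2_index G p) x)}"

definition density_measure :: "('g, 'n) monoid_scheme \<Rightarrow> nat \<Rightarrow> ('g \<Rightarrow>\<^sub>0 complex) mat \<Rightarrow> real measure"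
  where "density_measure G p B =
    interval_measure (spectral_density G p (abs_op (l2_index G p) (mat_op G p B)))"

text \<open>The extended real number \<open>\<integral>\<^bsub>(0,\<infinity>)\<^esub> log \<lambda> dF\<^sub>B(\<lambda>)\<close> as the difference of the integrals of the
  positive and negative parts. The first is always finite, because \<open>F\<^sub>B\<close> is constant beyond the
  operator norm; the second may be infinite.\<close>

definition log_integral :: "('g, 'n) monoid_scheme \<Rightarrow> nat \<Rightarrow> ('g \<Rightarrow>\<^sub>0 complex) mat \<Rightarrow> ereal"
  where "log_integral G p B =
    enn2ereal (\<integral>\<^sup>+x\<in>{0<..}. ennreal (ln x) \<partial>density_measure G p B) -
    enn2ereal (\<integral>\<^sup>+x\<in>{0<..}. ennreal (- ln x) \<partial>density_measure G p B)"

definition determinant_class :: "('g, 'n) monoid_scheme \<Rightarrow> nat \<Rightarrow> ('g \<Rightarrow>\<^sub>0 complex) mat \<Rightarrow> bool"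
  where "determinant_class G p B \<longleftrightarrow> log_integral G p B > -\<infinity>"

definition fk_det :: "('g, 'n) monoid_scheme \<Rightarrow> nat \<Rightarrow> ('g \<Rightarrow>\<^sub>0 complex) mat \<Rightarrow> real"
  where "fk_det G p B =
    (if log_integral G p B = -\<infinity> then 0 else exp (real_of_ereal (log_integral G p B)))"

definition full_rank :: "('g, 'n) monoid_scheme \<Rightarrow> nat \<Rightarrow> ('g \<Rightarrow>\<^sub>0 complex) mat \<Rightarrow> bool"
  where "full_rank G p B \<longleftrightarrow> inj_on (mat_op G p B) (ell2 (l2_index G p))"

definition regular_fk_det :: "('g, 'n) monoid_scheme \<Rightarrow> nat \<Rightarrow> ('g \<Rightarrow>\<^sub>0 complex) mat \<Rightarrow> real"
  where "regular_fk_det G p B =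
    (if full_rank G p B \<and> determinant_class G p B then fk_det G p B else 0)"

section \<open>Growth bound degree\<close>

definition degb_infinity :: "(real \<Rightarrow> real) \<Rightarrow> ereal"
  where "degb_infinity f = Inf {ereal D | D. ((\<lambda>t. f t * t powr (- D)) \<longlongrightarrow> 0) at_top}"

definition degb_zero :: "(real \<Rightarrow> real) \<Rightarrow> ereal"
  where "degb_zero f = Sup {ereal D | D. ((\<lambda>t. f t * t powr (- D)) \<longlongrightarrow> 0) (at_right 0)}"

definition has_degb :: "(real \<Rightarrow> real) \<Rightarrow> bool"
  where "has_degb f \<longleftrightarrow> \<bar>degb_infinity f\<bar> \<noteq> \<infinity> \<and> \<bar>degb_zero f\<bar> \<noteq> \<infinity>"

text \<open>Meaningful only if \<open>has_degb f\<close> holds.\<close>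

definition degb :: "(real \<Rightarrow> real) \<Rightarrow> real"
  where "degb f = real_of_ereal (degb_infinity f) - real_of_ereal (degb_zero f)"

end

theory Submission
  imports Defs
begin

text \<open>
  For an operator \<open>B\<close> of norm at most \<open>r\<close>, put \<open>X = 1 - B\<^sup>*B / r\<^sup>2\<close>. Then the logarithm of the regular
  determinant is the limit of \<open>p ln r - (\<Sum>n=1..N. tr (X\<^sup>n) / n) / 2\<close>: it is \<open>-\<infinity>\<close>, that is, the
  determinant is 0, exactly if \<open>B\<close> is not injective or not of determinant class.

  Let \<open>\<Phi> \<beta>\<close> be the regular determinant of the image of \<open>A\<close> under \<open>g \<mapsto> exp (\<beta> (\<gamma> g)) \<cdot> \<gamma> g\<close>. Along a
  line \<open>\<alpha> + s \<delta>\<close> of homomorphisms the matrix extends to a holomorphic family in \<open>z = s + i\<theta>\<close>, whose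
  members with equal \<open>s\<close> are unitarily conjugate. For even \<open>N\<close> the Laplacian of the partial sum is a
  sum of traces of the form \<open>tr (C\<^sup>*C)\<close>; as the partial sum does not depend on \<open>\<theta>\<close>, it is convex in
  \<open>s\<close>. So \<open>\<Phi>\<close> is log-convex on homomorphisms. In particular, it vanishes everywhere if it vanishes
  somewhere.

  If it does not vanish, \<open>deg\<^sup>b\<close> is \<open>M \<beta> + M (- \<beta>)\<close>, where \<open>M \<beta>\<close> is the slope at infinity of
  \<open>s \<mapsto> ln (\<Phi> (s \<beta>))\<close>. By convexity \<open>M\<close> is subadditive, and the operator norm bounds \<open>M \<beta>\<close> by \<open>p\<close>
  times the maximum of \<open>\<beta> \<circ> \<gamma>\<close> on the support of \<open>A\<close>. Hence degrees differ by at most the width of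
  the difference of the two homomorphisms.\<close>

section \<open>Bounded operators on a Hilbert space\<close>

text \<open>The regular determinant may vanish, so its logarithm cannot be differentiated along a
  line. The truncated sums can: they are polynomials in the operator and its adjoint under a trace,
  finite and smooth in \<open>s\<close>, and their exponentials converge even where the limit is 0.
  An inequality between exponentials therefore survives, and it carries the statement about
  vanishing with it.

  All scalars are real. Complex linearity is expressed as commutation with an operator
  \<open>J\<close> satisfying \<open>J * J = - 1\<close> that is kept among the symmetries, and
  traces are real parts. Thus an operator and its adjoint have the same trace, and the Laplacian is
  handled through derivatives of real functions of one variable.

  No projection-valued measure is constructed. Spectral subspaces come from square roots of positive
  operators, and the moments of the Stieltjes measure are matched with traces of powers by comparing
  increments over short intervals. The price is a translation at the end: adjoints, absolute values
  and projections in the definitions are unique descriptions on function spaces and have to be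
  identified with the operators used here.\<close>

class hilbert_space = real_inner + complete_space + perfect_space

instance hilbert_space \<subseteq> banach ..

text \<open>A type of its own lets composition be the product of a normed algebra with unit, so that
  powers, \<open>1\<close> and ring normalisation apply to operators.\<close>

typedef (overloaded) 'h endo = "UNIV :: ('h::real_normed_vector \<Rightarrow>\<^sub>L 'h) set"
  ..

setup_lifting type_definition_endo

lift_definition app :: "'h::real_normed_vector endo \<Rightarrow> 'h \<Rightarrow> 'h" is blinfun_apply .

instantiation endo :: (real_normed_vector) real_normed_vector
begin
lift_definition norm_endo :: "'a endo \<Rightarrow> real" is norm .
lift_definition zero_endo :: "'a endo" is 0 .
lift_definition plus_endo :: "'a endo \<Rightarrow> 'a endo \<Rightarrow> 'a endo" is "(+)" .
lift_definition minus_endo :: "'a endo \<Rightarrow> 'a endo \<Rightarrow> 'a endo" is "(-)" .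
lift_definition uminus_endo :: "'a endo \<Rightarrow> 'a endo" is "uminus" .
lift_definition scaleR_endo :: "real \<Rightarrow> 'a endo \<Rightarrow> 'a endo" is "scaleR" .
definition dist_endo :: "'a endo \<Rightarrow> 'a endo \<Rightarrow> real" where "dist_endo a b = norm (a - b)"
definition sgn_endo :: "'a endo \<Rightarrow> 'a endo" where "sgn_endo a = scaleR (inverse (norm a)) a"
definition [code del]: "(uniformity :: ('a endo \<times> 'a endo) filter) = (INF e\<in>{0 <..}. principal {(x, y). dist x y < e})"
definition open_endo :: "'a endo set \<Rightarrow> bool"
  where [code del]: "open_endo S = (\<forall>x\<in>S. \<forall>\<^sub>F (x', y) in uniformity. x' = x \<longrightarrow> y \<in> S)"
instance
proof
  fix a b c :: "'a endo" and r s :: real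
  show "dist a b = norm (a - b)" by (rule dist_endo_def)
  show "sgn a = inverse (norm a) *\<^sub>R a" by (rule sgn_endo_def)
  show "uniformity = (INF e\<in>{0 <..}. principal {(x, y). dist x (y :: 'a endo) < e})"
    by (rule uniformity_endo_def)
  show "open U = (\<forall>x\<in>U. \<forall>\<^sub>F (x', y) in uniformity. x' = x \<longrightarrow> y \<in> U)" for U :: "'a endo set"
    by (rule open_endo_def)
  show "norm (a + b) \<le> norm a + norm b" by transfer (rule norm_triangle_ineq)
qed (transfer; simp add: algebra_simps)+
end

lemma norm_app_le: "norm (app T x) \<le> norm T * norm x"
  by transfer (rule norm_blinfun)

lemma endo_eqI: "(\<And>x. app S x = app T x) \<Longrightarrow> S = T"
  by transfer (rule blinfun_eqI)

lemma app_add [simp]: "app (S + T) x = app S x + app T x"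
  by transfer (simp add: blinfun.add_left)

lemma app_diff [simp]: "app (S - T) x = app S x - app T x"
  by transfer (simp add: blinfun.diff_left)

lemma app_uminus [simp]: "app (- T) x = - app T x"
  by transfer (simp add: blinfun.minus_left)

lemma app_scaleR [simp]: "app (r *\<^sub>R T) x = r *\<^sub>R app T x"
  by transfer (simp add: blinfun.scaleR_left)

lemma app_zero [simp]: "app 0 x = 0"
  by transfer simp

lemma bounded_bilinear_app: "bounded_bilinear app"
proof
  fix S T :: "'a endo" and x y :: 'a and r :: real
  show "app T (x + y) = app T x + app T y"
    by (simp add: app.rep_eq blinfun.add_right)
  show "app T (r *\<^sub>R x) = r *\<^sub>R app T x"
    by (simp add: app.rep_eq blinfun.scaleR_right)
  show "\<exists>K. \<forall>T x. norm (app T (x :: 'a)) \<le> norm T * norm x * K"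
    by (rule exI[of _ 1]) (simp add: norm_app_le)
qed simp_all

interpretation app: bounded_bilinear app
  by (rule bounded_bilinear_app)

lemma bounded_linear_app: "bounded_linear (app T)"
  by (rule app.bounded_linear_right)

lemma norm_endo_bound: "0 \<le> b \<Longrightarrow> (\<And>x. norm (app T x) \<le> b * norm x) \<Longrightarrow> norm T \<le> b"
  by transfer (rule norm_blinfun_bound)

lemma ex_endo:
  assumes "bounded_linear f"
  shows "\<exists>T. \<forall>x. app T x = f x"
  by (rule exI[of _ "Abs_endo (Blinfun f)"])
     (simp add: app.rep_eq Abs_endo_inverse bounded_linear_Blinfun_apply[OF assms])

definition endo :: "('h::real_normed_vector \<Rightarrow> 'h) \<Rightarrow> 'h endo"
  where "endo f = Abs_endo (Blinfun f)"

lemma app_endo: "bounded_linear f \<Longrightarrow> app (endo f) x = f x"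
  by (simp add: endo_def app.rep_eq Abs_endo_inverse bounded_linear_Blinfun_apply)

instance endo :: (banach) banach
proof
  fix X :: "nat \<Rightarrow> 'a endo"
  assume "Cauchy X"
  have "Cauchy (\<lambda>n. Rep_endo (X n))"
    using \<open>Cauchy X\<close> unfolding Cauchy_def dist_norm
    by (simp add: norm_endo.rep_eq minus_endo.rep_eq)
  then obtain L where "(\<lambda>n. Rep_endo (X n)) \<longlonglongrightarrow> L"
    using Cauchy_convergent convergent_def by blast
  then have "X \<longlonglongrightarrow> Abs_endo L"
    unfolding LIMSEQ_def dist_norm
    by (simp add: norm_endo.rep_eq minus_endo.rep_eq Abs_endo_inverse)
  then show "convergent X"
    by (rule convergentI)
qed

text \<open>On the zero space \<open>norm 1 = 1\<close> would fail; \<open>perfect_space\<close>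
  excludes it.\<close>

instantiation endo :: ("{real_normed_vector, perfect_space}") real_normed_algebra_1
begin
lift_definition one_endo :: "'a endo" is id_blinfun .
lift_definition times_endo :: "'a endo \<Rightarrow> 'a endo \<Rightarrow> 'a endo" is blinfun_compose .
instance
proof
  fix a b c :: "'a endo" and r :: real
  show "a * b * c = a * (b * c)" by transfer (auto intro: blinfun_eqI)
  show "(a + b) * c = a * c + b * c" by transfer (auto intro: blinfun_eqI simp: blinfun.bilinear_simps)
  show "a * (b + c) = a * b + a * c" by transfer (auto intro: blinfun_eqI simp: blinfun.bilinear_simps)
  show "1 * a = a" by transfer (auto intro: blinfun_eqI)
  show "a * 1 = a" by transfer (auto intro: blinfun_eqI)
  show "r *\<^sub>R a * b = r *\<^sub>R (a * b)" by transfer (auto intro: blinfun_eqI simp: blinfun.bilinear_simps)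
  show "a * r *\<^sub>R b = r *\<^sub>R (a * b)" by transfer (auto intro: blinfun_eqI simp: blinfun.bilinear_simps)
  show "norm (a * b) \<le> norm a * norm b" by transfer (rule norm_blinfun_compose)
  show 1: "norm (1 :: 'a endo) = 1" by transfer (rule norm_blinfun_id)
  show "(0 :: 'a endo) \<noteq> 1" using 1 by (metis norm_zero zero_neq_one)
qed
end

lemma app_mult [simp]: "app (S * T) x = app S (app T x)"
  by transfer simp

lemma app_one [simp]: "app 1 x = x"
  by transfer simp

lemma app_sum_left: "app (\<Sum>i\<in>A. f i) x = (\<Sum>i\<in>A. app (f i) x)"
  by (rule app.sum_left)

section \<open>Orthogonal projections and adjoints\<close>

text \<open>A minimising sequence is Cauchy by the parallelogram law: the midpoint of two of its
  members lies in \<open>L\<close> again, so its squared distance from \<open>x\<close> is at least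
  the infimum \<open>d\<close>, which leaves little room for the difference of the two.\<close>

lemma nearest_point_exists:
  fixes L :: "'h::hilbert_space set"
  assumes "closed L" "subspace L"
  shows "\<exists>y\<in>L. \<forall>z\<in>L. norm (x - y) \<le> norm (x - z)"
proof -
  define d where "d = (INF z\<in>L. (norm (x - z))\<^sup>2)"
  have ne: "L \<noteq> {}"
    using assms(2) subspace_0 by auto
  have bdd: "bdd_below ((\<lambda>z. (norm (x - z))\<^sup>2) ` L)"
    by (auto intro!: bdd_belowI[of _ 0])
  have d_le: "d \<le> (norm (x - z))\<^sup>2" if "z \<in> L" for z
    unfolding d_def using that bdd by (rule cINF_lower[rotated])
  have "\<exists>z\<in>L. (norm (x - z))\<^sup>2 < d + 1 / Suc n" for n
    using cINF_less_iff[OF ne bdd, of "d + 1 / Suc n"] by (simp add: d_def)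
  then obtain u where u: "u n \<in> L" "(norm (x - u n))\<^sup>2 < d + 1 / Suc n" for n
    by metis
  have para: "(norm (u n - u m))\<^sup>2 \<le> 2 / Suc n + 2 / Suc m" for n m
  proof -
    have "(1/2) *\<^sub>R (u n + u m) \<in> L"
      using assms(2) u(1) by (meson subspace_add subspace_scale)
    from d_le[OF this] have "4 * d \<le> 4 * (norm (x - (1/2) *\<^sub>R (u n + u m)))\<^sup>2"
      by simp
    also have "\<dots> = 2 * (norm (x - u n))\<^sup>2 + 2 * (norm (x - u m))\<^sup>2 - (norm (u n - u m))\<^sup>2"
      by (simp add: power2_norm_eq_inner inner_simps inner_commute algebra_simps)
    finally show ?thesis
      using u(2)[of n] u(2)[of m] by linarith
  qed
  have "Cauchy u"
  proof (rule CauchyI)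
    fix e :: real assume "0 < e"
    then obtain N where N: "4 / e\<^sup>2 < real N"
      using reals_Archimedean2 by blast
    have "norm (u m - u n) < e" if "m \<ge> N" "n \<ge> N" for m n
    proof -
      have pos: "0 < 4 / e\<^sup>2" using \<open>0 < e\<close> by simp
      then have "0 < real N" using N by linarith
      have "(norm (u m - u n))\<^sup>2 \<le> 2 / Suc m + 2 / Suc n" by (rule para)
      also have "\<dots> \<le> 2 / real N + 2 / real N"
        using that \<open>0 < real N\<close> by (intro add_mono divide_left_mono) auto
      also have "\<dots> < e\<^sup>2"
        using N \<open>0 < e\<close> \<open>0 < real N\<close> by (simp add: field_simps)
      finally show ?thesis
        using \<open>0 < e\<close> by (simp add: power_less_imp_less_base)
    qed
    then show "\<exists>M. \<forall>m\<ge>M. \<forall>n\<ge>M. norm (u m - u n) < e" by blast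
  qed
  then obtain y where y: "u \<longlonglongrightarrow> y"
    using Cauchy_convergent convergent_def by blast
  have "y \<in> L"
    using assms(1) u(1) y by (auto simp: closed_sequential_limits)
  moreover have "(norm (x - y))\<^sup>2 \<le> d"
  proof (rule LIMSEQ_le)
    show "(\<lambda>n. (norm (x - u n))\<^sup>2) \<longlonglongrightarrow> (norm (x - y))\<^sup>2"
      by (intro tendsto_intros y)
    show "(\<lambda>n. d + 1 / Suc n) \<longlonglongrightarrow> d"
      using tendsto_add[OF tendsto_const[of d] LIMSEQ_inverse_real_of_nat]
      by (simp add: inverse_eq_divide)
  qed (use u(2) less_imp_le in blast)
  ultimately show ?thesis
    using d_le by (meson norm_ge_zero order_trans power2_le_imp_le)
qed

lemma orthogonal_decomposition:
  fixes L :: "'h::hilbert_space set"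
  assumes "closed L" "subspace L"
  shows "\<exists>y\<in>L. \<forall>z\<in>L. inner (x - y) z = 0"
proof -
  obtain y where y: "y \<in> L" "\<And>z. z \<in> L \<Longrightarrow> norm (x - y) \<le> norm (x - z)"
    using nearest_point_exists[OF assms] by metis
  have "inner (x - y) z = 0" if "z \<in> L" for z
  proof (cases "z = 0")
    case False
    \<comment> \<open>The minimiser of the quadratic polynomial
      \<open>(norm (x - (y + a *\<^sub>R z)))\<^sup>2\<close> in \<open>a\<close>.\<close>
    define a where "a = inner (x - y) z / inner z z"
    have "y + a *\<^sub>R z \<in> L"
      using assms(2) y(1) that by (meson subspace_add subspace_scale)
    from y(2)[OF this] have "(norm (x - y))\<^sup>2 \<le> (norm (x - (y + a *\<^sub>R z)))\<^sup>2"
      by (simp add: power_mono)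
    also have "\<dots> = (norm (x - y))\<^sup>2 - 2 * a * inner (x - y) z + a * (a * inner z z)"
      by (simp add: power2_norm_eq_inner inner_simps inner_commute algebra_simps)
    also have "\<dots> = (norm (x - y))\<^sup>2 - (inner (x - y) z)\<^sup>2 / inner z z"
      using False by (simp add: a_def power2_eq_square field_simps)
    finally have "(inner (x - y) z)\<^sup>2 / inner z z \<le> 0" by simp
    moreover have "0 < inner z z" using False by simp
    ultimately have "(inner (x - y) z)\<^sup>2 \<le> 0"
      by (simp add: divide_le_0_iff)
    then show ?thesis by simp
  qed simp
  with y(1) show ?thesis by blast
qed

lemma orthogonal_decomposition_unique:
  fixes L :: "'h::hilbert_space set"
  assumes "subspace L" "y \<in> L" "y' \<in> L"
    and "\<forall>z\<in>L. inner (x - y) z = 0" "\<forall>z\<in>L. inner (x - y') z = 0"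
  shows "y = y'"
proof -
  have "y' - y \<in> L" using assms(1-3) by (simp add: subspace_diff)
  then have "inner (x - y) (y' - y) = 0" "inner (x - y') (y' - y) = 0"
    using assms(4,5) by auto
  then have "inner (y' - y) (y' - y) = 0"
    by (simp add: inner_simps)
  then show ?thesis by simp
qed

definition proj :: "'h::hilbert_space set \<Rightarrow> 'h endo"
  where "proj L = endo (\<lambda>x. THE y. y \<in> L \<and> (\<forall>z\<in>L. inner (x - y) z = 0))"

context
  fixes L :: "'h::hilbert_space set"
  assumes L: "closed L" "subspace L"
begin

lemma proj_props: "app (proj L) x \<in> L \<and> (\<forall>z\<in>L. inner (x - app (proj L) x) z = 0)"
proof -
  define P where "P x = (THE y. y \<in> L \<and> (\<forall>z\<in>L. inner (x - y) z = 0))" for x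
  have P: "P x \<in> L \<and> (\<forall>z\<in>L. inner (x - P x) z = 0)" for x
    unfolding P_def
  proof (rule theI')
    obtain y where y: "y \<in> L" "\<forall>z\<in>L. inner (x - y) z = 0"
      using orthogonal_decomposition[OF L, of x] by blast
    show "\<exists>!y. y \<in> L \<and> (\<forall>z\<in>L. inner (x - y) z = 0)"
    proof (rule ex1I)
      show "y \<in> L \<and> (\<forall>z\<in>L. inner (x - y) z = 0)" using y by simp
      show "y' = y" if "y' \<in> L \<and> (\<forall>z\<in>L. inner (x - y') z = 0)" for y'
        using that y by (intro orthogonal_decomposition_unique[OF L(2), of y' y x]) auto
    qed
  qed
  have eqI: "P x = y" if "y \<in> L" "\<And>z. z \<in> L \<Longrightarrow> inner (x - y) z = 0" for x y
    using P[of x] that by (intro orthogonal_decomposition_unique[OF L(2), of "P x" y x]) auto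
  have "bounded_linear P"
  proof (rule bounded_linear_intro[where K = 1])
    show "P (x + y) = P x + P y" for x y
    proof (rule eqI)
      show "inner (x + y - (P x + P y)) z = 0" if "z \<in> L" for z
      proof -
        have "inner (x + y - (P x + P y)) z = inner (x - P x) z + inner (y - P y) z"
          by (simp add: inner_simps)
        then show ?thesis using P[of x] P[of y] that by simp
      qed
    qed (use P L(2) in \<open>auto intro: subspace_add\<close>)
    show "P (r *\<^sub>R x) = r *\<^sub>R P x" for r x
    proof (rule eqI)
      show "inner (r *\<^sub>R x - r *\<^sub>R P x) z = 0" if "z \<in> L" for z
      proof -
        have "inner (r *\<^sub>R x - r *\<^sub>R P x) z = r * inner (x - P x) z"
          by (simp add: inner_simps right_diff_distrib)
        then show ?thesis using P[of x] that by simp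
      qed
    qed (use P L(2) in \<open>auto intro: subspace_scale\<close>)
    show "norm (P x) \<le> norm x * 1" for x
    proof -
      have "inner (x - P x) (P x) = 0" using P by blast
      then have "(norm x)\<^sup>2 = (norm (P x))\<^sup>2 + (norm (x - P x))\<^sup>2"
        using norm_add_Pythagorean[of "x - P x" "P x"] by (simp add: real_inner_class.orthogonal_def)
      then have "(norm (P x))\<^sup>2 \<le> (norm x)\<^sup>2" by simp
      then show ?thesis by (simp add: power_mono_iff)
    qed
  qed
  then have "app (proj L) x = P x"
    using app_endo[of P x] by (simp add: proj_def P_def[abs_def])
  then show ?thesis using P[of x] by metis
qed

lemma proj_mem: "app (proj L) x \<in> L"
  and proj_orth: "z \<in> L \<Longrightarrow> inner (x - app (proj L) x) z = 0"
  by (simp_all add: proj_props)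

lemma proj_eqI: "y \<in> L \<Longrightarrow> (\<And>z. z \<in> L \<Longrightarrow> inner (x - y) z = 0) \<Longrightarrow> app (proj L) x = y"
  using proj_props[of x] by (intro orthogonal_decomposition_unique[OF L(2), of _ y x]) auto

lemma proj_fixes: "x \<in> L \<Longrightarrow> app (proj L) x = x"
  by (rule proj_eqI) auto

lemma proj_fixes_iff: "app (proj L) x = x \<longleftrightarrow> x \<in> L"
  using proj_fixes[of x] proj_mem[of x] by auto

lemma proj_idem: "proj L * proj L = proj L"
  by (rule endo_eqI) (simp add: proj_fixes proj_mem)

lemma proj_inner: "inner (app (proj L) x) y = inner x (app (proj L) y)"
proof -
  have "inner (x - app (proj L) x) (app (proj L) y) = 0" "inner (y - app (proj L) y) (app (proj L) x) = 0"
    by (simp_all add: proj_orth proj_mem)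
  then show ?thesis
    unfolding inner_diff_left by (metis eq_iff_diff_eq_0 inner_commute)
qed

lemma norm_proj_le: "norm (app (proj L) x) \<le> norm x"
proof -
  have "inner (x - app (proj L) x) (app (proj L) x) = 0" using proj_orth proj_mem by blast
  then have "(norm x)\<^sup>2 = (norm (app (proj L) x))\<^sup>2 + (norm (x - app (proj L) x))\<^sup>2"
    using norm_add_Pythagorean[of "x - app (proj L) x" "app (proj L) x"] by (simp add: real_inner_class.orthogonal_def)
  then have "(norm (app (proj L) x))\<^sup>2 \<le> (norm x)\<^sup>2" by simp
  then show ?thesis by (simp add: power_mono_iff)
qed

lemma proj_eq_0_iff: "app (proj L) x = 0 \<longleftrightarrow> (\<forall>z\<in>L. inner x z = 0)"
proof
  show "\<forall>z\<in>L. inner x z = 0" if "app (proj L) x = 0"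
    using proj_orth[of _ x] unfolding that by simp
  show "app (proj L) x = 0" if "\<forall>z\<in>L. inner x z = 0"
    using that subspace_0[OF L(2)] by (intro proj_eqI) auto
qed

end

text \<open>If \<open>f\<close> is not zero, its kernel has codimension one; a vector orthogonal to
  the kernel represents \<open>f\<close> after rescaling.\<close>

lemma riesz_representation:
  fixes f :: "'h::hilbert_space \<Rightarrow> real"
  assumes "bounded_linear f"
  shows "\<exists>y. \<forall>x. f x = inner x y"
proof (cases "\<forall>x. f x = 0")
  case True
  then show ?thesis by (intro exI[of _ 0]) simp
next
  case False
  then obtain w where w: "f w \<noteq> 0" by blast
  interpret f: bounded_linear f by fact
  define L where "L = {x. f x = 0}"
  have "closed L"
    unfolding L_def by (intro closed_Collect_eq continuous_intros f.continuous_on)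
  moreover have "subspace L"
    by (auto simp: L_def subspace_def f.add f.scaleR f.zero)
  ultimately have L: "closed L" "subspace L" by auto
  define u where "u = w - app (proj L) w"
  have u: "inner u z = 0" if "z \<in> L" for z
    unfolding u_def using that by (rule proj_orth[OF L])
  have fu: "f u = f w"
    using proj_mem[OF L, of w] by (simp add: u_def f.diff L_def)
  with w have "u \<noteq> 0" using f.zero by auto
  have "f x = inner x ((f u / inner u u) *\<^sub>R u)" for x
  proof -
    have "x - (f x / f u) *\<^sub>R u \<in> L"
      using w fu by (simp add: L_def f.diff f.scaleR)
    then have "inner u (x - (f x / f u) *\<^sub>R u) = 0"
      by (rule u)
    then have "inner u x = f x / f u * inner u u"
      by (simp add: inner_diff_right inner_scaleR_right)
    then show ?thesis
      using w fu \<open>u \<noteq> 0\<close> by (simp add: inner_commute[of x u])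
  qed
  then show ?thesis by blast
qed

lemma adjoint_exists: "\<exists>S. \<forall>x y. inner (app T x) y = inner x (app S y)"
  for T :: "'h::hilbert_space endo"
proof -
  have "\<exists>z. \<forall>x. inner (app T x) y = inner x z" for y
    by (rule riesz_representation)
       (rule bounded_linear_compose[OF bounded_linear_inner_left bounded_linear_app])
  then obtain s where s: "inner (app T x) y = inner x (s y)" for x y
    by metis
  have eqI: "a = b" if "\<And>x. inner x a = inner x b" for a b :: 'h
    using that[of "a - b"] by (metis inner_diff_right inner_eq_zero_iff eq_iff_diff_eq_0)
  have "bounded_linear s"
  proof (rule bounded_linear_intro[where K = "norm T"])
    show "s (x + y) = s x + s y" for x y
      by (rule eqI) (simp add: inner_simps flip: s)
    show "s (r *\<^sub>R x) = r *\<^sub>R s x" for r x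
      by (rule eqI) (simp flip: s)
    show "norm (s x) \<le> norm x * norm T" for x
    proof (cases "s x = 0")
      case False
      have "(norm (s x))\<^sup>2 = inner (app T (s x)) x"
        by (simp add: power2_norm_eq_inner s)
      also have "\<dots> \<le> norm (app T (s x)) * norm x" by (rule norm_cauchy_schwarz)
      also have "\<dots> \<le> norm T * norm (s x) * norm x" by (simp add: norm_app_le mult_right_mono)
      finally show ?thesis
        using False by (simp add: power2_eq_square mult.commute mult.left_commute)
    qed simp
  qed
  then show ?thesis
    using s ex_endo by metis
qed

definition adj :: "'h::hilbert_space endo \<Rightarrow> 'h endo"
  where "adj T = (SOME S. \<forall>x y. inner (app T x) y = inner x (app S y))"

lemma inner_app_left: "inner (app T x) y = inner x (app (adj T) y)"
  unfolding adj_def using someI_ex[OF adjoint_exists[of T]] by blast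

lemma inner_app_right: "inner x (app T y) = inner (app (adj T) x) y"
  by (metis inner_app_left inner_commute)

lemma adj_eqI: 
  assumes "\<And>x y. inner (app T x) y = inner x (app S y)"
  shows "adj T = S"
proof (rule endo_eqI)
  fix y
  have "inner x (app (adj T) y - app S y) = 0" for x
    by (simp add: inner_diff_right assms flip: inner_app_left)
  then show "app (adj T) y = app S y" by (metis eq_iff_diff_eq_0 inner_eq_zero_iff)
qed

lemma adj_adj [simp]: "adj (adj T) = T"
  by (rule adj_eqI) (metis inner_app_left inner_commute)

lemma adj_mult: "adj (S * T) = adj T * adj S"
  by (rule adj_eqI) (simp add: inner_app_left)

lemma adj_add: "adj (S + T) = adj S + adj T"
  by (rule adj_eqI) (simp add: inner_app_left inner_simps)

lemma adj_diff: "adj (S - T) = adj S - adj T"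
  by (rule adj_eqI) (simp add: inner_app_left inner_simps)

lemma adj_uminus: "adj (- T) = - adj T"
  by (rule adj_eqI) (simp add: inner_app_left)

lemma adj_scaleR: "adj (r *\<^sub>R T) = r *\<^sub>R adj T"
  by (rule adj_eqI) (simp add: inner_app_left)

lemma adj_one [simp]: "adj 1 = 1"
  by (rule adj_eqI) simp

lemma adj_zero [simp]: "adj 0 = 0"
  by (rule adj_eqI) simp

lemma adj_power: "adj (T ^ n) = adj T ^ n"
  by (induction n) (simp_all add: adj_mult power_commutes)

lemma norm_adj_le: "norm (adj T) \<le> norm T"
proof (rule norm_endo_bound)
  fix x
  show "norm (app (adj T) x) \<le> norm T * norm x"
  proof (cases "app (adj T) x = 0")
    case False
    have "(norm (app (adj T) x))\<^sup>2 = inner (app T (app (adj T) x)) x"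
      by (simp add: power2_norm_eq_inner inner_app_left)
    also have "\<dots> \<le> norm (app T (app (adj T) x)) * norm x" by (rule norm_cauchy_schwarz)
    also have "\<dots> \<le> norm T * norm (app (adj T) x) * norm x" by (simp add: norm_app_le mult_right_mono)
    finally show ?thesis
      using False by (simp add: power2_eq_square mult.commute mult.left_commute)
  qed simp
qed simp

lemma bounded_linear_adj: "bounded_linear adj"
  by (rule bounded_linear_intro[where K = 1]) (simp_all add: adj_add adj_scaleR norm_adj_le)

lemma adj_proj: "closed L \<Longrightarrow> subspace L \<Longrightarrow> adj (proj L) = proj L"
  by (rule adj_eqI) (rule proj_inner)

text \<open>Invariance of \<open>L\<close> under \<open>U\<close> keeps the image of the projection
  inside \<open>L\<close>; invariance under the adjoint keeps the image of the remainder orthogonal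
  to \<open>L\<close>.\<close>

lemma proj_commute:
  assumes "closed L" "subspace L"
    and "app U ` L \<subseteq> L" "app (adj U) ` L \<subseteq> L"
  shows "proj L * U = U * proj L"
proof (rule endo_eqI)
  fix x
  have "app (proj L) (app U x) = app U (app (proj L) x)"
  proof (rule proj_eqI[OF assms(1,2)])
    show "app U (app (proj L) x) \<in> L"
      using assms(3) proj_mem[OF assms(1,2)] by blast
    fix z assume "z \<in> L"
    then have "app (adj U) z \<in> L" using assms(4) by blast
    then show "inner (app U x - app U (app (proj L) x)) z = 0"
      using proj_orth[OF assms(1,2)] by (simp add: inner_app_left flip: app.diff_right)
  qed
  then show "app (proj L * U) x = app (U * proj L) x" by simp
qed

section \<open>Positive operators and their square roots\<close>

text \<open>Self-adjointness is demanded separately because over real scalars it does not follow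
  from a nonnegative quadratic form.\<close>

definition positive :: "'h::hilbert_space endo \<Rightarrow> bool"
  where "positive T \<longleftrightarrow> adj T = T \<and> (\<forall>x. 0 \<le> inner (app T x) x)"

lemma positive_adj: "positive T \<Longrightarrow> adj T = T"
  by (simp add: positive_def)

lemma positive_inner: "positive T \<Longrightarrow> 0 \<le> inner (app T x) x"
  by (simp add: positive_def)

lemma self_adjoint_inner: "adj T = T \<Longrightarrow> inner (app T x) y = inner x (app T y)"
  by (simp add: inner_app_left)

lemma positive_adj_mult_self: "positive (adj B * B)"
  unfolding positive_def
proof
  show "\<forall>x. 0 \<le> inner (app (adj B * B) x) x"
    by (simp flip: inner_app_right)
qed (simp add: adj_mult)

lemma positive_cauchy_schwarz:
  assumes "positive T"
  shows "(inner (app T x) y)\<^sup>2 \<le> inner (app T x) x * inner (app T y) y"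
proof -
  define a b c where "a = inner (app T x) x" and "b = inner (app T x) y" and "c = inner (app T y) y"
  have b': "inner (app T y) x = b"
    using self_adjoint_inner[OF positive_adj[OF assms], of y x] by (simp add: b_def inner_commute)
  have quad: "0 \<le> a + 2 * r * b + r\<^sup>2 * c" for r
  proof -
    have "inner (app T (x + r *\<^sub>R y)) (x + r *\<^sub>R y) = a + 2 * r * b + r\<^sup>2 * c"
      using b' by (simp add: app.add_right app.scaleR_right inner_add_left inner_add_right
          a_def b_def c_def power2_eq_square algebra_simps)
    with positive_inner[OF assms] show ?thesis by metis
  qed
  have "0 \<le> c" unfolding c_def by (rule positive_inner[OF assms])
  have "b\<^sup>2 \<le> a * c"
  proof (cases "c = 0")
    case True
    have "b = 0"
    proof (rule ccontr)
      assume "b \<noteq> 0"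
      \<comment> \<open>With \<open>c = 0\<close> the polynomial is affine in \<open>r\<close>; this
        argument makes it take the value -1.\<close>
      then show False using quad[of "- (a + 1) / (2 * b)"] True by (simp add: field_simps)
    qed
    then show ?thesis using True by simp
  next
    case False
    then have "0 < c" using \<open>0 \<le> c\<close> by simp
    have "0 \<le> a + 2 * (- b / c) * b + (- b / c)\<^sup>2 * c" by (rule quad)
    also have "\<dots> = a - b\<^sup>2 / c"
      using False by (simp add: power2_eq_square field_simps)
    finally show ?thesis using \<open>0 < c\<close> by (simp add: field_simps)
  qed
  then show ?thesis by (simp add: a_def b_def c_def)
qed

text \<open>Cauchy-Schwarz for the form of \<open>T\<close>, applied to \<open>v\<close> and
  \<open>app T v\<close>. The upper bound is required on an invariant set \<open>V\<close> only,
  because it is later available only on the range of a difference of spectral projections.\<close>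

lemma positive_norm_square_le:
  assumes "positive T" and inv: "\<And>v. v \<in> V \<Longrightarrow> app T v \<in> V"
    and le: "\<And>v. v \<in> V \<Longrightarrow> inner (app T v) v \<le> b * (norm v)\<^sup>2" and "v \<in> V"
  shows "(norm (app T v))\<^sup>2 \<le> b * inner (app T v) v"
proof (cases "app T v = 0")
  case False
  define z where "z = app T v"
  have "((norm z)\<^sup>2)\<^sup>2 = (inner (app T v) z)\<^sup>2"
    by (simp add: z_def power2_norm_eq_inner)
  also have "\<dots> \<le> inner (app T v) v * inner (app T z) z"
    by (rule positive_cauchy_schwarz[OF assms(1)])
  also have "\<dots> \<le> inner (app T v) v * (b * (norm z)\<^sup>2)"
    using assms by (intro mult_left_mono le positive_inner) (auto simp: z_def)
  finally have "(norm z)\<^sup>2 * (norm z)\<^sup>2 \<le> (b * inner (app T v) v) * (norm z)\<^sup>2"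
    by (simp add: power2_eq_square mult_ac)
  moreover have "0 < (norm z)\<^sup>2" using False by (simp add: z_def)
  ultimately show ?thesis
    unfolding z_def by (rule mult_right_le_imp_le)
qed simp

lemma positive_app_eq_0:
  assumes "positive T" "inner (app T x) x = 0"
  shows "app T x = 0"
proof -
  have "(norm (app T x))\<^sup>2 \<le> norm T * inner (app T x) x"
  proof (rule positive_norm_square_le[OF assms(1), of UNIV])
    fix v
    have "inner (app T v) v \<le> norm (app T v) * norm v" by (rule norm_cauchy_schwarz)
    also have "\<dots> \<le> norm T * norm v * norm v" by (simp add: norm_app_le mult_right_mono)
    finally show "inner (app T v) v \<le> norm T * (norm v)\<^sup>2" by (simp add: power2_eq_square mult_ac)
  qed auto
  with assms(2) show ?thesis by simp
qed

lemma norm_positive_le: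
  assumes "positive T" "0 \<le> b" "\<And>x. inner (app T x) x \<le> b * (norm x)\<^sup>2"
  shows "norm T \<le> b"
proof (rule norm_endo_bound[OF assms(2)])
  fix x
  have "(norm (app T x))\<^sup>2 \<le> b * inner (app T x) x"
    using assms by (intro positive_norm_square_le[of T UNIV]) auto
  also have "\<dots> \<le> b * (b * (norm x)\<^sup>2)"
    using assms by (intro mult_left_mono) auto
  finally have "(norm (app T x))\<^sup>2 \<le> (b * norm x)\<^sup>2"
    by (simp add: power2_eq_square mult_ac)
  then show "norm (app T x) \<le> b * norm x"
    by (rule power2_le_imp_le) (use assms(2) in simp)
qed

lemma app_power_add: "app (T ^ (m + n)) x = app (T ^ m) (app (T ^ n) x)"
  by (simp add: power_add)

lemma power_inner_even:
  assumes "adj T = T"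
  shows "inner (app (T ^ (k + k)) x) x = (norm (app (T ^ k) x))\<^sup>2"
proof -
  have "adj (T ^ k) = T ^ k" using assms by (simp add: adj_power)
  then show ?thesis
    by (simp add: app_power_add self_adjoint_inner power2_norm_eq_inner)
qed

lemma power_inner_odd:
  assumes "adj T = T"
  shows "inner (app (T ^ Suc (k + k)) x) x = inner (app T (app (T ^ k) x)) (app (T ^ k) x)"
proof -
  have "app (T ^ Suc (k + k)) x = app (T ^ k) (app T (app (T ^ k) x))"
    by (simp add: power_add power_commutes flip: app_mult mult.assoc)
  moreover have "adj (T ^ k) = T ^ k" using assms by (simp add: adj_power)
  ultimately show ?thesis
    by (simp add: self_adjoint_inner)
qed

lemma even_odd_cases:
  obtains k where "n = k + k" | k where "n = Suc (k + k)"
  by (metis add_Suc_right even_iff_mod_2_eq_zero mult_2 oddE evenE Suc_eq_plus1)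

lemma positive_power:
  assumes "positive T"
  shows "positive (T ^ n)"
  unfolding positive_def
proof (intro conjI allI)
  show "adj (T ^ n) = T ^ n" using assms by (simp add: adj_power positive_adj)
  show "0 \<le> inner (app (T ^ n) x) x" for x
    by (cases n rule: even_odd_cases)
       (simp_all add: power_inner_even power_inner_odd positive_adj[OF assms] positive_inner[OF assms]
         del: power_Suc)
qed

lemma power_inner_Suc_le:
  assumes "positive T" and inv: "\<And>v. v \<in> V \<Longrightarrow> app T v \<in> V"
    and le: "\<And>v. v \<in> V \<Longrightarrow> inner (app T v) v \<le> b * (norm v)\<^sup>2" and "v \<in> V"
  shows "inner (app (T ^ Suc n) v) v \<le> b * inner (app (T ^ n) v) v"
proof -
  have V: "app (T ^ k) v \<in> V" for k
    using assms(4) inv by (induction k) auto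
  note sa = positive_adj[OF assms(1)]
  show ?thesis
  proof (cases n rule: even_odd_cases)
    case (1 k)
    then show ?thesis
      using le[OF V] by (simp add: power_inner_even[OF sa] power_inner_odd[OF sa] del: power_Suc)
  next
    case (2 k)
    then have n: "Suc n = Suc k + Suc k" by simp
    have "inner (app (T ^ Suc n) v) v = (norm (app T (app (T ^ k) v)))\<^sup>2"
      unfolding n power_inner_even[OF sa] by simp
    also have "\<dots> \<le> b * inner (app T (app (T ^ k) v)) (app (T ^ k) v)"
      using assms V by (intro positive_norm_square_le[of T V]) auto
    also have "\<dots> = b * inner (app (T ^ n) v) v"
      unfolding 2 power_inner_odd[OF sa] ..
    finally show ?thesis .
  qed
qed

lemma power_inner_le:
  assumes "positive T" "\<And>v. v \<in> V \<Longrightarrow> app T v \<in> V" "0 \<le> b"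
    and "\<And>v. v \<in> V \<Longrightarrow> inner (app T v) v \<le> b * (norm v)\<^sup>2" "v \<in> V"
  shows "inner (app (T ^ n) v) v \<le> b ^ n * (norm v)\<^sup>2"
proof (induction n)
  case (Suc n)
  have "inner (app (T ^ Suc n) v) v \<le> b * inner (app (T ^ n) v) v"
    using assms by (intro power_inner_Suc_le[of T V]) auto
  also have "\<dots> \<le> b * (b ^ n * (norm v)\<^sup>2)"
    using Suc assms(3) by (rule mult_left_mono)
  finally show ?case by (simp add: mult.assoc)
qed (simp add: power2_norm_eq_inner)

lemma power_inner_Suc_ge:
  assumes "positive T" and inv: "\<And>v. v \<in> V \<Longrightarrow> app T v \<in> V" and "0 \<le> a"
    and ge: "\<And>v. v \<in> V \<Longrightarrow> a * (norm v)\<^sup>2 \<le> inner (app T v) v" and "v \<in> V"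
  shows "a * inner (app (T ^ n) v) v \<le> inner (app (T ^ Suc n) v) v"
proof -
  have V: "app (T ^ k) v \<in> V" for k
    using assms(5) inv by (induction k) auto
  note sa = positive_adj[OF assms(1)]
  show ?thesis
  proof (cases n rule: even_odd_cases)
    case (1 k)
    then show ?thesis
      using ge[OF V] by (simp add: power_inner_even[OF sa] power_inner_odd[OF sa] del: power_Suc)
  next
    case (2 k)
    define w where "w = app (T ^ k) v"
    have w: "w \<in> V" unfolding w_def by (rule V)
    \<comment> \<open>The lower bound on the form together with Cauchy-Schwarz gives
      \<open>a * norm w \<le> norm (app T w)\<close>; Cauchy-Schwarz is then used once more.\<close>
    have "a * inner (app T w) w \<le> (norm (app T w))\<^sup>2"
    proof -
      have *: "inner (app T w) w \<le> norm (app T w) * norm w" by (rule norm_cauchy_schwarz)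
      have "a * norm w \<le> norm (app T w)"
      proof (cases "norm w = 0")
        case False
        have "(a * norm w) * norm w \<le> norm (app T w) * norm w"
          using ge[OF w] * by (simp add: power2_eq_square mult_ac)
        then show ?thesis using False by (simp add: mult_right_le_imp_le)
      qed simp
      then have "a * norm w * norm (app T w) \<le> norm (app T w) * norm (app T w)"
        by (rule mult_right_mono) simp
      moreover have "a * inner (app T w) w \<le> a * (norm (app T w) * norm w)"
        using * assms(3) by (rule mult_left_mono)
      ultimately show ?thesis by (simp add: power2_eq_square mult_ac)
    qed
    moreover have n: "Suc n = Suc k + Suc k" using 2 by simp
    ultimately show ?thesis
      unfolding n power_inner_even[OF sa] unfolding 2 power_inner_odd[OF sa] by (simp add: w_def)
  qed
qed

lemma power_inner_ge:
  assumes "positive T" "\<And>v. v \<in> V \<Longrightarrow> app T v \<in> V" "0 \<le> a"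
    and "\<And>v. v \<in> V \<Longrightarrow> a * (norm v)\<^sup>2 \<le> inner (app T v) v" "v \<in> V"
  shows "a ^ n * (norm v)\<^sup>2 \<le> inner (app (T ^ n) v) v"
proof (induction n)
  case (Suc n)
  have "a * (a ^ n * (norm v)\<^sup>2) \<le> a * inner (app (T ^ n) v) v"
    using Suc assms(3) by (rule mult_left_mono)
  also have "\<dots> \<le> inner (app (T ^ Suc n) v) v"
    using assms by (intro power_inner_Suc_ge[of T V]) auto
  finally show ?case by (simp add: mult.assoc)
qed (simp add: power2_norm_eq_inner)

text \<open>The coefficients of \<open>sqrt (1 - x)\<close> are summable up to the boundary of the disc of convergence:
  all but the first are negative, and their partial sums are again binomial coefficients.\<close>

definition sqrt_coeff :: "nat \<Rightarrow> real"
  where "sqrt_coeff n = (1/2 gchoose n) * (-1) ^ n"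

lemma sqrt_coeff_0 [simp]: "sqrt_coeff 0 = 1"
  by (simp add: sqrt_coeff_def)

lemma sqrt_coeff_Suc_le_0: "sqrt_coeff (Suc n) \<le> 0"
proof -
  have "sqrt_coeff (Suc n) = pochhammer (- (1/2)) (Suc n) / fact (Suc n)"
    by (simp add: sqrt_coeff_def gbinomial_pochhammer)
  also have "\<dots> = - (1/2 * pochhammer (1/2) n / fact (Suc n))"
    by (simp add: pochhammer_rec)
  also have "\<dots> \<le> 0"
    by (simp add: pochhammer_nonneg)
  finally show ?thesis .
qed

lemma sum_sqrt_coeff_nonneg: "0 \<le> (\<Sum>k\<le>n. sqrt_coeff k)"
proof -
  have "(\<Sum>k\<le>n. sqrt_coeff k) = (-1) ^ n * ((1/2 - 1) gchoose n)"
    unfolding sqrt_coeff_def by (rule gbinomial_sum_lower_neg)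
  also have "\<dots> = pochhammer (1/2) n / fact n"
    by (simp add: gbinomial_pochhammer)
  finally show ?thesis
    by (simp add: pochhammer_nonneg)
qed

lemma sum_sqrt_coeff_le: "(\<Sum>k<n. - sqrt_coeff (Suc k)) \<le> 1"
  using sum_sqrt_coeff_nonneg[of n] sum.atMost_shift[of sqrt_coeff n] sqrt_coeff_0
  unfolding sum_negf by linarith

lemma summable_sqrt_coeff_Suc: "summable (\<lambda>n. - sqrt_coeff (Suc n))"
proof (rule summableI_nonneg_bounded)
  show "0 \<le> - sqrt_coeff (Suc n)" for n using sqrt_coeff_Suc_le_0[of n] by linarith
qed (rule sum_sqrt_coeff_le)

lemma summable_abs_sqrt_coeff: "summable (\<lambda>n. \<bar>sqrt_coeff n\<bar>)"
proof -
  have "(\<lambda>n. \<bar>sqrt_coeff (Suc n)\<bar>) = (\<lambda>n. - sqrt_coeff (Suc n))"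
    using sqrt_coeff_Suc_le_0 by (intro ext) auto
  then have "summable (\<lambda>n. \<bar>sqrt_coeff (Suc n)\<bar>)"
    using summable_sqrt_coeff_Suc by simp
  then show ?thesis
    by (subst (asm) summable_Suc_iff)
qed

text \<open>The square of the series is \<open>1 - x\<close>: Vandermonde's identity with 1/2 + 1/2
  = 1.\<close>

lemma sqrt_coeff_convolution:
  "(\<Sum>i\<le>n. sqrt_coeff i * sqrt_coeff (n - i)) = (if n = 0 then 1 else if n = 1 then - 1 else 0)"
proof -
  have "(\<Sum>i\<le>n. sqrt_coeff i * sqrt_coeff (n - i)) =
      (\<Sum>i\<le>n. (-1) ^ n * ((1/2 gchoose i) * (1/2 gchoose (n - i))))"
    by (rule sum.cong) (auto simp: sqrt_coeff_def simp flip: power_add)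
  also have "\<dots> = (-1) ^ n * (1 gchoose n)"
    using gbinomial_Vandermonde[of "1/2 :: real" "1/2" n]
    by (simp add: atLeast0AtMost flip: sum_distrib_left)
  also have "(1 :: real) gchoose n = of_nat (1 choose n)"
    by (metis binomial_gbinomial of_nat_1)
  also have "(-1) ^ n * real (1 choose n) = (if n = 0 then 1 else if n = 1 then - 1 else 0)"
    by (cases n) (auto simp: binomial_eq_0)
  finally show ?thesis .
qed

text \<open>The binomial series converges absolutely at \<open>A\<close> even if its norm is 1, and
  the Cauchy product computes the square. The commutation clause is what later yields uniqueness of
  the root and invariance of spectral subspaces.\<close>

lemma sqrt_one_minus_exists:
  fixes A :: "'h::hilbert_space endo"
  assumes "adj A = A" "norm A \<le> 1"
  shows "\<exists>S. positive S \<and> S * S = 1 - A \<and> (\<forall>Z. Z * A = A * Z \<longrightarrow> Z * S = S * Z)"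
proof -
  define f where "f n = sqrt_coeff n *\<^sub>R A ^ n" for n
  have nA: "norm (A ^ n) \<le> 1" for n
    using norm_power_ineq[of A n] power_le_one[OF norm_ge_zero assms(2), of n] by linarith
  have nf: "norm (f n) \<le> \<bar>sqrt_coeff n\<bar>" for n
    using mult_left_mono[OF nA, of "\<bar>sqrt_coeff n\<bar>"] by (simp add: f_def)
  have sn: "summable (\<lambda>n. norm (f n))"
    by (rule summable_comparison_test'[OF summable_abs_sqrt_coeff, of 0]) (simp add: nf)
  then have sf: "summable f" by (rule summable_norm_cancel)
  define S where "S = suminf f"
  have "S * S = suminf (\<lambda>k. \<Sum>i\<le>k. f i * f (k - i))"
    unfolding S_def by (rule Cauchy_product[OF sn sn])
  also have "(\<lambda>k. \<Sum>i\<le>k. f i * f (k - i)) = (\<lambda>k. (if k = 0 then 1 else if k = 1 then - 1 else 0) *\<^sub>R A ^ k)"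
  proof
    fix k
    have "(\<Sum>i\<le>k. f i * f (k - i)) = (\<Sum>i\<le>k. (sqrt_coeff i * sqrt_coeff (k - i)) *\<^sub>R A ^ k)"
      by (rule sum.cong) (auto simp: f_def simp flip: power_add)
    also have "\<dots> = (\<Sum>i\<le>k. sqrt_coeff i * sqrt_coeff (k - i)) *\<^sub>R A ^ k"
      by (simp add: scaleR_sum_left)
    finally show "(\<Sum>i\<le>k. f i * f (k - i)) = (if k = 0 then 1 else if k = 1 then - 1 else 0) *\<^sub>R A ^ k"
      by (simp only: sqrt_coeff_convolution)
  qed
  also have "suminf (\<lambda>k. (if k = 0 then 1 else if k = 1 then - 1 else (0::real)) *\<^sub>R A ^ k) =
      (\<Sum>k\<in>{0,1}. (if k = 0 then 1 else if k = 1 then - 1 else (0::real)) *\<^sub>R A ^ k)"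
    by (rule suminf_finite) auto
  finally have SS: "S * S = 1 - A" by simp
  have adjS: "adj S = S"
  proof -
    have "adj S = suminf (\<lambda>n. adj (f n))"
      unfolding S_def by (rule bounded_linear.suminf[OF bounded_linear_adj sf])
    also have "(\<lambda>n. adj (f n)) = f"
      using assms(1) by (intro ext) (simp add: f_def adj_scaleR adj_power)
    finally show ?thesis by (simp add: S_def)
  qed
  have commS: "Z * S = S * Z" if "Z * A = A * Z" for Z
  proof -
    have "Z * A ^ n = A ^ n * Z" for n
      using that by (metis power_commuting_commutes)
    then have "(\<lambda>n. Z * f n) = (\<lambda>n. f n * Z)"
      by (intro ext) (simp add: f_def)
    moreover have "Z * S = suminf (\<lambda>n. Z * f n)"
      unfolding S_def by (rule bounded_linear.suminf[OF bounded_linear_mult_right sf])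
    moreover have "S * Z = suminf (\<lambda>n. f n * Z)"
      unfolding S_def by (rule bounded_linear.suminf[OF bounded_linear_mult_left sf])
    ultimately show ?thesis by simp
  qed
  \<comment> \<open>Positivity of \<open>S = 1 - R\<close> needs only \<open>norm R \<le> 1\<close>:
    the coefficients of \<open>R\<close> are nonnegative and add up to at most 1.\<close>
  define R where "R = suminf (\<lambda>n. - f (Suc n))"
  have SR: "S = 1 - R"
    using suminf_split_head[OF sf] summable_ignore_initial_segment[OF sf, of 1]
    by (simp add: S_def R_def suminf_minus f_def)
  have "norm R \<le> suminf (\<lambda>n. - sqrt_coeff (Suc n))"
  proof -
    have "norm R \<le> suminf (\<lambda>n. norm (- f (Suc n)))"
      unfolding R_def using sn by (intro summable_norm) (simp add: summable_Suc_iff[of "\<lambda>n. norm (f n)"])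
    also have "\<dots> \<le> suminf (\<lambda>n. - sqrt_coeff (Suc n))"
    proof (rule suminf_le)
      show "norm (- f (Suc n)) \<le> - sqrt_coeff (Suc n)" for n
        using nf[of "Suc n"] sqrt_coeff_Suc_le_0[of n] by simp
      show "summable (\<lambda>n. norm (- f (Suc n)))"
        using sn by (simp add: summable_Suc_iff[of "\<lambda>n. norm (f n)"])
    qed (rule summable_sqrt_coeff_Suc)
    finally show ?thesis .
  qed
  also have "\<dots> \<le> 1"
    by (rule suminf_le_const[OF summable_sqrt_coeff_Suc sum_sqrt_coeff_le])
  finally have nR: "norm R \<le> 1" .
  have "0 \<le> inner (app S x) x" for x
  proof -
    have "inner (app R x) x \<le> norm (app R x) * norm x" by (rule norm_cauchy_schwarz)
    also have "\<dots> \<le> (1 * norm x) * norm x"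
      using norm_app_le[of R x] mult_right_mono[OF nR, of "norm x"]
      by (intro mult_right_mono) auto
    finally show ?thesis
      by (simp add: SR inner_diff_left dot_square_norm power2_eq_square)
  qed
  with adjS SS commS show ?thesis
    unfolding positive_def by blast
qed

theorem positive_sqrt_exists:
  assumes "positive C"
  shows "\<exists>S. positive S \<and> S * S = C \<and> (\<forall>Z. Z * C = C * Z \<longrightarrow> Z * S = S * Z)"
proof (cases "C = 0")
  case True
  then show ?thesis by (intro exI[of _ 0]) (simp add: positive_def)
next
  case False
  define m where "m = norm C"
  have m: "m > 0" using False by (simp add: m_def)
  \<comment> \<open>The scaling puts \<open>C\<close> between 0 and \<open>m\<close>, so that
    \<open>A\<close> lies between 0 and 1 and has norm at most 1.\<close>
  define A where "A = 1 - (1/m) *\<^sub>R C"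
  have "adj A = A" using positive_adj[OF assms] by (simp add: A_def adj_diff adj_scaleR)
  have form: "inner (app A x) x = (norm x)\<^sup>2 - inner (app C x) x / m" for x
    by (simp add: A_def inner_diff_left dot_square_norm)
  have "inner (app C x) x \<le> m * (norm x)\<^sup>2" for x
  proof -
    have "inner (app C x) x \<le> norm (app C x) * norm x" by (rule norm_cauchy_schwarz)
    also have "\<dots> \<le> m * norm x * norm x" by (simp add: norm_app_le mult_right_mono m_def)
    finally show ?thesis by (simp add: power2_eq_square mult_ac)
  qed
  then have "positive A"
    unfolding positive_def form using \<open>adj A = A\<close> m by (simp add: field_simps)
  moreover have "inner (app A x) x \<le> 1 * (norm x)\<^sup>2" for x
    using form[of x] positive_inner[OF assms, of x] m by simp
  ultimately have "norm A \<le> 1"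
    by (intro norm_positive_le) auto
  from sqrt_one_minus_exists[OF \<open>adj A = A\<close> this]
  obtain S where S: "positive S" "S * S = 1 - A" "\<And>Z. Z * A = A * Z \<Longrightarrow> Z * S = S * Z"
    by blast
  define S' where "S' = sqrt m *\<^sub>R S"
  have "positive S'"
    using S(1) m by (simp add: S'_def positive_def adj_scaleR)
  moreover have "S' * S' = C"
    using S(2) m by (simp add: S'_def A_def)
  moreover have "Z * S' = S' * Z" if "Z * C = C * Z" for Z
  proof -
    have "Z * A = A * Z" using that by (simp add: A_def algebra_simps)
    then show ?thesis using S(3) by (simp add: S'_def)
  qed
  ultimately show ?thesis by blast
qed

text \<open>Both roots are compared with the root \<open>R\<close> obtained from the series. Any
  other root commutes with the common square, hence with \<open>R\<close>, and for commuting roots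
  the difference of squares factorises.\<close>

theorem positive_sqrt_unique:
  assumes "positive S" "positive T" "S * S = T * T"
  shows "S = T"
proof -
  have "positive (T * T)"
    using positive_power[OF assms(2), of 2] by (simp add: power2_eq_square)
  then obtain R where R: "positive R" "R * R = T * T" "\<And>Z. Z * (T * T) = (T * T) * Z \<Longrightarrow> Z * R = R * Z"
    using positive_sqrt_exists by blast
  have "P = R" if P: "positive P" "P * P = T * T" for P
  proof (rule endo_eqI)
    fix x
    have comm: "P * R = R * P"
      using P(2) by (intro R(3)) (metis mult.assoc)
    define y where "y = app (P - R) x"
    have "(P + R) * (P - R) = 0"
      using P(2) R(2) comm by (simp add: algebra_simps)
    \<comment> \<open>Two nonnegative forms add up to 0 at \<open>y\<close>, so both vanish there
      and \<open>y\<close> lies in both kernels.\<close>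
    then have "app P y + app R y = 0"
      unfolding y_def by (metis app_add app_mult app_zero)
    then have "inner (app P y) y + inner (app R y) y = 0"
      by (metis inner_add_left inner_zero_left)
    then have "inner (app P y) y = 0" "inner (app R y) y = 0"
      using positive_inner[OF P(1), of y] positive_inner[OF R(1), of y] by linarith+
    then have "app P y = 0" "app R y = 0"
      using positive_app_eq_0[OF P(1)] positive_app_eq_0[OF R(1)] by blast+
    then have "app (P - R) y = 0" by simp
    moreover have "adj (P - R) = P - R"
      using P(1) R(1) by (simp add: adj_diff positive_adj)
    ultimately have "inner y y = 0"
      using self_adjoint_inner[of "P - R" x y] by (simp add: y_def)
    then show "app P x = app R x" by (simp add: y_def)
  qed
  then show ?thesis using assms by metis
qed

section \<open>Spectral subspaces\<close>

text \<open>The subspace is the kernel of the positive part of \<open>S = T - c\<close>, that is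
  \<open>{x. \<bar>S\<bar> x = - S x}\<close>.\<close>

theorem spectral_subspace_exists:
  fixes T :: "'h::hilbert_space endo"
  assumes "adj T = T"
  shows "\<exists>L. closed L \<and> subspace L \<and> (\<forall>U. U * T = T * U \<longrightarrow> app U ` L \<subseteq> L) \<and>
    (\<forall>x\<in>L. inner (app T x) x \<le> c * (norm x)\<^sup>2) \<and>
    (\<forall>x. (\<forall>z\<in>L. inner x z = 0) \<longrightarrow> x \<noteq> 0 \<longrightarrow> c * (norm x)\<^sup>2 < inner (app T x) x)"
proof -
  define S where "S = T - c *\<^sub>R 1"
  have adjS: "adj S = S" by (simp add: S_def adj_diff adj_scaleR assms)
  have "positive (S * S)"
    using positive_adj_mult_self[of S] by (simp add: adjS)
  then obtain N where N: "positive N" "N * N = S * S"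
    "\<And>Z. Z * (S * S) = (S * S) * Z \<Longrightarrow> Z * N = N * Z"
    using positive_sqrt_exists by blast
  have NS: "S * N = N * S" by (rule N(3)) (simp add: mult.assoc)
  have formS: "inner (app S x) x = inner (app T x) x - c * (norm x)\<^sup>2" for x
    by (simp add: S_def inner_diff_left dot_square_norm)
  define L where "L = {x. app N x = - app S x}"
  have "closed L"
    unfolding L_def
    by (intro closed_Collect_eq continuous_on_minus linear_continuous_on bounded_linear_app)
  moreover have "subspace L"
    by (auto simp: L_def subspace_def app.add_right app.scaleR_right app.zero_right)
  moreover have "app U ` L \<subseteq> L" if U: "U * T = T * U" for U
  proof -
    have US: "U * S = S * U" using U by (simp add: S_def algebra_simps)
    then have UN: "U * N = N * U" by (intro N(3)) (metis mult.assoc)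
    have "app N (app U x) = - app S (app U x)" if "app N x = - app S x" for x
    proof -
      have "app N (app U x) = app U (app N x)" using UN by (metis app_mult)
      also have "\<dots> = - app U (app S x)" by (simp add: that app.minus_right)
      also have "\<dots> = - app S (app U x)" using US by (metis app_mult)
      finally show ?thesis .
    qed
    then show ?thesis by (auto simp: L_def)
  qed
  moreover have "inner (app T x) x \<le> c * (norm x)\<^sup>2" if "x \<in> L" for x
  proof -
    have "inner (app S x) x = - inner (app N x) x" using that by (simp add: L_def)
    then show ?thesis using formS[of x] positive_inner[OF N(1), of x] by simp
  qed
  moreover have "c * (norm x)\<^sup>2 < inner (app T x) x" if x: "\<forall>z\<in>L. inner x z = 0" "x \<noteq> 0" for x
  proof -
    \<comment> \<open>\<open>N - S\<close> is twice the negative part of \<open>S\<close>, and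
      \<open>N + S\<close> annihilates it, so its range lies in \<open>L\<close>. Orthogonality of
      \<open>x\<close> to this range turns the form of \<open>S\<close> at \<open>x\<close> into
      that of \<open>N\<close>.\<close>
    have "app N (app (N - S) x) = - app S (app (N - S) x)"
    proof -
      have "N * (N - S) = - S * (N - S)" using N(2) NS by (simp add: algebra_simps)
      then show ?thesis by (metis app_mult app_uminus)
    qed
    then have "app (N - S) x \<in> L" by (simp add: L_def)
    then have "inner x (app (N - S) x) = 0" using x(1) by blast
    then have eq: "inner (app S x) x = inner (app N x) x"
      by (simp add: inner_diff_right inner_commute)
    \<comment> \<open>Otherwise \<open>N\<close> and \<open>S\<close> both kill \<open>x\<close>,
      which puts \<open>x\<close> into \<open>L\<close> and makes it orthogonal to itself. This
      gives the strict inequality.\<close>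
    have "inner (app N x) x \<noteq> 0"
    proof
      assume "inner (app N x) x = 0"
      then have "app N x = 0" by (rule positive_app_eq_0[OF N(1)])
      moreover have "app S x = 0"
      proof -
        have "inner (app S x) (app S x) = inner (app (S * S) x) x"
          using self_adjoint_inner[OF adjS] by simp
        also have "\<dots> = inner (app (N * N) x) x" by (simp only: N(2))
        finally show ?thesis using \<open>app N x = 0\<close> by (simp add: app.zero_right)
      qed
      ultimately have "x \<in> L" by (simp add: L_def)
      then show False using x by auto
    qed
    then show ?thesis
      using eq formS[of x] positive_inner[OF N(1), of x] by linarith
  qed
  ultimately show ?thesis by blast
qed

section \<open>Limits of contractions and of projections\<close>

lemma Cauchy_norm_square:
  fixes u :: "nat \<Rightarrow> 'h::real_normed_vector" and q :: "nat \<Rightarrow> real"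
  assumes "convergent q"
    and "\<And>m n. m \<le> n \<Longrightarrow> (norm (u m - u n))\<^sup>2 \<le> \<bar>q m - q n\<bar>"
  shows "Cauchy u"
proof (rule CauchyI)
  fix e :: real assume "0 < e"
  have "Cauchy q" using assms(1) by (rule convergent_Cauchy)
  then obtain M where M: "\<And>m n. m \<ge> M \<Longrightarrow> n \<ge> M \<Longrightarrow> norm (q m - q n) < e\<^sup>2"
    using \<open>0 < e\<close> by (metis CauchyD zero_less_power)
  have "norm (u m - u n) < e" if "m \<ge> M" "n \<ge> M" for m n
  proof -
    have "(norm (u m - u n))\<^sup>2 \<le> \<bar>q m - q n\<bar>"
      using assms(2)[of m n] assms(2)[of n m]
      by (cases "m \<le> n") (auto simp: norm_minus_commute abs_minus_commute)
    also have "\<dots> < e\<^sup>2" using M[OF that] by simp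
    finally show ?thesis using \<open>0 < e\<close> by (simp add: power_less_imp_less_base)
  qed
  then show "\<exists>M. \<forall>m\<ge>M. \<forall>n\<ge>M. norm (u m - u n) < e" by blast
qed

text \<open>The numbers \<open>q m\<close> decrease, and the squared distance of the
  \<open>m\<close>-th and \<open>n\<close>-th iterate is
  \<open>q (2 * m) + q (2 * n) - 2 * q (m + n)\<close>, at most \<open>q (2 * m) - q (2 * n)\<close>
  for \<open>m \<le> n\<close>. So the iterates form a Cauchy sequence. The limit is the orthogonal
  projection of \<open>x\<close> onto the fixed vectors.\<close>

lemma contraction_powers_converge:
  fixes X :: "'h::hilbert_space endo"
  assumes "positive X" "positive (1 - X)"
  shows "\<exists>v. (\<lambda>m. app (X ^ m) x) \<longlonglongrightarrow> v \<and> app X v = v \<and>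
    (\<forall>z. app X z = z \<longrightarrow> inner (x - v) z = 0)"
proof -
  note sa = positive_adj[OF assms(1)]
  define q where "q m = inner (app (X ^ m) x) x" for m
  have le1: "inner (app X v) v \<le> 1 * (norm v)\<^sup>2" for v
    using positive_inner[OF assms(2), of v] by (simp add: inner_diff_left dot_square_norm)
  have dec: "q (Suc m) \<le> q m" for m
    using power_inner_Suc_le[OF assms(1), of UNIV 1 x m] le1 by (simp add: q_def)
  then have "decseq q" by (rule decseq_SucI)
  have q0: "0 \<le> q m" for m
    unfolding q_def by (rule positive_inner[OF positive_power[OF assms(1)]])
  have conv: "convergent q"
    using decseq_convergent[OF \<open>decseq q\<close>] q0 by (metis convergentI)
  define u where "u m = app (X ^ m) x" for m
  have 1: "(norm (u m - u n))\<^sup>2 \<le> \<bar>q (2 * m) - q (2 * n)\<bar>" if "m \<le> n" for m n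
  proof -
    have uu: "inner (u m) (u n) = q (m + n)" for m n
    proof -
      have "adj (X ^ n) = X ^ n" using sa by (simp add: adj_power)
      then have "inner (u m) (u n) = inner (app (X ^ n) (app (X ^ m) x)) x"
        unfolding u_def by (rule self_adjoint_inner[symmetric])
      then show ?thesis by (simp add: q_def add.commute flip: app_power_add)
    qed
    have "(norm (u m - u n))\<^sup>2 = q (m + m) - q (m + n) - (q (n + m) - q (n + n))"
      unfolding power2_norm_eq_inner inner_diff_left inner_diff_right uu by simp
    then have "(norm (u m - u n))\<^sup>2 = q (2 * m) + q (2 * n) - 2 * q (m + n)"
      by (simp only: mult_2 add.commute[of n m])
    moreover have "q (2 * n) \<le> q (m + n)" "q (2 * n) \<le> q (2 * m)"
      using \<open>decseq q\<close> that by (auto simp: decseq_def)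
    ultimately show ?thesis by linarith
  qed
  have "convergent (\<lambda>m. q (2 * m))"
    using convergent_subseq_convergent[OF conv, of "\<lambda>m. 2 * m"]
    by (simp add: strict_mono_def o_def)
  then have "Cauchy u" by (rule Cauchy_norm_square) (rule 1)
  then obtain v where v: "u \<longlonglongrightarrow> v"
    using Cauchy_convergent convergent_def by blast
  have "app X v = v"
  proof (rule LIMSEQ_unique)
    show "(\<lambda>m. u (Suc m)) \<longlonglongrightarrow> v" using v by (rule LIMSEQ_Suc)
    show "(\<lambda>m. u (Suc m)) \<longlonglongrightarrow> app X v"
      using app.tendsto[OF tendsto_const v, of X] by (simp add: u_def)
  qed
  moreover have "inner (x - v) z = 0" if "app X z = z" for z
  proof -
    have "app (X ^ m) z = z" for m
      using that by (induction m) auto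
    then have "inner (u m) z = inner x z" for m
      using sa self_adjoint_inner[of "X ^ m" x z] by (simp add: u_def adj_power)
    moreover have "(\<lambda>m. inner (u m) z) \<longlonglongrightarrow> inner v z"
      by (intro tendsto_intros v)
    ultimately have "inner x z = inner v z"
      by (simp add: LIMSEQ_const_iff)
    then show ?thesis by (simp add: inner_diff_left)
  qed
  ultimately show ?thesis using v unfolding u_def by blast
qed

text \<open>Pythagoras turns squared distances between the projected vectors into differences of a
  decreasing sequence. This is the source of right-continuity of the spectral density.\<close>

lemma proj_decseq_tendsto:
  fixes L :: "nat \<Rightarrow> 'h::hilbert_space set"
  assumes L: "\<And>n. closed (L n)" "\<And>n. subspace (L n)" and "decseq L"
  shows "(\<lambda>n. app (proj (L n)) x) \<longlonglongrightarrow> app (proj (\<Inter>n. L n)) x"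
proof -
  define u where "u n = app (proj (L n)) x" for n
  define q where "q n = (norm (u n))\<^sup>2" for n
  have eq: "(norm (u m - u n))\<^sup>2 = q m - q n" if "m \<le> n" for m n
  proof -
    have "u n \<in> L m"
      using \<open>decseq L\<close> that proj_mem[OF L, of n x] by (auto simp: decseq_def u_def)
    then have "inner (x - u m) (u n) = 0" "inner (x - u n) (u n) = 0"
      unfolding u_def using proj_orth[OF L] proj_mem[OF L] by auto
    then have "inner (u m) (u n) = inner (u n) (u n)"
      by (simp add: inner_diff_left)
    then show ?thesis
      by (simp add: q_def power2_norm_eq_inner inner_diff_left inner_diff_right inner_commute[of "u n" "u m"])
  qed
  have "decseq q"
    unfolding decseq_def using eq by (metis diff_ge_0_iff_ge zero_le_power2)
  then have "convergent q"
    using decseq_convergent[of q 0] by (metis convergentI q_def zero_le_power2)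
  then have "Cauchy u"
    by (rule Cauchy_norm_square) (simp add: eq)
  then obtain v where v: "u \<longlonglongrightarrow> v"
    using Cauchy_convergent convergent_def by blast
  have "app (proj (\<Inter>n. L n)) x = v"
  proof (rule proj_eqI)
    show "closed (\<Inter>n. L n)" using L by blast
    show "subspace (\<Inter>n. L n)" using L by (auto simp: subspace_def)
    have "v \<in> L m" for m
    proof (rule closed_sequentially[OF L(1)])
      show "(\<lambda>n. u (n + m)) \<longlonglongrightarrow> v" using v by (rule LIMSEQ_ignore_initial_segment)
      show "u (n + m) \<in> L m" for n
        using decseqD[OF \<open>decseq L\<close>, of m "n + m"] proj_mem[OF L, of "n + m" x]
        by (auto simp: u_def)
    qed
    then show "v \<in> (\<Inter>n. L n)" by blast
    show "inner (x - v) z = 0" if "z \<in> (\<Inter>n. L n)" for z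
    proof -
      have "inner (x - u n) z = 0" for n
        unfolding u_def using that by (intro proj_orth[OF L]) auto
      moreover have "(\<lambda>n. inner (x - u n) z) \<longlonglongrightarrow> inner (x - v) z"
        by (intro tendsto_intros v)
      ultimately show ?thesis by (simp add: LIMSEQ_const_iff)
    qed
  qed
  with v show ?thesis unfolding u_def[abs_def] by simp
qed

section \<open>Traces and von Neumann dimensions\<close>

definition commutant :: "'h::hilbert_space endo set \<Rightarrow> 'h endo set"
  where "commutant \<U> = {T. \<forall>u\<in>\<U>. T * u = u * T}"

text \<open>For a group, \<open>e i\<close> will be the unit vector at the neutral element in the
  \<open>i\<close>-th summand, and this is the real part of the von Neumann trace.\<close>

definition op_trace :: "nat \<Rightarrow> (nat \<Rightarrow> 'h) \<Rightarrow> 'h::hilbert_space endo \<Rightarrow> real"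
  where "op_trace p e T = (\<Sum>i<p. inner (app T (e i)) (e i))"

lemma bounded_linear_op_trace: "bounded_linear (op_trace p e)"
  unfolding op_trace_def
  by (intro bounded_linear_sum bounded_linear_compose[OF bounded_linear_inner_left]
      app.bounded_linear_left)

lemmas op_trace_diff = linear_diff[OF bounded_linear.linear[OF bounded_linear_op_trace]]
  and op_trace_add = linear_add[OF bounded_linear.linear[OF bounded_linear_op_trace]]
  and op_trace_scaleR = linear_scale[OF bounded_linear.linear[OF bounded_linear_op_trace]]
  and op_trace_sum = linear_sum[OF bounded_linear.linear[OF bounded_linear_op_trace]]

lemma op_trace_adj: "op_trace p e (adj T) = op_trace p e T"
  unfolding op_trace_def by (rule sum.cong[OF refl]) (metis inner_app_right inner_commute)

lemma op_trace_nonneg: "(\<And>x. 0 \<le> inner (app T x) x) \<Longrightarrow> 0 \<le> op_trace p e T"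
  unfolding op_trace_def by (intro sum_nonneg) auto

lemma commutantD: "T \<in> commutant \<U> \<Longrightarrow> u \<in> \<U> \<Longrightarrow> T * u = u * T"
  by (simp add: commutant_def)

lemma commutant_mult: "S \<in> commutant \<U> \<Longrightarrow> T \<in> commutant \<U> \<Longrightarrow> S * T \<in> commutant \<U>"
  unfolding commutant_def by simp (metis mult.assoc)

lemma commutant_add: "S \<in> commutant \<U> \<Longrightarrow> T \<in> commutant \<U> \<Longrightarrow> S + T \<in> commutant \<U>"
  by (simp add: commutant_def algebra_simps)

lemma commutant_diff: "S \<in> commutant \<U> \<Longrightarrow> T \<in> commutant \<U> \<Longrightarrow> S - T \<in> commutant \<U>"
  by (simp add: commutant_def algebra_simps)

lemma commutant_scaleR: "T \<in> commutant \<U> \<Longrightarrow> r *\<^sub>R T \<in> commutant \<U>"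
  by (simp add: commutant_def)

lemma commutant_one: "1 \<in> commutant \<U>"
  by (simp add: commutant_def)

lemma commutant_zero: "0 \<in> commutant \<U>"
  by (simp add: commutant_def)

lemma commutant_power: "T \<in> commutant \<U> \<Longrightarrow> T ^ n \<in> commutant \<U>"
  by (induction n) (auto intro: commutant_one commutant_mult)

lemma commutant_sum: "(\<And>i. i \<in> A \<Longrightarrow> f i \<in> commutant \<U>) \<Longrightarrow> (\<Sum>i\<in>A. f i) \<in> commutant \<U>"
  by (induction A rule: infinite_finite_induct) (auto intro: commutant_zero commutant_add)

text \<open>The ambient Hilbert space consists of functions on a whole type, whereas the Hilbert
  module consists of those supported on the index set. \<open>Q\<close> is the projection onto the
  latter; it is why faithfulness ends in \<open>T * Q = 0\<close> and not in
  \<open>T = 0\<close>.\<close>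

locale tracial =
  fixes \<U> :: "'h::hilbert_space endo set" and p :: nat and e :: "nat \<Rightarrow> 'h" and Q :: "'h endo"
  assumes adj_closed: "u \<in> \<U> \<Longrightarrow> adj u \<in> \<U>"
    and trace_commute: "S \<in> commutant \<U> \<Longrightarrow> T \<in> commutant \<U> \<Longrightarrow>
      op_trace p e (S * T) = op_trace p e (T * S)"
    and faithful: "T \<in> commutant \<U> \<Longrightarrow> (\<And>i. i < p \<Longrightarrow> app T (e i) = 0) \<Longrightarrow> T * Q = 0"
    and norm_e: "i < p \<Longrightarrow> norm (e i) = 1"
    and Q_mem: "Q \<in> \<U>" and Q_idem: "Q * Q = Q" and Q_adj: "adj Q = Q"
    and Q_central: "u \<in> \<U> \<Longrightarrow> u * Q = Q * u"
    and Q_e: "i < p \<Longrightarrow> app Q (e i) = e i"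
begin

abbreviation tr :: "'h endo \<Rightarrow> real" where "tr \<equiv> op_trace p e"

definition invariant :: "'h set \<Rightarrow> bool"
  where "invariant L \<longleftrightarrow> closed L \<and> subspace L \<and> (\<forall>u\<in>\<U>. app u ` L \<subseteq> L)"

lemma commutant_adj:
  assumes "T \<in> commutant \<U>"
  shows "adj T \<in> commutant \<U>"
  unfolding commutant_def
proof safe
  fix u assume "u \<in> \<U>"
  then have "T * adj u = adj u * T"
    using assms adj_closed by (intro commutantD)
  then have "adj (T * adj u) = adj (adj u * T)" by (rule arg_cong)
  then show "adj T * u = u * adj T" by (simp add: adj_mult)
qed

lemma proj_commutant: "invariant L \<Longrightarrow> proj L \<in> commutant \<U>"
  unfolding invariant_def commutant_def using adj_closed by (blast intro: proj_commute)

lemma tr_one: "tr 1 = real p"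
  by (simp add: op_trace_def dot_square_norm norm_e)

lemma tr_proj: "closed L \<Longrightarrow> subspace L \<Longrightarrow> tr (proj L) = (\<Sum>i<p. (norm (app (proj L) (e i)))\<^sup>2)"
  unfolding op_trace_def
  by (intro sum.cong refl)
     (metis app_mult power2_norm_eq_inner proj_idem proj_inner)

text \<open>The intertwining relation \<open>b * (1 - a * b) ^ n = (1 - b * a) ^ n * b\<close> and
  one cyclic permutation reduce each power to the preceding one. The lemma replaces the unitary
  equivalence that a polar decomposition would supply.\<close>

lemma tr_power_one_minus_swap:
  assumes "a \<in> commutant \<U>" "b \<in> commutant \<U>"
  shows "tr ((1 - b * a) ^ n) = tr ((1 - a * b) ^ n)"
proof (induction n)
  case (Suc n)
  have "b * (1 - a * b) ^ n = (1 - b * a) ^ n * b" for n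
  proof (induction n)
    case (Suc n)
    have "b * (1 - a * b) ^ Suc n = (b * (1 - a * b)) * (1 - a * b) ^ n"
      by (simp add: mult.assoc)
    also have "b * (1 - a * b) = (1 - b * a) * b" by (simp add: algebra_simps)
    also have "(1 - b * a) * b * (1 - a * b) ^ n = (1 - b * a) * (b * (1 - a * b) ^ n)"
      by (rule mult.assoc)
    also have "\<dots> = (1 - b * a) ^ Suc n * b" by (simp only: Suc.IH power_Suc mult.assoc)
    finally show ?case .
  qed simp
  then have "(1 - b * a) ^ n * b * a = b * ((1 - a * b) ^ n * a)"
    by (metis mult.assoc)
  moreover have "(1 - a * b) ^ n * a \<in> commutant \<U>"
    using assms by (intro commutant_mult commutant_power commutant_diff commutant_one)
  ultimately have *: "tr ((1 - b * a) ^ n * b * a) = tr ((1 - a * b) ^ n * a * b)"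
    using trace_commute[of b] assms(2) by simp
  have "tr ((1 - b * a) ^ Suc n) = tr ((1 - b * a) ^ n - (1 - b * a) ^ n * b * a)"
    by (simp add: power_Suc2 algebra_simps del: power_Suc)
  also have "\<dots> = tr ((1 - a * b) ^ n - (1 - a * b) ^ n * a * b)"
    by (simp add: op_trace_diff Suc *)
  also have "\<dots> = tr ((1 - a * b) ^ Suc n)"
    by (simp add: power_Suc2 algebra_simps del: power_Suc)
  finally show ?case .
qed simp

text \<open>Compression by an injective operator cannot decrease dimensions. Instead of a polar
  decomposition we compare the traces of powers: with \<open>P\<close>, \<open>E\<close> the two projections, those of
  \<open>1 - P E P\<close> and \<open>1 - E P E\<close> agree, the former tend to the trace of \<open>1 - P\<close>, and the latter are
  at least that of \<open>1 - E\<close>.\<close>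

lemma tr_proj_le:
  assumes L: "invariant L" and K: "invariant K"
    and triv: "\<And>x. x \<in> L \<Longrightarrow> (\<forall>z\<in>K. inner x z = 0) \<Longrightarrow> x = 0"
  shows "tr (proj L) \<le> tr (proj K)"
proof -
  define P E where "P = proj L" and "E = proj K"
  have L': "closed L" "subspace L" and K': "closed K" "subspace K"
    using L K by (auto simp: invariant_def)
  have P: "adj P = P" "P * P = P" "P \<in> commutant \<U>" and E: "adj E = E" "E * E = E" "E \<in> commutant \<U>"
    using L K L' K' by (simp_all add: P_def E_def adj_proj proj_idem proj_commutant)
  have PP: "P * (P * x) = P * x" and EE: "E * (E * x) = E * x" for x
    using P(2) E(2) by (simp_all flip: mult.assoc)
  define X where "X = 1 - P * E * P"
  have PEP: "P * E * P = adj (E * P) * (E * P)"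
    by (simp add: adj_mult P E mult.assoc EE)
  have form: "inner (app (P * E * P) x) x = (norm (app E (app P x)))\<^sup>2" for x
    unfolding PEP power2_norm_eq_inner by (simp add: inner_app_left[of "adj (E * P)"])
  have posX: "positive X"
    unfolding positive_def
  proof (intro conjI allI)
    show "adj X = X" using P E by (simp add: X_def adj_diff adj_mult mult.assoc)
    fix x
    have "norm (app E (app P x)) \<le> norm x"
      using norm_proj_le[OF K', of "app P x"] norm_proj_le[OF L', of x] by (simp add: E_def P_def)
    then have "(norm (app E (app P x)))\<^sup>2 \<le> (norm x)\<^sup>2" by (simp add: power_mono)
    then show "0 \<le> inner (app X x) x"
      using form[of x] by (simp add: X_def inner_diff_left dot_square_norm)
  qed
  have pos1: "positive (1 - X)"
    using positive_adj_mult_self[of "E * P"] by (simp add: X_def PEP)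
  \<comment> \<open>Here the hypothesis \<open>triv\<close> enters: a vector of \<open>L\<close>
    orthogonal to \<open>K\<close> is 0, so \<open>X\<close> fixes nothing beyond the orthogonal
    complement of \<open>L\<close>.\<close>
  have fix_iff: "app X x = x \<longleftrightarrow> app P x = 0" for x
  proof
    assume "app X x = x"
    then have "app (P * E * P) x = 0" by (simp add: X_def)
    then have "app E (app P x) = 0" using form[of x] by simp
    then have "\<forall>z\<in>K. inner (app P x) z = 0"
      unfolding E_def by (simp add: proj_eq_0_iff[OF K'])
    then show "app P x = 0"
      using triv proj_mem[OF L'] by (simp add: P_def)
  qed (simp add: X_def app.zero_right)
  \<comment> \<open>The limit \<open>v\<close> of the powers is fixed, hence killed by
    \<open>P\<close>, and \<open>x - v\<close> is orthogonal to all fixed vectors, in particular to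
    its own component \<open>z\<close> off \<open>L\<close>. So \<open>v\<close> is the component of
    \<open>x\<close> off \<open>L\<close>.\<close>
  have lim: "(\<lambda>m. (norm (app (X ^ m) x))\<^sup>2) \<longlonglongrightarrow> (norm (app (1 - P) x))\<^sup>2" for x
  proof -
    obtain v where v: "(\<lambda>m. app (X ^ m) x) \<longlonglongrightarrow> v" "app X v = v"
      "\<And>z. app X z = z \<Longrightarrow> inner (x - v) z = 0"
      using contraction_powers_converge[OF posX pos1] by metis
    define z where "z = app (1 - P) (x - v)"
    have "app P z = 0" using P(2) by (simp add: z_def app.diff_right flip: app_mult)
    then have "inner (x - v) z = 0" using v(3) fix_iff by blast
    moreover have "inner (app P (x - v)) z = 0"
      by (simp only: self_adjoint_inner[OF P(1)] \<open>app P z = 0\<close> inner_zero_right)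
    moreover have "inner z z = inner (x - v) z - inner (app P (x - v)) z"
      unfolding inner_diff_left[symmetric] by (simp add: z_def)
    ultimately have "inner z z = 0" by simp
    then have "app (1 - P) x = v"
      using fix_iff[of v] v(2) by (simp add: z_def app.diff_right)
    with v(1) show ?thesis by (auto intro: tendsto_intros)
  qed
  have sq: "tr (Y ^ (m + m)) = (\<Sum>i<p. (norm (app (Y ^ m) (e i)))\<^sup>2)" if "adj Y = Y" for Y m
    using that by (simp add: op_trace_def power_inner_even)
  have tr1: "tr (1 - proj M) = (\<Sum>i<p. (norm (app (1 - proj M) (e i)))\<^sup>2)"
    if M: "closed M" "subspace M" for M
  proof -
    have "adj (1 - proj M) = 1 - proj M" by (simp add: adj_diff adj_proj[OF M])
    moreover have "(1 - proj M) ^ (1 + 1) = 1 - proj M"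
      by (simp add: algebra_simps proj_idem[OF M])
    ultimately show ?thesis using sq[of "1 - proj M" 1] by simp
  qed
  have "(\<lambda>m. tr (X ^ (m + m))) \<longlonglongrightarrow> tr (1 - P)"
    unfolding sq[OF positive_adj[OF posX]] P_def tr1[OF L'] unfolding P_def[symmetric]
    by (intro tendsto_sum lim)
  moreover have "tr (1 - E) \<le> tr (X ^ (m + m))" for m
  proof -
    define Y where "Y = 1 - E * P * E"
    have adjY: "adj Y = Y" using P E by (simp add: Y_def adj_diff adj_mult mult.assoc)
    \<comment> \<open>The factor \<open>1 - E\<close> annihilates the subtracted term of
      \<open>Y\<close>. So the component off \<open>K\<close> stays the same under all powers of
      \<open>Y\<close> and bounds their norms from below.\<close>
    have Y1: "(1 - E) * Y = 1 - E"
      by (simp add: Y_def algebra_simps EE)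
    have EY: "(1 - E) * Y ^ m = 1 - E"
    proof (induction m)
      case (Suc m)
      have "(1 - E) * Y ^ Suc m = ((1 - E) * Y) * Y ^ m" by (simp add: mult.assoc)
      then show ?case by (simp only: Y1 Suc.IH)
    qed simp
    have "(norm (app (1 - E) (e i)))\<^sup>2 \<le> (norm (app (Y ^ m) (e i)))\<^sup>2" for i
    proof -
      define w where "w = app (Y ^ m) (e i)"
      have w: "app (1 - E) (e i) = app (1 - E) w"
        unfolding w_def using EY by (metis app_mult)
      have "inner (w - app E w) (app E w) = 0"
        unfolding E_def by (rule proj_orth[OF K' proj_mem[OF K']])
      then have "(norm w)\<^sup>2 = (norm (w - app E w))\<^sup>2 + (norm (app E w))\<^sup>2"
        using norm_add_Pythagorean[of "w - app E w" "app E w"]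
        by (simp add: real_inner_class.orthogonal_def)
      then show ?thesis unfolding w by (simp add: w_def)
    qed
    then have "tr (1 - E) \<le> tr (Y ^ (m + m))"
      unfolding sq[OF adjY] E_def tr1[OF K'] unfolding E_def[symmetric] by (intro sum_mono)
    also have "tr (Y ^ (m + m)) = tr (X ^ (m + m))"
    proof -
      have "E * P * E = (E * P) * (P * E)" "P * E * P = (P * E) * (E * P)"
        by (simp_all add: mult.assoc PP EE)
      then show ?thesis
        unfolding X_def Y_def using tr_power_one_minus_swap[of "P * E" "E * P"] P E
        by (simp add: commutant_mult)
    qed
    finally show ?thesis .
  qed
  ultimately have "tr (1 - E) \<le> tr (1 - P)"
    by (meson LIMSEQ_le_const)
  then show ?thesis
    by (simp add: op_trace_diff P_def E_def)
qed

lemma tr_proj_mono: "invariant L \<Longrightarrow> invariant K \<Longrightarrow> L \<subseteq> K \<Longrightarrow> tr (proj L) \<le> tr (proj K)"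
  by (rule tr_proj_le) (assumption | metis inner_eq_zero_iff subsetD)+

definition spectral_space :: "'h endo \<Rightarrow> real \<Rightarrow> 'h set"
  where "spectral_space T c = (SOME L. closed L \<and> subspace L \<and>
    (\<forall>U. U * T = T * U \<longrightarrow> app U ` L \<subseteq> L) \<and>
    (\<forall>x\<in>L. inner (app T x) x \<le> c * (norm x)\<^sup>2) \<and>
    (\<forall>x. (\<forall>z\<in>L. inner x z = 0) \<longrightarrow> x \<noteq> 0 \<longrightarrow> c * (norm x)\<^sup>2 < inner (app T x) x))"

lemma spectral_space:
  assumes "adj T = T"
  shows "closed (spectral_space T c)" "subspace (spectral_space T c)"
    "U * T = T * U \<Longrightarrow> x \<in> spectral_space T c \<Longrightarrow> app U x \<in> spectral_space T c"
    "x \<in> spectral_space T c \<Longrightarrow> inner (app T x) x \<le> c * (norm x)\<^sup>2"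
    "(\<forall>z\<in>spectral_space T c. inner x z = 0) \<Longrightarrow> x \<noteq> 0 \<Longrightarrow> c * (norm x)\<^sup>2 < inner (app T x) x"
proof -
  note H = someI_ex[OF spectral_subspace_exists[OF assms, of c], folded spectral_space_def]
  show "closed (spectral_space T c)" "subspace (spectral_space T c)"
    using H by (rule conjunct1, rule conjunct2[THEN conjunct1])
  show "app U x \<in> spectral_space T c" if "U * T = T * U" "x \<in> spectral_space T c"
    using H[THEN conjunct2, THEN conjunct2, THEN conjunct1, rule_format, OF that(1)] that(2) by blast
  show "inner (app T x) x \<le> c * (norm x)\<^sup>2" if "x \<in> spectral_space T c"
    by (rule H[THEN conjunct2, THEN conjunct2, THEN conjunct2, THEN conjunct1, rule_format, OF that])
  show "c * (norm x)\<^sup>2 < inner (app T x) x"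
    if "\<forall>z\<in>spectral_space T c. inner x z = 0" "x \<noteq> 0"
    using H[THEN conjunct2, THEN conjunct2, THEN conjunct2, THEN conjunct2] that by blast
qed

text \<open>The spaces are chosen, not given by a formula, so inclusion has to be proved. The part
  of \<open>x\<close> orthogonal to the larger space still lies in the smaller one, by commutation;
  there the form is at most \<open>c\<close>, yet orthogonality makes it exceed \<open>d\<close>
  unless the part is 0.\<close>

lemma spectral_space_mono:
  assumes "adj T = T" "c \<le> d"
  shows "spectral_space T c \<subseteq> spectral_space T d"
proof
  fix x assume x: "x \<in> spectral_space T c"
  note sp = spectral_space[OF assms(1)]
  define E where "E = proj (spectral_space T d)"
  have "E * T = T * E"
    unfolding E_def using sp(3)[of T] assms(1) by (intro proj_commute sp(1,2)) auto
  then have "(1 - E) * T = T * (1 - E)" by (simp add: algebra_simps)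
  then have "app (1 - E) x \<in> spectral_space T c" by (rule sp(3)) (rule x)
  then have "inner (app T (app (1 - E) x)) (app (1 - E) x) \<le> c * (norm (app (1 - E) x))\<^sup>2"
    by (rule sp(4))
  also have "\<dots> \<le> d * (norm (app (1 - E) x))\<^sup>2"
    using assms(2) by (intro mult_right_mono) auto
  finally have le: "inner (app T (app (1 - E) x)) (app (1 - E) x) \<le> d * (norm (app (1 - E) x))\<^sup>2" .
  have "\<forall>z\<in>spectral_space T d. inner (app (1 - E) x) z = 0"
    unfolding E_def using proj_orth[OF sp(1,2)] by simp
  then have "app (1 - E) x = 0"
    using sp(5)[of d "app (1 - E) x"] le by fastforce
  then show "x \<in> spectral_space T d"
    using proj_fixes_iff[OF sp(1,2), of d x] by (simp add: E_def)
qed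

text \<open>The abstract counterpart of \<open>spectral_density\<close>; the range of
  \<open>Q\<close> stands for the square summable functions on the index set.\<close>

definition density :: "'h endo \<Rightarrow> real \<Rightarrow> real"
  where "density B c = Sup {tr (proj L) | L. invariant L \<and> L \<subseteq> range (app Q) \<and>
    (\<forall>x\<in>L. norm (app B x) \<le> c * norm x)}"

lemma range_Q: "x \<in> range (app Q) \<longleftrightarrow> app Q x = x"
proof
  assume "x \<in> range (app Q)"
  then obtain y where "x = app Q y" by blast
  then show "app Q x = x" by (simp add: Q_idem flip: app_mult)
next
  assume "app Q x = x"
  then show "x \<in> range (app Q)" by (metis rangeI)
qed

end

section \<open>Spectral projections of a single operator in the commutant\<close>

locale tracial_operator = tracial +
  fixes B :: "'a endo" and r :: real
  assumes B_commutant: "B \<in> commutant \<U>"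
    and B_bound: "norm (app B x) \<le> r * norm x" and r_pos: "0 < r"
begin

definition T where "T = adj B * B"

text \<open>\<open>T\<close> is the square of the absolute value of \<open>B\<close>, so the
  threshold is squared to express \<open>norm (app B x) \<le> c * norm x\<close>. The square forgets
  the sign of \<open>c\<close>, whence the recurring assumption \<open>0 \<le> c\<close>.\<close>

definition spc where "spc c = spectral_space T (c\<^sup>2)"

definition E where "E c = proj (spc c)"

definition X where "X = 1 - (1 / r\<^sup>2) *\<^sub>R T"

lemma T_adj: "adj T = T"
  by (simp add: T_def adj_mult)

lemma T_commutant: "T \<in> commutant \<U>"
  unfolding T_def by (intro commutant_mult commutant_adj B_commutant)

lemma T_form: "inner (app T x) x = (norm (app B x))\<^sup>2"
  by (simp add: T_def power2_norm_eq_inner inner_app_left[of "adj B"])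

lemmas spc = spectral_space[OF T_adj, where c = "c\<^sup>2" for c, folded spc_def]

lemma spc_invariant: "invariant (spc c)"
  unfolding invariant_def
proof (intro conjI ballI image_subsetI spc(1,2))
  show "app u x \<in> spc c" if "u \<in> \<U>" "x \<in> spc c" for u x
    using commutantD[OF T_commutant that(1)] that(2) by (intro spc(3)) auto
qed

lemma spc_le:
  assumes "x \<in> spc c" "0 \<le> c"
  shows "norm (app B x) \<le> c * norm x"
proof (rule power2_le_imp_le)
  show "(norm (app B x))\<^sup>2 \<le> (c * norm x)\<^sup>2"
    using spc(4)[OF assms(1)] unfolding T_form power_mult_distrib .
qed (simp add: assms(2))

lemma spc_gt:
  assumes "\<forall>z\<in>spc c. inner x z = 0" "x \<noteq> 0" "0 \<le> c"
  shows "c * norm x < norm (app B x)"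
proof (rule power2_less_imp_less)
  show "(c * norm x)\<^sup>2 < (norm (app B x))\<^sup>2"
    using spc(5)[OF assms(1,2)] unfolding T_form power_mult_distrib .
qed simp

lemma E_adj: "adj (E c) = E c" and E_idem: "E c * E c = E c" and E_T: "E c * T = T * E c"
  and E_commutant: "E c \<in> commutant \<U>"
proof -
  have "app T ` spc c \<subseteq> spc c" using spc(3)[of T] by blast
  then show "E c * T = T * E c"
    unfolding E_def using T_adj by (intro proj_commute spc(1,2)) simp_all
qed (simp_all add: E_def adj_proj[OF spc(1,2)] proj_idem[OF spc(1,2)] proj_commutant[OF spc_invariant])

lemma E_fixes: "app (E c) x = x \<longleftrightarrow> x \<in> spc c"
  unfolding E_def by (rule proj_fixes_iff[OF spc(1,2)])

lemma E_mem: "app (E c) x \<in> spc c"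
  unfolding E_def by (rule proj_mem[OF spc(1,2)])

lemma E_orth: "z \<in> spc c \<Longrightarrow> inner (app (1 - E c) x) z = 0"
  unfolding E_def app_diff app_one by (rule proj_orth[OF spc(1,2)])

lemma spc_mono: "0 \<le> c \<Longrightarrow> c \<le> d \<Longrightarrow> spc c \<subseteq> spc d"
  unfolding spc_def by (rule spectral_space_mono[OF T_adj]) (simp add: power_mono)

lemma E_mult:
  assumes "0 \<le> c" "c \<le> d"
  shows "E d * E c = E c" "E c * E d = E c"
proof -
  show 1: "E d * E c = E c"
  proof (rule endo_eqI)
    fix x
    have "app (E c) x \<in> spc d" using E_mem spc_mono[OF assms] by blast
    then show "app (E d * E c) x = app (E c) x" using E_fixes by simp
  qed
  have "adj (E d * E c) = adj (E c)" by (simp only: 1)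
  then show "E c * E d = E c" by (simp only: adj_mult E_adj)
qed

lemma spc_full: "r \<le> c \<Longrightarrow> spc c = UNIV"
proof -
  assume "r \<le> c"
  have "x \<in> spc c" for x
  proof -
    define y where "y = app (1 - E c) x"
    have "\<forall>z\<in>spc c. inner y z = 0" using E_orth by (simp add: y_def)
    moreover have "norm (app B y) \<le> c * norm y"
      using B_bound[of y] \<open>r \<le> c\<close> by (meson mult_right_mono norm_ge_zero order_trans)
    ultimately have "y = 0" using spc_gt[of c y] \<open>r \<le> c\<close> r_pos by fastforce
    then show ?thesis using E_fixes[of c x] by (simp add: y_def)
  qed
  then show ?thesis by blast
qed

lemma E_full: "r \<le> c \<Longrightarrow> E c = 1"
  by (rule endo_eqI) (simp add: E_fixes spc_full)

lemma tr_proj_le_E: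
  assumes "invariant L" "0 \<le> c" "\<And>x. x \<in> L \<Longrightarrow> norm (app B x) \<le> c * norm x"
  shows "tr (proj L) \<le> tr (E c)"
  unfolding E_def
proof (rule tr_proj_le[OF assms(1) spc_invariant])
  show "x = 0" if "x \<in> L" "\<forall>z\<in>spc c. inner x z = 0" for x
    using spc_gt[OF that(2) _ assms(2)] assms(3)[OF that(1)] by fastforce
qed

lemma density_eq:
  assumes "0 \<le> c"
  shows "density B c = tr (E c)"
  unfolding density_def
proof (rule cSup_eq_maximum)
  \<comment> \<open>The spectral space may reach outside the range of \<open>Q\<close>, so it is cut
    down to an admissible submodule. Its trace does not change, because \<open>Q\<close> fixes the
    vectors \<open>e i\<close>.\<close>
  define K where "K = spc c \<inter> range (app Q)"
  have EQ: "E c * Q = Q * E c"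
    by (rule commutantD[OF E_commutant Q_mem])
  have Qr: "range (app Q) = {x. app Q x = x}"
    using range_Q by blast
  have cl: "closed K" "subspace K"
  proof -
    have "closed (range (app Q))"
      unfolding Qr by (intro closed_Collect_eq linear_continuous_on bounded_linear_app continuous_on_id)
    then show "closed K" unfolding K_def using spc(1) by blast
    have "subspace (range (app Q))"
      unfolding Qr by (auto simp: subspace_def app.add_right app.scaleR_right app.zero_right)
    then show "subspace K" unfolding K_def using spc(2) by (rule subspace_inter[rotated])
  qed
  have "invariant K"
    unfolding invariant_def
  proof (intro conjI ballI cl)
    fix u assume u: "u \<in> \<U>"
    have "app u x \<in> range (app Q)" if "x \<in> range (app Q)" for x
      using that Q_central[OF u] unfolding range_Q by (metis app_mult)
    then show "app u ` K \<subseteq> K"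
      using spc_invariant[of c] u by (auto simp: invariant_def K_def)
  qed
  moreover have "proj K = E c * Q"
  proof (rule endo_eqI)
    fix x
    show "app (proj K) x = app (E c * Q) x"
    proof (rule proj_eqI[OF cl])
      show "app (E c * Q) x \<in> K"
        using E_mem EQ unfolding K_def by (metis IntI app_mult rangeI)
      fix z assume z: "z \<in> K"
      then have "app (E c) z = z" "app Q z = z"
        using E_fixes range_Q by (auto simp: K_def)
      then have "inner (app (E c * Q) x) z = inner x z"
        using self_adjoint_inner[OF E_adj, of c "app Q x" z] self_adjoint_inner[OF Q_adj, of x z] by simp
      then show "inner (x - app (E c * Q) x) z = 0" by (simp add: inner_diff_left)
    qed
  qed
  then have "tr (proj K) = tr (E c)"
    by (simp add: op_trace_def Q_e)
  moreover have "\<forall>x\<in>K. norm (app B x) \<le> c * norm x"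
    using spc_le assms by (auto simp: K_def)
  ultimately show "tr (E c) \<in> {tr (proj L) | L. invariant L \<and> L \<subseteq> range (app Q) \<and>
      (\<forall>x\<in>L. norm (app B x) \<le> c * norm x)}"
    by (intro CollectI exI[of _ K]) (auto simp: K_def)
qed (use tr_proj_le_E assms in auto)

lemma zero_invariant: "invariant {0}"
  by (auto simp: invariant_def subspace_def app.zero_right)

lemma tr_proj_zero: "tr (proj {0}) = 0"
proof -
  have "app (proj {0}) x = 0" for x :: 'a
    using zero_invariant proj_mem[of "{0 :: 'a}" x] by (simp add: invariant_def)
  then show ?thesis by (simp add: op_trace_def)
qed

lemma density_neg:
  assumes "c < 0"
  shows "density B c = 0"
proof -
  have "{tr (proj L) | L. invariant L \<and> L \<subseteq> range (app Q) \<and>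
      (\<forall>x\<in>L. norm (app B x) \<le> c * norm x)} = {tr (proj {0})}" (is "?S = _")
  proof -
    have "L = {0}" if "invariant L" "\<forall>x\<in>L. norm (app B x) \<le> c * norm x" for L
    proof -
      have "x = 0" if "x \<in> L" for x
      proof (rule ccontr)
        assume "x \<noteq> 0"
        then have "c * norm x < 0" using assms by (simp add: mult_neg_pos)
        then show False
          using \<open>\<forall>x\<in>L. norm (app B x) \<le> c * norm x\<close> that norm_ge_zero[of "app B x"]
          by (meson order.trans not_le)
      qed
      moreover have "0 \<in> L" using that(1) by (simp add: invariant_def subspace_0)
      ultimately show ?thesis by blast
    qed
    then have "?S \<subseteq> {tr (proj {0})}" by blast
    moreover have "0 \<in> range (app Q)" by (simp add: range_Q app.zero_right)
    then have "tr (proj {0}) \<in> ?S"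
      by (intro CollectI exI[of _ "{0}"] conjI refl zero_invariant) (simp_all add: app.zero_right)
    ultimately show ?thesis by blast
  qed
  then show ?thesis by (simp add: density_def tr_proj_zero)
qed

lemma tr_E_nonneg: "0 \<le> tr (E c)"
  unfolding E_def tr_proj[OF spc(1,2)] by (intro sum_nonneg) simp

lemma tr_E_mono: "0 \<le> c \<Longrightarrow> c \<le> d \<Longrightarrow> tr (E c) \<le> tr (E d)"
  unfolding E_def by (intro tr_proj_mono spc_invariant spc_mono)

lemma density_mono: "c \<le> d \<Longrightarrow> density B c \<le> density B d"
  by (cases "c < 0"; cases "d < 0") (auto simp: density_neg density_eq tr_E_nonneg tr_E_mono)

lemma density_full: "r \<le> c \<Longrightarrow> density B c = real p"
  using r_pos by (simp add: density_eq E_full tr_one)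

text \<open>Along thresholds decreasing to \<open>c\<close> the projections converge to that onto
  the intersection \<open>K\<close>. Vectors of \<open>K\<close> satisfy the bound for
  \<open>c\<close> itself, so \<open>K\<close> is no larger in trace than the spectral space at
  \<open>c\<close>.\<close>

lemma density_right_continuous: "continuous (at_right c) (density B)"
proof (cases "c < 0")
  case True
  have "eventually (\<lambda>x. density B x = density B c) (at_right c)"
    using True by (intro eventually_at_rightI[of c 0]) (auto simp: density_neg)
  then show ?thesis
    unfolding continuous_within by (rule tendsto_eventually)
next
  case False
  have "(density B \<longlongrightarrow> density B c) (at_right c)"
  proof (rule tendsto_at_right_sequentially[of c "c + 1"])
    fix S :: "nat \<Rightarrow> real"
    assume S: "\<And>n. c < S n" "decseq S" "S \<longlonglongrightarrow> c"
    have S0: "0 \<le> S n" for n using S(1)[of n] False by simp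
    define K where "K = (\<Inter>n. spc (S n))"
    have "decseq (\<lambda>n. spc (S n))"
      unfolding decseq_def by (intro allI impI spc_mono S0 decseqD[OF S(2)])
    from proj_decseq_tendsto[OF _ _ this]
    have lim: "(\<lambda>n. tr (E (S n))) \<longlonglongrightarrow> tr (proj K)"
      unfolding op_trace_def E_def K_def by (intro tendsto_intros) (use spc(1,2) in auto)
    have "invariant K"
      unfolding invariant_def
    proof (intro conjI ballI image_subsetI)
      show "closed K" unfolding K_def using spc(1) by blast
      show "subspace K" unfolding K_def using spc(2) by (auto simp: subspace_def)
      fix u x assume "u \<in> \<U>" "x \<in> K"
      then show "app u x \<in> K"
        using spc_invariant unfolding invariant_def K_def by blast
    qed
    moreover have "norm (app B x) \<le> c * norm x" if "x \<in> K" for x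
    proof (rule LIMSEQ_le_const)
      show "(\<lambda>n. S n * norm x) \<longlonglongrightarrow> c * norm x" by (intro tendsto_intros S)
      show "\<exists>N. \<forall>n\<ge>N. norm (app B x) \<le> S n * norm x"
        using that spc_le[OF _ S0] by (auto simp: K_def)
    qed
    ultimately have "tr (proj K) \<le> density B c"
      using False by (simp add: density_eq tr_proj_le_E)
    moreover have "density B c \<le> tr (proj K)"
    proof (rule LIMSEQ_le_const[OF lim])
      show "\<exists>N. \<forall>n\<ge>N. density B c \<le> tr (E (S n))"
        using density_mono[of c "S n" for n] S(1) S0 by (auto simp: density_eq intro: less_imp_le)
    qed
    ultimately show "(\<lambda>n. density B (S n)) \<longlonglongrightarrow> density B c"
      using lim S0 by (simp add: density_eq)
  qed simp
  then show ?thesis by (simp add: continuous_within)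
qed

lemma X_form: "inner (app X x) x = (norm x)\<^sup>2 - (norm (app B x))\<^sup>2 / r\<^sup>2"
  by (simp add: X_def inner_diff_left dot_square_norm T_form)

lemma X_positive: "positive X"
  unfolding positive_def
proof (intro conjI allI)
  show "adj X = X" by (simp add: X_def adj_diff adj_scaleR T_adj)
  fix x
  have "(norm (app B x))\<^sup>2 \<le> (r * norm x)\<^sup>2" by (intro power_mono B_bound) simp
  then show "0 \<le> inner (app X x) x"
    using r_pos by (simp add: X_form power_mult_distrib field_simps)
qed

lemma X_E: "X * E c = E c * X"
  by (simp add: X_def algebra_simps E_T)

text \<open>On the range of \<open>E d - E c\<close> the operator \<open>B\<close> stretches by
  factors between \<open>c\<close> and \<open>d\<close>, so the form of \<open>X\<close> lies
  between \<open>1 - d\<^sup>2 / r\<^sup>2\<close> and \<open>1 - c\<^sup>2 / r\<^sup>2\<close>, and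
  forms of powers lie between the powers of these numbers. These are the Riemann-Stieltjes bounds
  for the moments.\<close>

lemma tr_X_slice:
  assumes "0 \<le> c" "c \<le> d" "d \<le> r"
  shows "(1 - d\<^sup>2 / r\<^sup>2) ^ n * (tr (E d) - tr (E c)) \<le> tr (X ^ n * (E d - E c))"
    and "tr (X ^ n * (E d - E c)) \<le> (1 - c\<^sup>2 / r\<^sup>2) ^ n * (tr (E d) - tr (E c))"
proof -
  define D where "D = E d - E c"
  have D: "adj D = D" "D * D = D"
    using E_mult[OF assms(1,2)] by (simp_all add: D_def adj_diff E_adj algebra_simps E_idem)
  have DX: "D * X = X * D" by (simp add: D_def algebra_simps X_E)
  then have DXn: "D * X ^ n = X ^ n * D" by (metis power_commuting_commutes)
  define V where "V = {v. app D v = v}"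
  have VX: "app X v \<in> V" if "v \<in> V" for v
    using that DX unfolding V_def by (metis (mono_tags) app_mult mem_Collect_eq)
  have De: "app D x \<in> V" for x
    using D(2) by (simp add: V_def flip: app_mult)
  have slice: "(1 - d\<^sup>2 / r\<^sup>2) * (norm v)\<^sup>2 \<le> inner (app X v) v"
    "inner (app X v) v \<le> (1 - c\<^sup>2 / r\<^sup>2) * (norm v)\<^sup>2" if v: "v \<in> V" for v
  proof -
    have "E d * D = D" "E c * D = 0"
      using E_mult[OF assms(1,2)] by (simp_all add: D_def algebra_simps E_idem)
    then have Ev: "app (E d) v = v" "app (E c) v = 0"
    proof -
      have Dv: "app D v = v" using v by (simp add: V_def)
      have "app (E d) (app D v) = app D v" "app (E c) (app D v) = 0"
        using \<open>E d * D = D\<close> \<open>E c * D = 0\<close> by (simp_all flip: app_mult)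
      then show "app (E d) v = v" "app (E c) v = 0" by (simp_all only: Dv)
    qed
    have "norm (app B v) \<le> d * norm v"
      using Ev(1) E_fixes spc_le assms by auto
    then have "(norm (app B v))\<^sup>2 \<le> d\<^sup>2 * (norm v)\<^sup>2"
      unfolding power_mult_distrib[symmetric] by (rule power_mono) simp
    then have "(norm (app B v))\<^sup>2 / r\<^sup>2 \<le> d\<^sup>2 * (norm v)\<^sup>2 / r\<^sup>2" by (simp add: divide_right_mono)
    then show "(1 - d\<^sup>2 / r\<^sup>2) * (norm v)\<^sup>2 \<le> inner (app X v) v"
      unfolding X_form by (simp add: algebra_simps)
    have "c * norm v \<le> norm (app B v)"
    proof (cases "v = 0")
      case False
      have "\<forall>z\<in>spc c. inner v z = 0" using E_orth[of _ c v] Ev(2) by simp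
      then show ?thesis using spc_gt[of c v] False assms by simp
    qed simp
    then have "c\<^sup>2 * (norm v)\<^sup>2 \<le> (norm (app B v))\<^sup>2"
      unfolding power_mult_distrib[symmetric] by (rule power_mono) (simp add: assms(1))
    then have "c\<^sup>2 * (norm v)\<^sup>2 / r\<^sup>2 \<le> (norm (app B v))\<^sup>2 / r\<^sup>2" by (simp add: divide_right_mono)
    then show "inner (app X v) v \<le> (1 - c\<^sup>2 / r\<^sup>2) * (norm v)\<^sup>2"
      unfolding X_form by (simp add: algebra_simps)
  qed
  have nn: "0 \<le> 1 - d\<^sup>2 / r\<^sup>2" "0 \<le> 1 - c\<^sup>2 / r\<^sup>2"
    using assms r_pos power_mono[of d r 2] power_mono[of c r 2] by (simp_all add: divide_le_eq)
  have trD: "tr (E d) - tr (E c) = (\<Sum>i<p. (norm (app D (e i)))\<^sup>2)"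
  proof -
    have "inner (app D x) x = (norm (app D x))\<^sup>2" for x
      using self_adjoint_inner[OF D(1), of "app D x" x] D(2)
      by (simp add: power2_norm_eq_inner flip: app_mult)
    then have "tr D = (\<Sum>i<p. (norm (app D (e i)))\<^sup>2)"
      unfolding op_trace_def by simp
    then show ?thesis by (simp only: D_def op_trace_diff)
  qed
  have trX: "tr (X ^ n * D) = (\<Sum>i<p. inner (app (X ^ n) (app D (e i))) (app D (e i)))"
  proof -
    have "inner (app (X ^ n * D) x) x = inner (app (X ^ n) (app D x)) (app D x)" for x
    proof -
      have "X ^ n * D = D * (X ^ n * D)"
        using D(2) DXn by (metis mult.assoc)
      then have "inner (app (X ^ n * D) x) x = inner (app D (app (X ^ n * D) x)) x"
        by (metis app_mult)
      then show ?thesis using self_adjoint_inner[OF D(1)] by simp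
    qed
    then show ?thesis unfolding op_trace_def by simp
  qed
  show "(1 - d\<^sup>2 / r\<^sup>2) ^ n * (tr (E d) - tr (E c)) \<le> tr (X ^ n * (E d - E c))"
    unfolding D_def[symmetric] trD trX sum_distrib_left
    by (intro sum_mono power_inner_ge[of X V] X_positive VX nn slice De)
  show "tr (X ^ n * (E d - E c)) \<le> (1 - c\<^sup>2 / r\<^sup>2) ^ n * (tr (E d) - tr (E c))"
    unfolding D_def[symmetric] trD trX sum_distrib_left
    by (intro sum_mono power_inner_le[of X V] X_positive VX nn slice De)
qed

lemma tr_X_kernel: "tr (X ^ n * E 0) = tr (E 0)"
proof -
  have "app (X ^ n) y = y" if "y \<in> spc 0" for y
  proof -
    have "app B y = 0" using spc_le[OF that] by simp
    then have "app X y = y" by (simp add: X_def T_def app.zero_right)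
    then show ?thesis by (induction n) auto
  qed
  then have "X ^ n * E 0 = E 0"
    using E_mem by (intro endo_eqI) auto
  then show ?thesis by simp
qed

lemma tr_X_nonneg: "0 \<le> tr (X ^ n)"
  by (intro op_trace_nonneg positive_inner positive_power X_positive)

text \<open>Zero density means that the kernel projection \<open>E 0\<close> kills every
  \<open>e i\<close>; \<open>faithful\<close> then makes it vanish on the whole range of
  \<open>Q\<close>.\<close>

lemma density_zero_iff:
  "density B 0 = 0 \<longleftrightarrow> (\<forall>x. app Q x = x \<longrightarrow> app B x = 0 \<longrightarrow> x = 0)"
proof
  assume "density B 0 = 0"
  then have "(\<Sum>i<p. (norm (app (E 0) (e i)))\<^sup>2) = 0"
    unfolding density_eq[OF order.refl] E_def tr_proj[OF spc(1,2)] .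
  then have "app (E 0) (e i) = 0" if "i < p" for i
    using that by (subst (asm) sum_nonneg_eq_0_iff) auto
  then have EQ: "E 0 * Q = 0" by (rule faithful[OF E_commutant])
  show "\<forall>x. app Q x = x \<longrightarrow> app B x = 0 \<longrightarrow> x = 0"
  proof (intro allI impI)
    fix x assume x: "app Q x = x" "app B x = 0"
    define y where "y = app (1 - E 0) x"
    have "\<forall>z\<in>spc 0. inner y z = 0" using E_orth by (simp add: y_def)
    moreover have "app B y = 0"
    proof -
      have "app B (app (E 0) x) = 0" using spc_le[OF E_mem, of 0] by simp
      then show ?thesis using x by (simp add: y_def app.diff_right)
    qed
    ultimately have "y = 0" using spc_gt[of 0 y] by force
    then have "x = app (E 0) x" by (simp add: y_def)
    also have "\<dots> = app (E 0 * Q) x" using x(1) by simp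
    finally show "x = 0" using EQ by simp
  qed
next
  assume inj: "\<forall>x. app Q x = x \<longrightarrow> app B x = 0 \<longrightarrow> x = 0"
  have "app (E 0) (e i) = 0" if "i < p" for i
  proof -
    have "E 0 * Q = Q * E 0"
      by (rule commutantD[OF E_commutant Q_mem])
    then have "app Q (app (E 0) (e i)) = app (E 0) (e i)"
      using Q_e[OF that] by (metis app_mult)
    moreover have "app B (app (E 0) (e i)) = 0" using spc_le[OF E_mem, of 0] by simp
    ultimately show ?thesis using inj by blast
  qed
  then show "density B 0 = 0"
    unfolding density_eq[OF order.refl] op_trace_def by simp
qed

end

section \<open>The determinant as a limit of traces of powers\<close>

text \<open>Cutting the interval into \<open>m + 1\<close> equal pieces and telescoping bounds the
  total change by a constant over \<open>m + 1\<close>. This permits comparing an integral with a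
  trace without evaluating either.\<close>

lemma constant_if_increments_small:
  fixes K F :: "real \<Rightarrow> real"
  assumes "a \<le> b"
    and inc: "\<And>x y. a \<le> x \<Longrightarrow> x \<le> y \<Longrightarrow> y \<le> b \<Longrightarrow> \<bar>K y - K x\<bar> \<le> \<Lambda> * (y - x) * (F y - F x)"
  shows "K b = K a"
proof -
  define C where "C = \<Lambda> * (b - a) * (F b - F a)"
  have bound: "\<bar>K b - K a\<bar> \<le> C / real (Suc m)" for m
  proof -
    define x where "x i = a + real i * ((b - a) / real (Suc m))" for i
    have x0: "x 0 = a" by (simp add: x_def)
    have xm: "x (Suc m) = b" by (simp add: x_def del: of_nat_Suc)
    have step: "x (Suc i) - x i = (b - a) / real (Suc m)" for i
    proof -
      have "(a + (real i + 1) * w) - (a + real i * w) = w" for w by (simp add: algebra_simps)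
      then show ?thesis unfolding x_def of_nat_Suc[of i] by (simp only: add.commute)
    qed
    have d0: "0 \<le> (b - a) / real (Suc m)" using assms(1) by simp
    have mono: "x i \<le> x j" if "i \<le> j" for i j
      unfolding x_def using that d0 by (intro add_left_mono mult_right_mono) auto
    have "\<bar>K b - K a\<bar> = \<bar>\<Sum>i<Suc m. K (x (Suc i)) - K (x i)\<bar>"
      by (subst sum_lessThan_telescope) (simp add: x0 xm)
    also have "\<dots> \<le> (\<Sum>i<Suc m. \<bar>K (x (Suc i)) - K (x i)\<bar>)" by (rule sum_abs)
    also have "\<dots> \<le> (\<Sum>i<Suc m. \<Lambda> * ((b - a) / real (Suc m)) * (F (x (Suc i)) - F (x i)))"
    proof (rule sum_mono)
      fix i assume "i \<in> {..<Suc m}"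
      then show "\<bar>K (x (Suc i)) - K (x i)\<bar> \<le> \<Lambda> * ((b - a) / real (Suc m)) * (F (x (Suc i)) - F (x i))"
        using inc[of "x i" "x (Suc i)"] mono[of 0 i] mono[of i "Suc i"] mono[of "Suc i" "Suc m"]
        unfolding step x0 xm by simp
    qed
    also have "\<dots> = \<Lambda> * ((b - a) / real (Suc m)) * (F b - F a)"
      unfolding sum_distrib_left[symmetric] by (subst sum_lessThan_telescope) (simp only: x0 xm)
    finally show ?thesis by (simp add: C_def)
  qed
  have "(\<lambda>m. C / real (Suc m)) \<longlonglongrightarrow> 0"
    using tendsto_mult[OF tendsto_const[of C] LIMSEQ_inverse_real_of_nat]
    by (simp add: divide_inverse)
  then have "\<bar>K b - K a\<bar> \<le> 0"
    by (rule LIMSEQ_le_const) (use bound in blast)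
  then show ?thesis by simp
qed

lemma log_series_ennreal:
  assumes "0 < x" "x \<le> r"
  shows "suminf (\<lambda>n. ennreal ((1 - x\<^sup>2 / r\<^sup>2) ^ n / real n)) = ennreal (2 * (ln r - ln x))"
proof (rule suminf_ennreal_eq)
  define y where "y = x\<^sup>2 / r\<^sup>2"
  have y: "0 < y" "y \<le> 1"
    using assms by (auto simp: y_def power_mono)
  then show "0 \<le> (1 - x\<^sup>2 / r\<^sup>2) ^ n / real n" for n
    by (simp add: y_def)
  have "(\<lambda>n. - ((1 - y) ^ n) / real n) sums ln y"
    using ln_series'[of "- (1 - y)"] y by simp
  then have "(\<lambda>n. - (- ((1 - y) ^ n) / real n)) sums (- ln y)"
    by (rule sums_minus)
  moreover have "- ln y = 2 * (ln r - ln x)"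
    using assms by (simp add: y_def ln_div ln_realpow)
  ultimately show "(\<lambda>n. (1 - x\<^sup>2 / r\<^sup>2) ^ n / real n) sums (2 * (ln r - ln x))"
    by (simp add: y_def)
qed

lemma harmonic_ennreal: "suminf (\<lambda>n. ennreal (1 / real n)) = top_class.top"
proof (rule ccontr)
  assume "suminf (\<lambda>n. ennreal (1 / real n)) \<noteq> top_class.top"
  then have "summable (\<lambda>n. 1 / real n)"
    by (rule summable_suminf_not_top[rotated]) simp
  then show False
    using not_summable_harmonic[where 'a = real] by (simp add: inverse_eq_divide)
qed

lemma sum_at_top_if_not_summable:
  fixes b :: "nat \<Rightarrow> real"
  assumes "\<And>n. 0 \<le> b n" "\<not> summable b"
  shows "filterlim (\<lambda>N. \<Sum>n\<le>N. b n) at_top sequentially"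
  unfolding filterlim_at_top
proof
  fix Z
  have "\<exists>N. Z < (\<Sum>n<N. b n)"
    using summableI_nonneg_bounded[of b Z] assms by (meson not_le)
  then obtain N where N: "Z < (\<Sum>n<N. b n)" by blast
  show "eventually (\<lambda>N. Z \<le> (\<Sum>n\<le>N. b n)) sequentially"
  proof (rule eventually_sequentiallyI)
    fix M assume "N \<le> M"
    then have "(\<Sum>n<N. b n) \<le> (\<Sum>n\<le>M. b n)"
      using assms(1) by (intro sum_mono2) auto
    then show "Z \<le> (\<Sum>n\<le>M. b n)" using N by linarith
  qed
qed

text \<open>The term for \<open>n = 0\<close> of the logarithm series below vanishes because \<open>x / 0 = 0\<close>.\<close>

lemma log_integral_moments:
  fixes \<mu> :: "real measure" and a :: "nat \<Rightarrow> real"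
  defines "I \<equiv> enn2ereal (\<integral>\<^sup>+x\<in>{0<..}. ennreal (ln x) \<partial>\<mu>) - enn2ereal (\<integral>\<^sup>+x\<in>{0<..}. ennreal (- ln x) \<partial>\<mu>)"
  assumes sets [measurable_cong]: "sets \<mu> = sets borel" and "0 < r"
    and AE: "AE x in \<mu>. 0 \<le> x \<and> x \<le> r"
    and a0: "\<And>n. 0 \<le> a n"
    and moments: "\<And>n. (\<integral>\<^sup>+x. ennreal ((1 - x\<^sup>2 / r\<^sup>2) ^ n) \<partial>\<mu>) = ennreal (a n)"
  shows "(\<lambda>N. exp (a 0 * ln r - (\<Sum>n\<le>N. a n / real n) / 2)) \<longlonglongrightarrow>
    (if emeasure \<mu> {0} = 0 \<and> I > -\<infinity> then exp (real_of_ereal I) else 0)"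
proof -
  \<comment> \<open>For \<open>0 < x \<le> r\<close> this is \<open>2 * (ln r - ln x)\<close>, and
    at 0 it is the harmonic series. So an atom at 0 and an infinite logarithmic integral show up
    alike, as divergence of the series of moments.\<close>
  define H where "H x = suminf (\<lambda>n. ennreal ((1 - x\<^sup>2 / r\<^sup>2) ^ n / real n))" for x :: real
  have "(\<integral>\<^sup>+x. H x \<partial>\<mu>) = suminf (\<lambda>n. \<integral>\<^sup>+x. ennreal ((1 - x\<^sup>2 / r\<^sup>2) ^ n / real n) \<partial>\<mu>)"
    unfolding H_def by (rule nn_integral_suminf) measurable
  also have "(\<lambda>n. \<integral>\<^sup>+x. ennreal ((1 - x\<^sup>2 / r\<^sup>2) ^ n / real n) \<partial>\<mu>) = (\<lambda>n. ennreal (a n / real n))"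
  proof
    fix n
    have "(\<integral>\<^sup>+x. ennreal ((1 - x\<^sup>2 / r\<^sup>2) ^ n / real n) \<partial>\<mu>) =
        (\<integral>\<^sup>+x. ennreal (1 / real n) * ennreal ((1 - x\<^sup>2 / r\<^sup>2) ^ n) \<partial>\<mu>)"
      by (rule nn_integral_cong) (simp flip: ennreal_mult')
    also have "\<dots> = ennreal (1 / real n) * ennreal (a n)"
      unfolding moments[symmetric] by (rule nn_integral_cmult) measurable
    also have "\<dots> = ennreal (a n / real n)"
      by (simp flip: ennreal_mult')
    finally show "(\<integral>\<^sup>+x. ennreal ((1 - x\<^sup>2 / r\<^sup>2) ^ n / real n) \<partial>\<mu>) = ennreal (a n / real n)" .
  qed
  finally have HS: "(\<integral>\<^sup>+x. H x \<partial>\<mu>) = suminf (\<lambda>n. ennreal (a n / real n))" .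
  have diverge: "(\<lambda>N. exp (a 0 * ln r - (\<Sum>n\<le>N. a n / real n) / 2)) \<longlonglongrightarrow> 0"
    if "(\<integral>\<^sup>+x. H x \<partial>\<mu>) = top_class.top"
  proof -
    have "\<not> summable (\<lambda>n. a n / real n)"
    proof
      assume sm: "summable (\<lambda>n. a n / real n)"
      have "suminf (\<lambda>n. ennreal (a n / real n)) = ennreal (suminf (\<lambda>n. a n / real n))"
        by (rule suminf_ennreal2[OF _ sm]) (simp add: a0)
      with that show False unfolding HS by simp
    qed
    then have "filterlim (\<lambda>N. \<Sum>n\<le>N. a n / real n) at_top sequentially"
      using a0 by (intro sum_at_top_if_not_summable) auto
    then have "filterlim (\<lambda>N. (1/2) * (\<Sum>n\<le>N. a n / real n)) at_top sequentially"
      by (intro filterlim_tendsto_pos_mult_at_top[OF tendsto_const]) auto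
    then have "filterlim (\<lambda>N. - a 0 * ln r + (1/2) * (\<Sum>n\<le>N. a n / real n)) at_top sequentially"
      by (rule filterlim_tendsto_add_at_top[OF tendsto_const])
    then have "filterlim (\<lambda>N. - (- a 0 * ln r + (1/2) * (\<Sum>n\<le>N. a n / real n))) at_bot sequentially"
      by (simp only: filterlim_uminus_at_top[symmetric])
    then have "((\<lambda>N. exp (- (- a 0 * ln r + (1/2) * (\<Sum>n\<le>N. a n / real n)))) \<longlongrightarrow> 0) sequentially"
      by (rule filterlim_compose[OF exp_at_bot])
    then show ?thesis by simp
  qed
  show ?thesis
  proof (cases "emeasure \<mu> {0} = 0")
    case False
    have "H 0 = top_class.top" by (simp add: H_def harmonic_ennreal)
    then have "top_class.top * indicator {0} x \<le> H x" for x
      by (auto split: split_indicator)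
    then have "(\<integral>\<^sup>+x. top_class.top * indicator {0} x \<partial>\<mu>) \<le> (\<integral>\<^sup>+x. H x \<partial>\<mu>)"
      by (intro nn_integral_mono)
    moreover have "(\<integral>\<^sup>+x. top_class.top * indicator {0} x \<partial>\<mu>) = top_class.top"
      using False by (subst nn_integral_cmult_indicator) (auto simp: ennreal_top_mult sets)
    ultimately have "(\<integral>\<^sup>+x. H x \<partial>\<mu>) = top_class.top" by (simp add: top_unique)
    with diverge False show ?thesis by simp
  next
    case True
    have "AE x in \<mu>. x \<notin> {0}"
      using True by (intro AE_not_in) (simp add: null_sets_def sets)
    with AE have AE': "AE x in \<mu>. 0 < x \<and> x \<le> r" by eventually_elim auto
    define K P N where "K = (\<integral>\<^sup>+x. ennreal (ln r - ln x) \<partial>\<mu>)"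
      and "P = (\<integral>\<^sup>+x\<in>{0<..}. ennreal (ln x) \<partial>\<mu>)" and "N = (\<integral>\<^sup>+x\<in>{0<..}. ennreal (- ln x) \<partial>\<mu>)"
    have mass: "(\<integral>\<^sup>+x. 1 \<partial>\<mu>) = ennreal (a 0)" using moments[of 0] by simp
    have const: "(\<integral>\<^sup>+x. c \<partial>\<mu>) = c * ennreal (a 0)" for c
      using nn_integral_cmult[of "\<lambda>_. 1" \<mu> c] mass by simp
    have HK: "(\<integral>\<^sup>+x. H x \<partial>\<mu>) = 2 * K"
    proof -
      have "(\<integral>\<^sup>+x. H x \<partial>\<mu>) = (\<integral>\<^sup>+x. 2 * ennreal (ln r - ln x) \<partial>\<mu>)"
      proof (rule nn_integral_cong_AE)
        show "AE x in \<mu>. H x = 2 * ennreal (ln r - ln x)"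
          using AE'
        proof eventually_elim
          case (elim x)
          have "H x = ennreal (2 * (ln r - ln x))"
            unfolding H_def using elim by (intro log_series_ennreal) auto
          also have "\<dots> = ennreal 2 * ennreal (ln r - ln x)"
            by (rule ennreal_mult') simp
          finally show ?case by simp
        qed
      qed
      also have "\<dots> = 2 * K" unfolding K_def by (rule nn_integral_cmult) measurable
      finally show ?thesis .
    qed
    \<comment> \<open>The identity \<open>ln r - ln x + ln x = ln r\<close> with every negative part
      moved to the other side, so that no infinite quantities are subtracted.\<close>
    have "(\<integral>\<^sup>+x. ennreal (ln r - ln x) + (ennreal (ln x) * indicator {0<..} x + ennreal (- ln r)) \<partial>\<mu>) =
        (\<integral>\<^sup>+x. ennreal (ln r) + ennreal (- ln x) * indicator {0<..} x \<partial>\<mu>)"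
    proof (rule nn_integral_cong_AE)
      show "AE x in \<mu>. ennreal (ln r - ln x) + (ennreal (ln x) * indicator {0<..} x + ennreal (- ln r)) =
          ennreal (ln r) + ennreal (- ln x) * indicator {0<..} x"
        using AE'
      proof eventually_elim
        case (elim x)
        have pm: "ennreal z = ennreal (max 0 z)" for z by (simp add: max_def ennreal_neg)
        have "ln x \<le> ln r" using elim by simp
        then have "max 0 (ln r - ln x) + (max 0 (ln x) + max 0 (- ln r)) = max 0 (ln r) + max 0 (- ln x)"
          by (simp add: max_def)
        then have "ennreal (max 0 (ln r - ln x) + (max 0 (ln x) + max 0 (- ln r))) = ennreal (max 0 (ln r) + max 0 (- ln x))"
          by (rule arg_cong)
        then have "ennreal (ln r - ln x) + (ennreal (ln x) + ennreal (- ln r)) = ennreal (ln r) + ennreal (- ln x)"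
          unfolding pm[of "ln r - ln x"] pm[of "ln x"] pm[of "- ln r"] pm[of "ln r"] pm[of "- ln x"]
          by (simp only: ennreal_plus max.cobounded1 add_nonneg_nonneg)
        then show ?case using elim by simp
      qed
    qed
    then have eq: "K + (P + ennreal (- ln r) * ennreal (a 0)) = ennreal (ln r) * ennreal (a 0) + N"
      unfolding K_def P_def N_def const[symmetric] by (simp add: nn_integral_add)
    \<comment> \<open>The positive part is finite because the measure lives below \<open>r\<close>;
      only \<open>N\<close> can be infinite.\<close>
    have "P \<le> ennreal (ln r) * ennreal (a 0)"
      unfolding P_def const[symmetric]
    proof (rule nn_integral_mono_AE)
      show "AE x in \<mu>. ennreal (ln x) * indicator {0<..} x \<le> ennreal (ln r)"
        using AE' by eventually_elim (auto intro: ennreal_leI)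
    qed
    then have "P < top_class.top"
      by (rule order.strict_trans1) (simp add: ennreal_mult_less_top)
    then obtain P' where P': "P = ennreal P'" "0 \<le> P'" by (cases P) auto
    \<comment> \<open>With all other terms of \<open>eq\<close> finite, \<open>K\<close> and
      \<open>N\<close> are infinite together: either both limits are degenerate or the equation may
      be solved in the reals.\<close>
    show ?thesis
    proof (cases "(\<integral>\<^sup>+x. H x \<partial>\<mu>) = top_class.top")
      case top: True
      then have "K = top_class.top" unfolding HK by (simp add: ennreal_mult_eq_top_iff)
      then have "ennreal (ln r) * ennreal (a 0) + N = top_class.top" using eq by simp
      then have "N = top_class.top" by (simp add: ennreal_mult_eq_top_iff ennreal_add_eq_top)
      then have "I = -\<infinity>"
        unfolding I_def P_def[symmetric] N_def[symmetric] P' by (simp add: enn2ereal_ennreal P'(2))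
      with diverge top show ?thesis by simp
    next
      case fin: False
      then have summ: "summable (\<lambda>n. a n / real n)"
        unfolding HS by (rule summable_suminf_not_top[rotated]) (simp add: a0)
      define s where "s = suminf (\<lambda>n. a n / real n)"
      have s0: "0 \<le> s" unfolding s_def by (rule suminf_nonneg[OF summ]) (simp add: a0)
      have "2 * K = ennreal s"
        unfolding HK[symmetric] HS s_def
        by (rule suminf_ennreal2[OF _ summ]) (simp add: a0)
      moreover have "K \<noteq> top_class.top" using fin unfolding HK by (auto simp: ennreal_mult_eq_top_iff)
      then obtain K' where K': "K = ennreal K'" "0 \<le> K'" by (cases K) auto
      ultimately have "ennreal (2 * K') = ennreal s" by (simp add: ennreal_mult)
      then have sK: "s = 2 * K'" using s0 K'(2) by simp
      have "N \<noteq> top_class.top"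
      proof
        assume "N = top_class.top"
        then have "K + (P + ennreal (- ln r) * ennreal (a 0)) = top_class.top" using eq by simp
        then show False unfolding K' P' by (simp add: ennreal_mult_eq_top_iff ennreal_add_eq_top)
      qed
      then obtain N' where N': "N = ennreal N'" "0 \<le> N'" by (cases N) auto
      have "ennreal (K' + (P' + max 0 (- ln r) * a 0)) = ennreal (max 0 (ln r) * a 0 + N')"
      proof -
        have pm: "ennreal z = ennreal (max 0 z)" for z by (simp add: max_def ennreal_neg)
        show ?thesis
          using eq unfolding K' P' N' pm[of "ln r"] pm[of "- ln r"]
          using K'(2) P'(2) N'(2) a0[of 0] by (simp add: ennreal_plus ennreal_mult)
      qed
      then have "K' + (P' + max 0 (- ln r) * a 0) = max 0 (ln r) * a 0 + N'"
        using K'(2) P'(2) N'(2) a0[of 0] by (subst (asm) ennreal_inj) auto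
      moreover have "max 0 (ln r) * a 0 - max 0 (- ln r) * a 0 = a 0 * ln r"
      proof -
        have "max 0 (ln r) - max 0 (- ln r) = ln r" by (simp add: max_def)
        then show ?thesis by (metis left_diff_distrib mult.commute)
      qed
      ultimately have "P' - N' = a 0 * ln r - s / 2"
        unfolding sK by linarith
      then have "I = ereal (a 0 * ln r - s / 2)"
        unfolding I_def P_def[symmetric] N_def[symmetric] P' N'
        by (simp add: enn2ereal_ennreal P'(2) N'(2))
      moreover have "(\<lambda>N. exp (a 0 * ln r - (\<Sum>n\<le>N. a n / real n) / 2)) \<longlonglongrightarrow> exp (a 0 * ln r - s / 2)"
        unfolding s_def by (intro tendsto_intros summable_LIMSEQ' summ) simp
      ultimately show ?thesis using True by simp
    qed
  qed
qed

section \<open>The spectral measure and its moments\<close>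

context tracial_operator
begin

abbreviation \<mu> where "\<mu> \<equiv> interval_measure (density B)"

lemma emeasure_mu: "a \<le> b \<Longrightarrow> emeasure \<mu> {a<..b} = ennreal (density B b - density B a)"
  by (rule emeasure_interval_measure_Ioc) (auto intro: density_mono density_right_continuous)

text \<open>The measure is known on half-open intervals, so both rays are covered by countably many
  of these. The right endpoints on the negative side stay strictly below 0, where the density
  vanishes.\<close>

lemma AE_mu: "AE x in \<mu>. 0 \<le> x \<and> x \<le> r"
proof -
  have sub0: "{..<0} \<subseteq> (\<Union>(n, m)\<in>UNIV. {- real n<..- inverse (real (Suc m))})"
  proof
    fix x :: real assume "x \<in> {..<0}"
    then have "0 < - x" by simp
    obtain n where "- x < real n" using reals_Archimedean2 by blast
    moreover obtain m where "inverse (real (Suc m)) < - x"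
      using reals_Archimedean[OF \<open>0 < - x\<close>] by blast
    ultimately have "x \<in> {- real n<..- inverse (real (Suc m))}" by auto
    then show "x \<in> (\<Union>(n, m)\<in>UNIV. {- real n<..- inverse (real (Suc m))})" by blast
  qed
  have "(\<Union>(n, m)\<in>UNIV. {- real n<..- inverse (real (Suc m))}) \<in> null_sets \<mu>"
  proof (rule null_sets_UN', simp, safe)
    fix n m :: nat
    have "emeasure \<mu> {- real n<..- inverse (real (Suc m))} = 0"
    proof (cases "- real n \<le> - inverse (real (Suc m))")
      case True
      have neg: "- inverse (real (Suc m)) < 0" by simp
      then have "- real n < 0" using True by linarith
      with neg True show ?thesis by (simp only: emeasure_mu density_neg) simp
    qed (simp del: of_nat_Suc)
    then show "{- real n<..- inverse (real (Suc m))} \<in> null_sets \<mu>" by (simp add: null_sets_def)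
  qed
  then have "{..<0} \<in> null_sets \<mu>"
    by (rule null_sets_subset[OF _ _ sub0]) simp
  then have "AE x in \<mu>. x \<notin> {..<0}" by (rule AE_not_in)
  have subr: "{r<..} \<subseteq> (\<Union>n. {r<..r + real n})"
  proof
    fix x assume "x \<in> {r<..}"
    then obtain n where "x - r < real n" using reals_Archimedean2 by blast
    with \<open>x \<in> {r<..}\<close> show "x \<in> (\<Union>n. {r<..r + real n})" by (auto intro!: exI[of _ n])
  qed
  have "(\<Union>n. {r<..r + real n}) \<in> null_sets \<mu>"
  proof (rule null_sets_UN)
    show "{r<..r + real n} \<in> null_sets \<mu>" for n
      by (simp add: null_sets_def emeasure_mu density_full)
  qed
  then have "{r<..} \<in> null_sets \<mu>"
    by (rule null_sets_subset[OF _ _ subr]) simp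
  then have "AE x in \<mu>. x \<notin> {r<..}" by (rule AE_not_in)
  with \<open>AE x in \<mu>. x \<notin> {..<0}\<close> show ?thesis
    by eventually_elim auto
qed

lemma emeasure_mu_zero: "emeasure \<mu> {0} = ennreal (density B 0)"
proof -
  have "emeasure \<mu> {0} = emeasure \<mu> {-1<..0}"
    using AE_mu by (intro emeasure_eq_AE) (auto elim!: eventually_mono)
  then show ?thesis by (simp add: emeasure_mu density_neg)
qed

text \<open>As functions of \<open>c\<close>, the integral of \<open>h\<close> over
  \<open>{0<..c}\<close> and the trace of \<open>X ^ n * E c\<close> have increments over
  \<open>{x<..y}\<close> that both lie between \<open>h y\<close> and \<open>h x\<close> times the
  increment of the density. As \<open>h\<close> is Lipschitz,
  \<open>constant_if_increments_small\<close> makes their difference constant.\<close>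

lemma moments: "(\<integral>\<^sup>+x. ennreal ((1 - x\<^sup>2 / r\<^sup>2) ^ n) \<partial>\<mu>) = ennreal (tr (X ^ n))"
proof -
  define h where "h x = (1 - x\<^sup>2 / r\<^sup>2) ^ n" for x
  define J where "J S = (\<integral>\<^sup>+x. ennreal (h x) * indicator S x \<partial>\<mu>)" for S
  have [measurable]: "h \<in> borel_measurable borel" unfolding h_def by measurable
  have unit: "0 \<le> 1 - x\<^sup>2 / r\<^sup>2" "1 - x\<^sup>2 / r\<^sup>2 \<le> 1" if "0 \<le> x" "x \<le> r" for x
    using that r_pos power_mono[of x r 2] by (simp_all add: divide_le_eq)
  have h0: "0 \<le> h x" if "0 \<le> x" "x \<le> r" for x
    using unit[OF that] by (simp add: h_def)
  have hdec: "h y \<le> h x" if "0 \<le> x" "x \<le> y" "y \<le> r" for x y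
    unfolding h_def using that unit[of y] r_pos
    by (intro power_mono) (auto intro!: divide_right_mono power_mono)
  \<comment> \<open>The factor \<open>real n\<close> comes from differences of powers in the unit
    interval, the factor \<open>2 / r\<close> bounds the slope of
    \<open>x\<^sup>2 / r\<^sup>2\<close> up to \<open>r\<close>.\<close>
  have hlip: "h x - h y \<le> (real n * (2 / r)) * (y - x)" if "0 \<le> x" "x \<le> y" "y \<le> r" for x y
  proof -
    define u v where "u = 1 - x\<^sup>2 / r\<^sup>2" and "v = 1 - y\<^sup>2 / r\<^sup>2"
    have "norm (u ^ n - v ^ n) \<le> real n * norm (u - v)"
      using unit[of x] unit[of y] that by (intro norm_power_diff) (auto simp: u_def v_def)
    moreover have "norm (u - v) \<le> (2 / r) * (y - x)"
    proof -
      have "u - v = (y + x) * (y - x) / r\<^sup>2"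
        using r_pos by (simp add: u_def v_def field_simps power2_eq_square)
      also have "\<dots> = ((y + x) / r) * ((y - x) / r)" by (simp add: power2_eq_square)
      finally have *: "u - v = ((y + x) / r) * ((y - x) / r)" .
      have "(y + x) / r \<le> 2" using that r_pos by (simp add: divide_le_eq)
      then have "((y + x) / r) * ((y - x) / r) \<le> 2 * ((y - x) / r)"
        using that r_pos by (intro mult_right_mono) auto
      moreover have "0 \<le> u - v" unfolding * using that r_pos by simp
      ultimately show ?thesis using * by simp
    qed
    ultimately have "norm (u ^ n - v ^ n) \<le> real n * ((2 / r) * (y - x))"
      by (meson mult_left_mono of_nat_0_le_iff order_trans)
    moreover have "h x - h y \<le> norm (u ^ n - v ^ n)"
      by (simp add: h_def u_def v_def)
    ultimately show ?thesis by (simp add: mult.assoc)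
  qed
  have J_le: "J {x<..y} \<le> ennreal (h x * (density B y - density B x))"
    and J_ge: "ennreal (h y * (density B y - density B x)) \<le> J {x<..y}"
    if xy: "0 \<le> x" "x \<le> y" "y \<le> r" for x y
  proof -
    have c: "(\<integral>\<^sup>+z. ennreal c * indicator {x<..y} z \<partial>\<mu>) = ennreal (c * (density B y - density B x))"
      if "0 \<le> c" for c
      using that xy(2) by (subst nn_integral_cmult_indicator) (auto simp: emeasure_mu ennreal_mult density_mono)
    have "J {x<..y} \<le> (\<integral>\<^sup>+z. ennreal (h x) * indicator {x<..y} z \<partial>\<mu>)"
      unfolding J_def using xy hdec by (intro nn_integral_mono) (auto split: split_indicator intro!: ennreal_leI)
    then show "J {x<..y} \<le> ennreal (h x * (density B y - density B x))"
      using c[of "h x"] h0[of x] xy by simp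
    have "(\<integral>\<^sup>+z. ennreal (h y) * indicator {x<..y} z \<partial>\<mu>) \<le> J {x<..y}"
      unfolding J_def using xy hdec by (intro nn_integral_mono) (auto split: split_indicator intro!: ennreal_leI)
    then show "ennreal (h y * (density B y - density B x)) \<le> J {x<..y}"
      using c[of "h y"] h0[of y] xy by simp
  qed
  define j where "j x y = enn2real (J {x<..y})" for x y
  have j_nonneg: "0 \<le> j x y" for x y by (simp add: j_def)
  have J_j: "J {x<..y} = ennreal (j x y)" if "0 \<le> x" "x \<le> y" "y \<le> r" for x y
    unfolding j_def using le_less_trans[OF J_le[OF that] ennreal_less_top] by simp
  have j_split: "j 0 y = j 0 x + j x y" if xy: "0 \<le> x" "x \<le> y" "y \<le> r" for x y
  proof -
    have "J {0<..y} = J ({0<..x} \<union> {x<..y})"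
      using xy by (intro arg_cong[of _ _ J]) auto
    also have "\<dots> = J {0<..x} + J {x<..y}"
      unfolding J_def by (rule nn_integral_disjoint_pair) auto
    finally have "ennreal (j 0 y) = ennreal (j 0 x) + ennreal (j x y)"
      using xy by (simp add: J_j)
    also have "\<dots> = ennreal (j 0 x + j x y)"
      by (simp add: ennreal_plus j_nonneg)
    finally show ?thesis by (subst (asm) ennreal_inj) (auto intro: j_nonneg add_nonneg_nonneg)
  qed
  define k where "k c = j 0 c - tr (X ^ n * E c)" for c
  have "k r = k 0"
  proof (rule constant_if_increments_small[where K = k and a = 0 and b = r and \<Lambda> = "real n * (2 / r)" and F = "density B"])
    fix x y assume xy: "0 \<le> x" "x \<le> y" "y \<le> r"
    define d where "d = density B y - density B x"
    have d: "d = tr (E y) - tr (E x)" using xy by (simp add: d_def density_eq)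
    have "0 \<le> d" unfolding d_def using xy(2) by (simp add: density_mono)
    have "j x y \<le> h x * d" "h y * d \<le> j x y"
      using J_le[OF xy] J_ge[OF xy] h0[of x] h0[of y] xy \<open>0 \<le> d\<close>
      unfolding J_j[OF xy] d_def[symmetric] by (simp_all add: ennreal_le_iff j_nonneg)
    moreover have "tr (X ^ n * E y) - tr (X ^ n * E x) \<le> h x * d"
      "h y * d \<le> tr (X ^ n * E y) - tr (X ^ n * E x)"
      using tr_X_slice[OF xy, of n] unfolding d h_def by (simp_all add: right_diff_distrib op_trace_diff)
    moreover have "k y - k x = j x y - (tr (X ^ n * E y) - tr (X ^ n * E x))"
      using j_split[OF xy] by (simp add: k_def)
    ultimately have "\<bar>k y - k x\<bar> \<le> (h x - h y) * d" by (simp add: algebra_simps abs_le_iff)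
    also have "\<dots> \<le> (real n * (2 / r)) * (y - x) * d"
      using hlip[OF xy] \<open>0 \<le> d\<close> by (rule mult_right_mono)
    finally show "\<bar>k y - k x\<bar> \<le> real n * (2 / r) * (y - x) * (density B y - density B x)"
      by (simp add: d_def)
  qed (use r_pos in simp)
  moreover have "j 0 0 = 0" by (simp add: j_def J_def)
  ultimately have j0r: "j 0 r = tr (X ^ n) - density B 0"
    by (simp add: k_def E_full tr_X_kernel density_eq)
  have "(\<integral>\<^sup>+x. ennreal (h x) \<partial>\<mu>) = J ({0} \<union> {0<..r})"
    unfolding J_def
  proof (rule nn_integral_cong_AE)
    show "AE x in \<mu>. ennreal (h x) = ennreal (h x) * indicator ({0} \<union> {0<..r}) x"
      using AE_mu by eventually_elim (auto split: split_indicator)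
  qed
  also have "\<dots> = J {0} + J {0<..r}"
    unfolding J_def by (rule nn_integral_disjoint_pair) auto
  \<comment> \<open>Since \<open>h 0 = 1\<close>, the atom contributes its mass. It matches the
    trace of \<open>X ^ n * E 0\<close>, which was split off in \<open>j0r\<close>.\<close>
  also have "J {0} = ennreal (density B 0)"
  proof -
    have "J {0} = (\<integral>\<^sup>+x. ennreal 1 * indicator {0} x \<partial>\<mu>)"
      unfolding J_def by (intro nn_integral_cong) (auto split: split_indicator simp: h_def)
    also have "\<dots> = ennreal (density B 0)"
      by (subst nn_integral_cmult_indicator) (auto simp: emeasure_mu_zero)
    finally show ?thesis .
  qed
  also have "ennreal (density B 0) + J {0<..r} = ennreal (tr (X ^ n))"
  proof -
    have "0 \<le> density B 0" by (simp add: density_eq tr_E_nonneg)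
    then have "ennreal (density B 0) + J {0<..r} = ennreal (density B 0 + j 0 r)"
      using r_pos by (simp add: J_j ennreal_plus j_nonneg)
    then show ?thesis by (simp add: j0r)
  qed
  finally show ?thesis by (simp add: h_def)
qed

theorem regular_determinant_limit:
  defines "I \<equiv> enn2ereal (\<integral>\<^sup>+x\<in>{0<..}. ennreal (ln x) \<partial>\<mu>) - enn2ereal (\<integral>\<^sup>+x\<in>{0<..}. ennreal (- ln x) \<partial>\<mu>)"
  shows "(\<lambda>N. exp (real p * ln r - (\<Sum>n\<le>N. tr (X ^ n) / real n) / 2)) \<longlonglongrightarrow>
    (if (\<forall>x. app Q x = x \<longrightarrow> app B x = 0 \<longrightarrow> x = 0) \<and> I > -\<infinity> then exp (real_of_ereal I) else 0)"
proof -
  have "emeasure \<mu> {0} = 0 \<longleftrightarrow> density B 0 = 0"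
    using tr_E_nonneg[of 0] by (simp add: emeasure_mu_zero density_eq ennreal_eq_0_iff)
  then have zero: "emeasure \<mu> {0} = 0 \<longleftrightarrow> (\<forall>x. app Q x = x \<longrightarrow> app B x = 0 \<longrightarrow> x = 0)"
    by (simp only: density_zero_iff)
  show ?thesis
    using log_integral_moments[of \<mu> r "\<lambda>n. tr (X ^ n)",
        OF sets_interval_measure r_pos AE_mu tr_X_nonneg moments]
    by (simp only: I_def tr_one zero power_0)
qed

end

section \<open>Convexity along one-parameter families\<close>

lemma has_vector_derivative_power:
  fixes X :: "real \<Rightarrow> 'h::hilbert_space endo"
  assumes "(X has_vector_derivative X') (at s)"
  shows "((\<lambda>s. X s ^ n) has_vector_derivative (\<Sum>b<n. X s ^ (n - Suc b) * X' * X s ^ b)) (at s)"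
proof (induction n)
  case (Suc n)
  have "((\<lambda>s. X s * X s ^ n) has_vector_derivative
      X s * (\<Sum>b<n. X s ^ (n - Suc b) * X' * X s ^ b) + X' * X s ^ n) (at s)"
    by (rule has_vector_derivative_mult[OF assms Suc])
  also have "X s * (\<Sum>b<n. X s ^ (n - Suc b) * X' * X s ^ b) + X' * X s ^ n =
      (\<Sum>b<Suc n. X s ^ (Suc n - Suc b) * X' * X s ^ b)"
  proof -
    have "X s * (\<Sum>b<n. X s ^ (n - Suc b) * X' * X s ^ b) = (\<Sum>b<n. X s ^ (Suc n - Suc b) * X' * X s ^ b)"
      unfolding sum_distrib_left
    proof (rule sum.cong[OF refl])
      fix b assume "b \<in> {..<n}"
      then have "Suc n - Suc b = Suc (n - Suc b)" by auto
      then show "X s * (X s ^ (n - Suc b) * X' * X s ^ b) = X s ^ (Suc n - Suc b) * X' * X s ^ b"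
        by (simp add: mult.assoc del: diff_Suc_Suc)
    qed
    then show ?thesis by simp
  qed
  finally show ?case by simp
qed simp

lemma has_vector_derivative_scaleR_const:
  fixes a :: "'h::real_normed_vector"
  assumes "(f has_real_derivative f') (at s)"
  shows "((\<lambda>s. f s *\<^sub>R a) has_vector_derivative f' *\<^sub>R a) (at s)"
  using has_vector_derivative_scaleR[OF assms has_vector_derivative_const[of a]] by simp

text \<open>Moving \<open>f\<close> to the right through powers of \<open>1 - a * f\<close> turns
  them into powers of \<open>Y = 1 - f * a\<close>, and the factor \<open>f * a = 1 - Y\<close>
  makes each term a difference of consecutive powers. Summation over \<open>k\<close> leaves words
  with \<open>N - 1\<close> factors around \<open>w\<close>, the shape in which positivity is
  visible.\<close>

lemma telescoping_identity:
  fixes f a w :: "'r::ring_1"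
  shows "(\<Sum>k<N. w * (1 - a * f) ^ k - f * (\<Sum>b<k. (1 - a * f) ^ (k - Suc b) * (a * w) * (1 - a * f) ^ b)) =
    (\<Sum>b<N. (1 - f * a) ^ (N - Suc b) * w * (1 - a * f) ^ b)"
proof (induction N)
  case (Suc N)
  define X Y where "X = 1 - a * f" and "Y = 1 - f * a"
  have fX: "f * X ^ i = Y ^ i * f" for i
  proof (induction i)
    case (Suc i)
    have "f * X ^ Suc i = (f * X ^ i) * X" by (simp add: power_Suc2 mult.assoc del: power_Suc)
    also have "\<dots> = Y ^ i * (f * X)" by (simp only: Suc.IH mult.assoc)
    also have "f * X = Y * f" by (simp add: X_def Y_def algebra_simps)
    finally show ?case by (simp add: power_Suc2 mult.assoc del: power_Suc)
  qed simp
  have fXa: "f * (X ^ i * (a * z)) = (Y ^ i - Y ^ Suc i) * z" for i z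
  proof -
    have "f * (X ^ i * (a * z)) = Y ^ i * (f * a) * z" by (simp add: fX mult.assoc[symmetric])
    also have "Y ^ i * (f * a) = Y ^ i - Y ^ Suc i" by (simp add: Y_def power_Suc2 algebra_simps del: power_Suc)
    finally show ?thesis .
  qed
  have "w * X ^ N - f * (\<Sum>b<N. X ^ (N - Suc b) * (a * w) * X ^ b) =
      w * X ^ N - (\<Sum>b<N. (Y ^ (N - Suc b) - Y ^ Suc (N - Suc b)) * w * X ^ b)"
    by (simp add: sum_distrib_left mult.assoc fXa del: power_Suc)
  also have "\<dots> = w * X ^ N - (\<Sum>b<N. Y ^ (N - Suc b) * w * X ^ b) + (\<Sum>b<N. Y ^ (Suc N - Suc b) * w * X ^ b)"
  proof -
    have "(\<Sum>b<N. (Y ^ (N - Suc b) - Y ^ Suc (N - Suc b)) * w * X ^ b) =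
        (\<Sum>b<N. Y ^ (N - Suc b) * w * X ^ b - Y ^ (Suc N - Suc b) * w * X ^ b)"
    proof (rule sum.cong[OF refl])
      fix b assume "b \<in> {..<N}"
      then have "Suc N - Suc b = Suc (N - Suc b)" by auto
      then show "(Y ^ (N - Suc b) - Y ^ Suc (N - Suc b)) * w * X ^ b =
          Y ^ (N - Suc b) * w * X ^ b - Y ^ (Suc N - Suc b) * w * X ^ b"
        by (simp only: left_diff_distrib)
    qed
    then show ?thesis by (simp add: sum_subtractf)
  qed
  finally show ?case
    using Suc.IH unfolding X_def[symmetric] Y_def[symmetric] by simp
qed simp

text \<open>\<open>J\<close> is the imaginary unit, so the factor in \<open>W_b\<close> is the
  exponential of \<open>\<theta> * d k\<close> times the imaginary unit. \<open>W \<theta>\<close>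
  is unitary but need not lie in the commutant; that it fixes the vectors \<open>e i\<close> is what
  lets conjugation by it preserve traces.\<close>

locale tracial_flow = tracial +
  fixes J :: "'a endo" and A :: "'k set" and b :: "'k \<Rightarrow> 'a endo" and d :: "'k \<Rightarrow> real"
    and W :: "real \<Rightarrow> 'a endo"
  assumes J_sq: "J * J = - 1" and J_adj: "adj J = - J" and J_mem: "J \<in> \<U>"
    and J_commutant: "J \<in> commutant \<U>"
    and b_commutant: "k \<in> A \<Longrightarrow> b k \<in> commutant \<U>"
    and W_b: "k \<in> A \<Longrightarrow> W \<theta> * b k * W (- \<theta>) = (cos (\<theta> * d k) *\<^sub>R 1 + sin (\<theta> * d k) *\<^sub>R J) * b k"
    and W_inverse: "W \<theta> * W (- \<theta>) = 1" and W_adj: "adj (W \<theta>) = W (- \<theta>)"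
    and W_e: "i < p \<Longrightarrow> app (W \<theta>) (e i) = e i" and W_J: "W \<theta> * J = J * W \<theta>"
begin

text \<open>\<open>fam m s \<theta>\<close> is the \<open>m\<close>-th derivative of the holomorphic family
  \<open>z \<mapsto> \<Sum>\<^sub>k e\<^bsup>z d\<^sub>k\<^esup> b\<^sub>k\<close> at \<open>z = s + \<i>\<theta>\<close>. Conjugation by \<open>W \<theta>\<close> translates it in
  the imaginary direction, so traces of polynomials in the family and its adjoint depend on \<open>s\<close> only
  and their second derivative in \<open>s\<close> is their Laplacian.\<close>

definition fam :: "nat \<Rightarrow> real \<Rightarrow> real \<Rightarrow> 'a endo"
  where "fam m s \<theta> = (\<Sum>k\<in>A. (d k ^ m * exp (s * d k)) *\<^sub>R
    ((cos (\<theta> * d k) *\<^sub>R 1 + sin (\<theta> * d k) *\<^sub>R J) * b k))"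

text \<open>In contrast to the operator of the same name in \<open>tracial_operator\<close>, the
  argument is expected to be scaled to norm at most 1 already.\<close>

definition X where "X g = 1 - adj g * g"

text \<open>A truncated Neumann series for the inverse of \<open>adj g * g\<close>, as produced by
  differentiating the logarithm series.\<close>

definition geo where "geo N g = (\<Sum>k<N. X g ^ k)"

lemma fam_commutant: "fam m s \<theta> \<in> commutant \<U>"
  unfolding fam_def
  by (intro commutant_sum commutant_scaleR commutant_mult commutant_add commutant_one J_commutant b_commutant)

lemma X_commutant: "g \<in> commutant \<U> \<Longrightarrow> X g \<in> commutant \<U>"
  unfolding X_def by (intro commutant_diff commutant_mult commutant_one commutant_adj)

lemma fam_derivative_s: "((\<lambda>s. fam m s \<theta>) has_vector_derivative fam (Suc m) s \<theta>) (at s)"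
  unfolding fam_def
proof (rule has_vector_derivative_sum)
  fix k
  have "((\<lambda>s. d k ^ m * exp (s * d k)) has_real_derivative d k ^ Suc m * exp (s * d k)) (at s)"
    by (auto intro!: derivative_eq_intros)
  then show "((\<lambda>s. (d k ^ m * exp (s * d k)) *\<^sub>R ((cos (\<theta> * d k) *\<^sub>R 1 + sin (\<theta> * d k) *\<^sub>R J) * b k))
      has_vector_derivative (d k ^ Suc m * exp (s * d k)) *\<^sub>R
        ((cos (\<theta> * d k) *\<^sub>R 1 + sin (\<theta> * d k) *\<^sub>R J) * b k)) (at s)"
    by (rule has_vector_derivative_scaleR_const)
qed

text \<open>These are the Cauchy-Riemann equations: differentiating in the imaginary direction is
  differentiating in \<open>s\<close> and multiplying by \<open>J\<close>.\<close>

lemma fam_derivative_theta: "((\<lambda>\<theta>. fam m s \<theta>) has_vector_derivative J * fam (Suc m) s \<theta>) (at \<theta>)"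
proof -
  have "((\<lambda>\<theta>. fam m s \<theta>) has_vector_derivative
    (\<Sum>k\<in>A. J * ((d k ^ Suc m * exp (s * d k)) *\<^sub>R ((cos (\<theta> * d k) *\<^sub>R 1 + sin (\<theta> * d k) *\<^sub>R J) * b k)))) (at \<theta>)"
    unfolding fam_def
  proof (rule has_vector_derivative_sum)
    fix k
    define c where "c = d k ^ m * exp (s * d k)"
    have "((\<lambda>\<theta>. c * cos (\<theta> * d k)) has_real_derivative - (c * d k * sin (\<theta> * d k))) (at \<theta>)"
      "((\<lambda>\<theta>. c * sin (\<theta> * d k)) has_real_derivative c * d k * cos (\<theta> * d k)) (at \<theta>)"
      by (auto intro!: derivative_eq_intros)
    then have "((\<lambda>\<theta>. (c * cos (\<theta> * d k)) *\<^sub>R b k + (c * sin (\<theta> * d k)) *\<^sub>R (J * b k)) has_vector_derivative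
        (- (c * d k * sin (\<theta> * d k))) *\<^sub>R b k + (c * d k * cos (\<theta> * d k)) *\<^sub>R (J * b k)) (at \<theta>)"
      by (intro has_vector_derivative_add has_vector_derivative_scaleR_const)
    moreover have "(\<lambda>\<theta>. (c * cos (\<theta> * d k)) *\<^sub>R b k + (c * sin (\<theta> * d k)) *\<^sub>R (J * b k)) =
        (\<lambda>\<theta>. (d k ^ m * exp (s * d k)) *\<^sub>R ((cos (\<theta> * d k) *\<^sub>R 1 + sin (\<theta> * d k) *\<^sub>R J) * b k))"
      by (intro ext) (simp add: c_def distrib_right scaleR_add_right)
    moreover have "(- (c * d k * sin (\<theta> * d k))) *\<^sub>R b k + (c * d k * cos (\<theta> * d k)) *\<^sub>R (J * b k) =
        J * ((d k ^ Suc m * exp (s * d k)) *\<^sub>R ((cos (\<theta> * d k) *\<^sub>R 1 + sin (\<theta> * d k) *\<^sub>R J) * b k))"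
    proof -
      have "J * (J * b k) = - b k" using J_sq by (simp flip: mult.assoc)
      then show ?thesis by (simp add: c_def distrib_left distrib_right scaleR_add_right mult_ac)
    qed
    ultimately show "((\<lambda>\<theta>. (d k ^ m * exp (s * d k)) *\<^sub>R ((cos (\<theta> * d k) *\<^sub>R 1 + sin (\<theta> * d k) *\<^sub>R J) * b k))
      has_vector_derivative
        J * ((d k ^ Suc m * exp (s * d k)) *\<^sub>R ((cos (\<theta> * d k) *\<^sub>R 1 + sin (\<theta> * d k) *\<^sub>R J) * b k))) (at \<theta>)"
      by simp
  qed
  then show ?thesis by (simp only: fam_def sum_distrib_left)
qed

lemma W_inverse': "W (- \<theta>) * W \<theta> = 1"
  using W_inverse[of "- \<theta>"] by simp

lemma W_fam: "W \<theta> * fam m s 0 * W (- \<theta>) = fam m s \<theta>"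
  unfolding fam_def sum_distrib_left sum_distrib_right
  by (rule sum.cong) (simp_all add: W_b)

definition conj_W where "conj_W \<theta> Z = W \<theta> * Z * W (- \<theta>)"

lemma conj_W_mult: "conj_W \<theta> (Y * Z) = conj_W \<theta> Y * conj_W \<theta> Z"
proof -
  have "conj_W \<theta> Y * conj_W \<theta> Z = W \<theta> * Y * (W (- \<theta>) * W \<theta>) * Z * W (- \<theta>)"
    by (simp only: conj_W_def mult.assoc)
  then show ?thesis by (simp add: W_inverse' conj_W_def mult.assoc)
qed

lemma conj_W_one: "conj_W \<theta> 1 = 1"
  by (simp add: conj_W_def W_inverse)

lemma conj_W_power: "conj_W \<theta> (Y ^ n) = conj_W \<theta> Y ^ n"
  by (induction n) (simp_all add: conj_W_one conj_W_mult)

lemma conj_W_adj: "conj_W \<theta> (adj Y) = adj (conj_W \<theta> Y)"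
  by (simp add: conj_W_def adj_mult W_adj mult.assoc)

lemma conj_W_diff: "conj_W \<theta> (Y - Z) = conj_W \<theta> Y - conj_W \<theta> Z"
  by (simp add: conj_W_def algebra_simps)

lemma conj_W_sum: "conj_W \<theta> (\<Sum>i\<in>I. g i) = (\<Sum>i\<in>I. conj_W \<theta> (g i))"
  by (simp add: conj_W_def sum_distrib_left sum_distrib_right)

lemma conj_W_J: "conj_W \<theta> J = J"
  using W_J[of \<theta>] W_inverse[of \<theta>] by (simp add: conj_W_def mult.assoc)

text \<open>\<open>trace_commute\<close> does not apply to \<open>W\<close>. Instead
  \<open>W (- \<theta>)\<close> and the adjoint of \<open>W \<theta>\<close>, which coincide, fix
  the vectors \<open>e i\<close>.\<close>

lemma tr_conj_W: "tr (conj_W \<theta> Z) = tr Z"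
proof -
  have "inner (app (conj_W \<theta> Z) (e i)) (e i) = inner (app Z (e i)) (e i)" if "i < p" for i
    using that by (simp add: conj_W_def inner_app_left[of "W \<theta>"] W_adj W_e)
  then show ?thesis by (simp add: op_trace_def)
qed

lemma conj_W_fam: "conj_W \<theta> (fam m s 0) = fam m s \<theta>"
  by (simp add: conj_W_def W_fam)

lemma J_fam: "g \<in> commutant \<U> \<Longrightarrow> J * g = g * J"
  using commutantD[OF _ J_mem] by metis

lemma tr_derivative:
  "(Z has_vector_derivative Z') F \<Longrightarrow> ((\<lambda>s. tr (Z s)) has_vector_derivative tr Z') F"
  by (rule bounded_linear.has_vector_derivative[OF bounded_linear_op_trace])

lemma adj_derivative:
  "(Z has_vector_derivative Z') F \<Longrightarrow> ((\<lambda>s. adj (Z s)) has_vector_derivative adj Z') F"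
  by (rule bounded_linear.has_vector_derivative[OF bounded_linear_adj])

lemma X_derivative:
  assumes "(g has_vector_derivative w) (at s)"
  shows "((\<lambda>s. X (g s)) has_vector_derivative - (adj w * g s + adj (g s) * w)) (at s)"
proof -
  have "((\<lambda>s. 1 - adj (g s) * g s) has_vector_derivative 0 - (adj (g s) * w + adj w * g s)) (at s)"
    by (intro has_vector_derivative_diff has_vector_derivative_const has_vector_derivative_mult
        adj_derivative assms)
  then show ?thesis by (simp add: X_def algebra_simps)
qed

text \<open>The derivative of \<open>f * geo N f\<close> at \<open>f\<close> in direction
  \<open>w\<close>. Because of \<open>adj w\<close> it is linear in \<open>w\<close> over the reals
  only.\<close>

definition V where "V N f w = (\<Sum>k<N. w * X f ^ k - f *
  (\<Sum>b<k. X f ^ (k - Suc b) * (adj w * f + adj f * w) * X f ^ b))"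

lemma mult_geo_derivative:
  assumes "(g has_vector_derivative w) (at s)"
  shows "((\<lambda>s. g s * geo N (g s)) has_vector_derivative V N (g s) w) (at s)"
proof -
  have "((\<lambda>s. \<Sum>k<N. g s * X (g s) ^ k) has_vector_derivative
      (\<Sum>k<N. g s * (\<Sum>b<k. X (g s) ^ (k - Suc b) * - (adj w * g s + adj (g s) * w) * X (g s) ^ b) + w * X (g s) ^ k)) (at s)"
    by (intro has_vector_derivative_sum has_vector_derivative_mult has_vector_derivative_power
        X_derivative assms)
  moreover have "g s * (\<Sum>b<k. X (g s) ^ (k - Suc b) * - (adj w * g s + adj (g s) * w) * X (g s) ^ b) + w * X (g s) ^ k =
      w * X (g s) ^ k - g s * (\<Sum>b<k. X (g s) ^ (k - Suc b) * (adj w * g s + adj (g s) * w) * X (g s) ^ b)" for k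
    by (simp only: mult_minus_right mult_minus_left sum_negf) simp
  moreover have "g s * geo N (g s) = (\<Sum>k<N. g s * X (g s) ^ k)" for s
    by (simp add: geo_def sum_distrib_left)
  ultimately show ?thesis
    by (simp only: V_def)
qed

text \<open>Combining the directions \<open>w\<close> and \<open>J * w\<close> cancels the part of
  \<open>V\<close> that is conjugate-linear in \<open>w\<close>, that is, the terms with
  \<open>adj w * f\<close>. The complex-linear part is doubled and collapses by
  \<open>telescoping_identity\<close>.\<close>

lemma V_complex:
  assumes f: "f \<in> commutant \<U>" and w: "w \<in> commutant \<U>"
  shows "tr (adj w * V N f w) + tr (adj (J * w) * V N f (J * w)) =
    2 * (\<Sum>b<N. tr (adj w * (1 - f * adj f) ^ (N - Suc b) * w * X f ^ b))"
proof -
  have Jc: "J * z = z * J" if "z \<in> commutant \<U>" for z using that by (rule J_fam)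
  have Jw: "adj (J * w) = - J * adj w"
    using Jc[OF commutant_adj[OF w]] by (simp add: adj_mult J_adj)
  have JX: "J * (X f ^ i * z) = X f ^ i * (J * z)" for i z
    using Jc[OF commutant_power[OF X_commutant[OF f]], of i] by (metis mult.assoc)
  have Jf: "J * (f * z) = f * (J * z)" "J * (adj f * z) = adj f * (J * z)" "J * (adj w * z) = adj w * (J * z)" for z
    using Jc[OF f] Jc[OF commutant_adj[OF f]] Jc[OF commutant_adj[OF w]] by (metis mult.assoc)+
  have JJ: "J * (J * z) = - z" for z using J_sq by (simp flip: mult.assoc)
  \<comment> \<open>Passing to \<open>J * w\<close> and multiplying back by \<open>- J\<close>
    preserves the term with \<open>w\<close> but reverses the sign of the one with
    \<open>adj w\<close>, since \<open>adj (J * w) = - J * adj w\<close>.\<close>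
  have conj_term: "- J * (X f ^ i * (adj (J * w) * f + adj f * (J * w)) * X f ^ l) =
      X f ^ i * (- (adj w * f) + adj f * w) * X f ^ l" for i l
  proof -
    have "adj (J * w) * f + adj f * (J * w) = J * (- (adj w * f) + adj f * w)"
      unfolding Jw by (simp add: mult.assoc Jf algebra_simps)
    then show ?thesis by (simp only: mult.assoc mult_minus_left JX JJ) simp
  qed
  have "- J * V N f (J * w) = (\<Sum>k<N. w * X f ^ k - f *
      (\<Sum>b<k. X f ^ (k - Suc b) * (- (adj w * f) + adj f * w) * X f ^ b))"
  proof -
    have "- J * V N f (J * w) = (\<Sum>k<N. - J * ((J * w) * X f ^ k) - f *
      (\<Sum>b<k. - J * (X f ^ (k - Suc b) * (adj (J * w) * f + adj f * (J * w)) * X f ^ b)))"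
      unfolding V_def sum_distrib_left[of "- J"] right_diff_distrib[of "- J"]
      by (intro sum.cong refl arg_cong2[of _ _ _ _ "(-)"])
         (simp_all add: mult.assoc Jf sum_distrib_left)
    then show ?thesis unfolding conj_term by (simp add: mult.assoc JJ)
  qed
  moreover have double: "(u - f * S1) + (u - f * S2) = 2 *\<^sub>R (u - f * S3)"
    if "S1 + S2 = 2 *\<^sub>R S3" for u S1 S2 S3
  proof -
    have "f * S1 + f * S2 = f * S3 + f * S3"
      using that by (metis distrib_left scaleR_2)
    then show ?thesis by (simp add: scaleR_2 algebra_simps)
  qed
  ultimately have "V N f w + (- J) * V N f (J * w) =
      (\<Sum>k<N. (w * X f ^ k - f * (\<Sum>b<k. X f ^ (k - Suc b) * (adj w * f + adj f * w) * X f ^ b)) +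
        (w * X f ^ k - f * (\<Sum>b<k. X f ^ (k - Suc b) * (- (adj w * f) + adj f * w) * X f ^ b)))"
    unfolding V_def by (simp add: sum.distrib)
  also have "\<dots> = (\<Sum>k<N. 2 *\<^sub>R (w * X f ^ k - f * (\<Sum>b<k. X f ^ (k - Suc b) * (adj f * w) * X f ^ b)))"
  proof (rule sum.cong[OF refl])
    fix k
    have "(\<Sum>b<k. X f ^ (k - Suc b) * (adj w * f + adj f * w) * X f ^ b) +
        (\<Sum>b<k. X f ^ (k - Suc b) * (- (adj w * f) + adj f * w) * X f ^ b) =
        2 *\<^sub>R (\<Sum>b<k. X f ^ (k - Suc b) * (adj f * w) * X f ^ b)"
      unfolding sum.distrib[symmetric] scaleR_sum_right
      by (rule sum.cong[OF refl]) (simp add: scaleR_2 algebra_simps)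
    then show "(w * X f ^ k - f * (\<Sum>b<k. X f ^ (k - Suc b) * (adj w * f + adj f * w) * X f ^ b)) +
        (w * X f ^ k - f * (\<Sum>b<k. X f ^ (k - Suc b) * (- (adj w * f) + adj f * w) * X f ^ b)) =
        2 *\<^sub>R (w * X f ^ k - f * (\<Sum>b<k. X f ^ (k - Suc b) * (adj f * w) * X f ^ b))"
      by (rule double)
  qed
  also have "\<dots> = 2 *\<^sub>R (\<Sum>b<N. (1 - f * adj f) ^ (N - Suc b) * w * X f ^ b)"
    unfolding scaleR_sum_right[symmetric] X_def telescoping_identity ..
  finally have eq: "V N f w + (- J) * V N f (J * w) = 2 *\<^sub>R (\<Sum>b<N. (1 - f * adj f) ^ (N - Suc b) * w * X f ^ b)" .
  have "adj (J * w) * V N f (J * w) = adj w * (- J * V N f (J * w))"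
    unfolding Jw by (simp add: mult.assoc Jf)
  then have "tr (adj w * V N f w) + tr (adj (J * w) * V N f (J * w)) =
      tr (adj w * (V N f w + (- J) * V N f (J * w)))"
    by (simp only: op_trace_add distrib_left)
  also have "\<dots> = 2 * (\<Sum>b<N. tr (adj w * (1 - f * adj f) ^ (N - Suc b) * w * X f ^ b))"
    unfolding eq by (simp add: op_trace_scaleR op_trace_sum sum_distrib_left mult.assoc)
  finally show ?thesis .
qed

text \<open>Under the trace the \<open>n + 1\<close> terms of the derivative of a power of exponent
  \<open>n + 1\<close> coincide by cyclicity, which cancels the denominator. The two halves of the
  derivative of \<open>X\<close> give adjoint operators and hence the same real trace; this is the
  factor 2.\<close>

lemma tr_power_derivative:
  assumes "\<And>s. g s \<in> commutant \<U>" "w \<in> commutant \<U>" "(g has_vector_derivative w) (at s)"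
  shows "((\<lambda>s. - (\<Sum>n\<le>N. tr (X (g s) ^ n) / real n)) has_vector_derivative
    2 * tr (adj w * (g s * geo N (g s)))) (at s)"
proof -
  define X' where "X' = - (adj w * g s + adj (g s) * w)"
  have X'c: "X' \<in> commutant \<U>"
  proof -
    have "adj w * g s + adj (g s) * w \<in> commutant \<U>"
      using assms(1,2) by (intro commutant_add commutant_mult commutant_adj)
    from commutant_scaleR[OF this, of "- 1"] show ?thesis by (simp add: X'_def)
  qed
  have der: "((\<lambda>s. tr (X (g s) ^ Suc n) / real (Suc n)) has_vector_derivative tr (X (g s) ^ n * X')) (at s)" for n
  proof -
    have "((\<lambda>s. tr (X (g s) ^ Suc n)) has_vector_derivative
        tr (\<Sum>b<Suc n. X (g s) ^ (Suc n - Suc b) * X' * X (g s) ^ b)) (at s)"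
      unfolding X'_def by (intro tr_derivative has_vector_derivative_power X_derivative assms)
    moreover have "tr (\<Sum>b<Suc n. X (g s) ^ (Suc n - Suc b) * X' * X (g s) ^ b) = (\<Sum>b<Suc n. tr (X (g s) ^ n * X'))"
      unfolding op_trace_sum
    proof (rule sum.cong[OF refl])
      fix l assume "l \<in> {..<Suc n}"
      then have n: "l + (n - l) = n" by auto
      have "tr (X (g s) ^ (Suc n - Suc l) * X' * X (g s) ^ l) = tr (X (g s) ^ l * (X (g s) ^ (n - l) * X'))"
        using assms(1) X'c by (subst trace_commute) (auto intro: commutant_mult commutant_power X_commutant)
      also have "X (g s) ^ l * (X (g s) ^ (n - l) * X') = X (g s) ^ n * X'"
        by (simp only: mult.assoc[symmetric] power_add[symmetric] n)
      finally show "tr (X (g s) ^ (Suc n - Suc l) * X' * X (g s) ^ l) = tr (X (g s) ^ n * X')" .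
    qed
    ultimately have "((\<lambda>s. tr (X (g s) ^ Suc n)) has_vector_derivative real (Suc n) * tr (X (g s) ^ n * X')) (at s)"
      by (simp only: sum_constant card_lessThan)
    from has_vector_derivative_mult_right[OF this, of "1 / real (Suc n)"]
    show ?thesis by (simp del: of_nat_Suc power_Suc)
  qed
  have val: "tr (X (g s) ^ n * X') = - (2 * tr (adj w * (g s * X (g s) ^ n)))" for n
  proof -
    have Xn: "X (g s) ^ n \<in> commutant \<U>" using assms(1) by (intro commutant_power X_commutant)
    have adjX: "adj (X (g s) ^ n) = X (g s) ^ n" by (simp add: adj_power X_def adj_diff adj_mult)
    have 1: "tr (X (g s) ^ n * (adj w * g s)) = tr (adj w * (g s * X (g s) ^ n))"
      using trace_commute[OF Xn, of "adj w * g s"] assms(1,2)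
      by (simp add: commutant_mult commutant_adj mult.assoc)
    have "tr (X (g s) ^ n * (adj (g s) * w)) = tr (adj (adj w * (g s * X (g s) ^ n)))"
      by (simp add: adj_mult adjX mult.assoc)
    also have "\<dots> = tr (adj w * (g s * X (g s) ^ n))" by (rule op_trace_adj)
    finally have 2: "tr (X (g s) ^ n * (adj (g s) * w)) = tr (adj w * (g s * X (g s) ^ n))" .
    have "X (g s) ^ n * X' = (-1) *\<^sub>R (X (g s) ^ n * (adj w * g s) + X (g s) ^ n * (adj (g s) * w))"
      by (simp only: X'_def mult_minus_right distrib_left scaleR_minus_left scaleR_one)
    then show ?thesis by (simp only: op_trace_scaleR op_trace_add 1 2) simp
  qed
  have "((\<lambda>s. - (\<Sum>n<N. tr (X (g s) ^ Suc n) / real (Suc n))) has_vector_derivative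
      - (\<Sum>n<N. tr (X (g s) ^ n * X'))) (at s)"
    by (intro has_vector_derivative_minus has_vector_derivative_sum der)
  moreover have "(\<Sum>n\<le>N. tr (X (g s) ^ n) / real n) = (\<Sum>n<N. tr (X (g s) ^ Suc n) / real (Suc n))" for s
    using sum.atMost_shift[of "\<lambda>n. tr (X (g s) ^ n) / real n" N] by simp
  moreover have "- (\<Sum>n<N. tr (X (g s) ^ n * X')) = 2 * tr (adj w * (g s * geo N (g s)))"
    by (simp add: val geo_def sum_distrib_left op_trace_sum sum_negf)
  ultimately show ?thesis by simp
qed

lemma X_positive: "norm g \<le> 1 \<Longrightarrow> positive (X g)"
  unfolding positive_def
proof (intro conjI allI)
  fix x assume "norm g \<le> 1"
  then have "norm (app g x) \<le> norm x"
    using norm_app_le[of g x] by (meson mult_left_le_one_le norm_ge_zero order_trans)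
  then have "(norm (app g x))\<^sup>2 \<le> (norm x)\<^sup>2" by (simp add: power_mono)
  then show "0 \<le> inner (app (X g) x) x"
    by (simp add: X_def inner_diff_left dot_square_norm inner_app_left[of "adj g"])
qed (simp add: X_def adj_diff adj_mult)

text \<open>An odd sum of exponents leaves one of them even. Half of that power is moved cyclically
  to the other end, which exhibits the operator as \<open>adj v * P * v\<close> with
  \<open>P\<close> a power of a positive operator. Evenness of \<open>N\<close> in the next theorem
  serves to provide this parity.\<close>

lemma tr_sandwich_nonneg:
  assumes Y: "positive Y" "Y \<in> commutant \<U>" and Z: "positive Z" "Z \<in> commutant \<U>"
    and w: "w \<in> commutant \<U>" and "odd (c + l)"
  shows "0 \<le> tr (adj w * Y ^ c * w * Z ^ l)"
proof -
  have conj_nonneg: "0 \<le> tr (adj v * P * v)" if "positive P" for v P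
  proof (rule op_trace_nonneg)
    show "0 \<le> inner (app (adj v * P * v) x) x" for x
      using positive_inner[OF that, of "app v x"] by (simp add: inner_app_left[of "adj v"])
  qed
  have Yn: "adj (Y ^ n) = Y ^ n" "Y ^ n \<in> commutant \<U>" and Zn: "adj (Z ^ n) = Z ^ n" "Z ^ n \<in> commutant \<U>" for n
    using Y Z by (simp_all add: adj_power positive_adj commutant_power)
  note comm = commutant_mult commutant_adj w Yn(2) Zn(2)
  show ?thesis
  proof (cases "even l")
    case True
    then obtain m where l: "l = m + m" by (auto elim!: evenE simp: mult_2)
    have "tr (adj w * Y ^ c * w * Z ^ l) = tr (adj w * Y ^ c * w * Z ^ m * Z ^ m)"
      by (simp add: l power_add mult.assoc)
    also have "\<dots> = tr (Z ^ m * (adj w * Y ^ c * w * Z ^ m))"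
      by (rule trace_commute) (intro comm)+
    also have "Z ^ m * (adj w * Y ^ c * w * Z ^ m) = adj (w * Z ^ m) * Y ^ c * (w * Z ^ m)"
      by (simp add: adj_mult Zn mult.assoc)
    finally show ?thesis
      using conj_nonneg[OF positive_power[OF Y(1)]] by simp
  next
    case False
    then have "even c" using assms(6) by simp
    then obtain m where c: "c = m + m" by (auto elim!: evenE simp: mult_2)
    have "tr (adj w * Y ^ c * w * Z ^ l) = tr ((adj w * Y ^ m) * (Y ^ m * w * Z ^ l))"
      by (simp add: c power_add mult.assoc)
    also have "\<dots> = tr ((Y ^ m * w * Z ^ l) * (adj w * Y ^ m))"
      by (rule trace_commute) (intro comm)+
    also have "(Y ^ m * w * Z ^ l) * (adj w * Y ^ m) = adj (adj w * Y ^ m) * Z ^ l * (adj w * Y ^ m)"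
      by (simp add: adj_mult Yn mult.assoc)
    finally show ?thesis
      using conj_nonneg[OF positive_power[OF Z(1)]] by simp
  qed
qed

theorem log_partial_sums_convex:
  assumes "even N" and le1: "\<And>s. s \<in> {s0..s1} \<Longrightarrow> norm (fam 0 s 0) \<le> 1"
  shows "convex_on {s0..s1} (\<lambda>s. - (\<Sum>n\<le>N. tr (X (fam 0 s 0) ^ n) / real n))"
proof (rule f''_ge0_imp_convex)
  define f w w2 where "f s = fam 0 s 0" and "w s = fam 1 s 0" and "w2 s = fam 2 s 0" for s
  define S where "S s = (\<Sum>b<N. tr (adj (w s) * (1 - f s * adj (f s)) ^ (N - Suc b) * w s * X (f s) ^ b))" for s
  have fw: "(f has_vector_derivative w s) (at s)" "(w has_vector_derivative w2 s) (at s)" for s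
    using fam_derivative_s[of 0 0 s] fam_derivative_s[of 1 0 s]
    by (simp_all add: f_def[abs_def] w_def[abs_def] w2_def numeral_2_eq_2)
  show "((\<lambda>s. - (\<Sum>n\<le>N. tr (X (fam 0 s 0) ^ n) / real n)) has_real_derivative
      2 * tr (adj (w s) * (f s * geo N (f s)))) (at s)" for s
    using tr_power_derivative[of f "w s" s N] fw
    by (simp add: has_real_derivative_iff_has_vector_derivative f_def w_def fam_commutant)
  show "((\<lambda>s. 2 * tr (adj (w s) * (f s * geo N (f s)))) has_real_derivative 4 * S s) (at s)" for s
  proof -
    have der: "((\<lambda>s. tr (adj (w s) * (f s * geo N (f s)))) has_vector_derivative
        tr (adj (w s) * V N (f s) (w s) + adj (w2 s) * (f s * geo N (f s)))) (at s)"
      by (intro tr_derivative has_vector_derivative_mult adj_derivative mult_geo_derivative fw)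
    \<comment> \<open>Translation invariance in \<theta> is applied to the first derivative in
      direction \<open>J * fam 1\<close>, a constant function by conjugation. Its vanishing
      derivative expresses the term with \<open>w2\<close> through \<open>V\<close> in direction
      \<open>J * w s\<close>, so that the second derivative involves first derivatives of the family
      only.\<close>
    have der_theta: "((\<lambda>\<theta>. tr (adj (J * fam 1 s \<theta>) * (fam 0 s \<theta> * geo N (fam 0 s \<theta>)))) has_vector_derivative
        tr (adj (J * fam 1 s 0) * V N (fam 0 s 0) (J * fam 1 s 0) +
          adj (J * (J * fam 2 s 0)) * (fam 0 s 0 * geo N (fam 0 s 0)))) (at 0)"
    proof (intro tr_derivative has_vector_derivative_mult[of _ _ 0] adj_derivative mult_geo_derivative)
      show "((\<lambda>\<theta>. fam 0 s \<theta>) has_vector_derivative J * fam 1 s 0) (at 0)"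
        using fam_derivative_theta[of 0 s 0] by simp
      show "((\<lambda>\<theta>. J * fam 1 s \<theta>) has_vector_derivative J * (J * fam 2 s 0)) (at 0)"
        using fam_derivative_theta[of 1 s 0]
        by (intro has_vector_derivative_mult_right) (simp add: numeral_2_eq_2)
    qed
    have const: "(\<lambda>\<theta>. tr (adj (J * fam 1 s \<theta>) * (fam 0 s \<theta> * geo N (fam 0 s \<theta>)))) =
        (\<lambda>\<theta>. tr (adj (J * fam 1 s 0) * (fam 0 s 0 * geo N (fam 0 s 0))))"
    proof
      fix \<theta>
      have "conj_W \<theta> (adj (J * fam 1 s 0) * (fam 0 s 0 * geo N (fam 0 s 0))) =
          adj (J * fam 1 s \<theta>) * (fam 0 s \<theta> * geo N (fam 0 s \<theta>))"
        by (simp add: conj_W_mult conj_W_adj conj_W_J conj_W_fam geo_def X_def conj_W_sum conj_W_power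
            conj_W_diff conj_W_one)
      then show "tr (adj (J * fam 1 s \<theta>) * (fam 0 s \<theta> * geo N (fam 0 s \<theta>))) =
          tr (adj (J * fam 1 s 0) * (fam 0 s 0 * geo N (fam 0 s 0)))"
        using tr_conj_W by metis
    qed
    have "tr (adj (J * w s) * V N (f s) (J * w s) + adj (J * (J * w2 s)) * (f s * geo N (f s))) = 0"
      using vector_derivative_unique_at[OF der_theta[unfolded const] has_vector_derivative_const]
      by (simp only: f_def w_def w2_def)
    moreover have "J * (J * w2 s) = - w2 s" using J_sq by (simp flip: mult.assoc)
    ultimately have "tr (adj (w2 s) * (f s * geo N (f s))) = tr (adj (J * w s) * V N (f s) (J * w s))"
      by (simp add: adj_uminus op_trace_diff)
    then have "tr (adj (w s) * V N (f s) (w s) + adj (w2 s) * (f s * geo N (f s))) = 2 * S s"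
      using V_complex[of "f s" "w s" N] by (simp add: op_trace_add S_def f_def w_def fam_commutant)
    with has_vector_derivative_mult_right[OF der, of 2]
    show ?thesis by (simp add: has_real_derivative_iff_has_vector_derivative)
  qed
  show "0 \<le> 4 * S s" if s: "s \<in> {s0..s1}" for s
  proof -
    have fc: "f s \<in> commutant \<U>" "w s \<in> commutant \<U>"
      by (simp_all add: f_def w_def fam_commutant)
    have "norm (f s) \<le> 1" using le1[OF s] by (simp add: f_def)
    then have "positive (X (f s))" "positive (X (adj (f s)))"
      using norm_adj_le[of "f s"] by (auto intro!: X_positive)
    moreover have "X (adj (f s)) = 1 - f s * adj (f s)" by (simp add: X_def)
    ultimately have "0 \<le> tr (adj (w s) * (1 - f s * adj (f s)) ^ (N - Suc l) * w s * X (f s) ^ l)"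
      if "l < N" for l
      using that assms(1) fc X_commutant[OF commutant_adj[OF fc(1)]]
      by (intro tr_sandwich_nonneg X_commutant) auto
    then show ?thesis unfolding S_def by (auto intro!: sum_nonneg)
  qed
qed simp

end

section \<open>Square summable functions as a Hilbert space\<close>

lemma summable_on_if_bounded:
  fixes f :: "'x \<Rightarrow> real"
  assumes "\<And>s. 0 \<le> f s" "\<And>F. finite F \<Longrightarrow> sum f F \<le> K"
  shows "f summable_on UNIV" "infsum f UNIV \<le> K"
proof -
  show 1: "f summable_on UNIV"
    using assms by (intro nonneg_bdd_above_summable_on bdd_aboveI[of _ K]) auto
  show "infsum f UNIV \<le> K"
    by (rule infsum_le_finite_sums[OF 1]) (use assms in auto)
qed

lemma sum_le_infsum_UNIV:
  fixes f :: "'x \<Rightarrow> real"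
  assumes "f summable_on UNIV" "\<And>s. 0 \<le> f s" "finite F"
  shows "sum f F \<le> infsum f UNIV"
  using assms by (intro finite_sum_le_infsum) auto

lemma summable_on_if_le:
  fixes f g :: "'x \<Rightarrow> real"
  assumes "g summable_on UNIV" "\<And>s. 0 \<le> f s" "\<And>s. f s \<le> g s"
  shows "f summable_on UNIV"
proof (rule summable_on_if_bounded(1)[where K = "infsum g UNIV"])
  fix F :: "'x set" assume "finite F"
  have "sum f F \<le> sum g F" using assms by (intro sum_mono)
  also have "\<dots> \<le> infsum g UNIV"
    using assms \<open>finite F\<close> by (intro sum_le_infsum_UNIV) (auto intro: order_trans)
  finally show "sum f F \<le> infsum g UNIV" .
qed (rule assms)

definition sqsum :: "('x \<Rightarrow> complex) \<Rightarrow> bool"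
  where "sqsum f \<longleftrightarrow> (\<lambda>s. (cmod (f s))\<^sup>2) summable_on UNIV"

lemma sqsum_zero: "sqsum (\<lambda>_. 0)"
  by (simp add: sqsum_def)

lemma sqsum_add:
  assumes "sqsum f" "sqsum g"
  shows "sqsum (\<lambda>s. f s + g s)"
  unfolding sqsum_def
proof (rule summable_on_if_le)
  show "(\<lambda>s. 2 * (cmod (f s))\<^sup>2 + 2 * (cmod (g s))\<^sup>2) summable_on UNIV"
    using assms unfolding sqsum_def by (intro summable_on_add summable_on_cmult_right)
  show "(cmod (f s + g s))\<^sup>2 \<le> 2 * (cmod (f s))\<^sup>2 + 2 * (cmod (g s))\<^sup>2" for s
  proof -
    have "(cmod (f s + g s))\<^sup>2 \<le> (cmod (f s) + cmod (g s))\<^sup>2"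
      by (intro power_mono norm_triangle_ineq) simp
    also have "\<dots> \<le> 2 * (cmod (f s))\<^sup>2 + 2 * (cmod (g s))\<^sup>2"
      using sum_squares_bound[of "cmod (f s)" "cmod (g s)"] by (simp add: power2_sum)
    finally show ?thesis .
  qed
qed simp

lemma sqsum_scaleR: "sqsum f \<Longrightarrow> sqsum (\<lambda>s. r *\<^sub>R f s)"
  unfolding sqsum_def by (simp add: power_mult_distrib summable_on_cmult_right)

lemma sqsum_inner_summable:
  assumes "sqsum f" "sqsum g"
  shows "(\<lambda>s. inner (f s) (g s)) summable_on UNIV"
proof (rule abs_summable_summable, rule summable_on_if_le)
  show "(\<lambda>s. (cmod (f s))\<^sup>2 + (cmod (g s))\<^sup>2) summable_on UNIV"
    using assms unfolding sqsum_def by (intro summable_on_add)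
  show "norm (inner (f s) (g s)) \<le> (cmod (f s))\<^sup>2 + (cmod (g s))\<^sup>2" for s
  proof -
    have "norm (inner (f s) (g s)) \<le> cmod (f s) * cmod (g s)"
      using Cauchy_Schwarz_ineq2[of "f s" "g s"] by simp
    also have "\<dots> \<le> (cmod (f s))\<^sup>2 + (cmod (g s))\<^sup>2"
    proof -
      have "0 \<le> cmod (f s) * cmod (g s)" by simp
      then show ?thesis
        using sum_squares_bound[of "cmod (f s)" "cmod (g s)"] by linarith
    qed
    finally show ?thesis .
  qed
qed simp

text \<open>A type cannot depend on the carrier of a group, so the functions live on the whole index
  type and a projection cuts out those with support in the carrier. The inner product below is the
  real part of the Hermitian one.\<close>

typedef 'x l2 = "{f :: 'x \<Rightarrow> complex. sqsum f}"
  morphisms l2_fun Abs_l2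
  using sqsum_zero by blast

setup_lifting type_definition_l2

lemma sqsum_l2_fun: "sqsum (l2_fun x)"
  using l2_fun[of x] by simp

lemma l2_eqI: "(\<And>s. l2_fun x s = l2_fun y s) \<Longrightarrow> x = y"
  by (metis ext l2_fun_inject)

lemma l2_fun_Abs: "sqsum f \<Longrightarrow> l2_fun (Abs_l2 f) = f"
  by (simp add: Abs_l2_inverse)

instantiation l2 :: (type) real_inner
begin
lift_definition zero_l2 :: "'a l2" is "\<lambda>_. 0" by (rule sqsum_zero)
lift_definition plus_l2 :: "'a l2 \<Rightarrow> 'a l2 \<Rightarrow> 'a l2" is "\<lambda>f g s. f s + g s" by (rule sqsum_add)
lift_definition scaleR_l2 :: "real \<Rightarrow> 'a l2 \<Rightarrow> 'a l2" is "\<lambda>r f s. r *\<^sub>R f s" by (rule sqsum_scaleR)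
definition uminus_l2 :: "'a l2 \<Rightarrow> 'a l2" where "uminus_l2 x = (-1) *\<^sub>R x"
definition minus_l2 :: "'a l2 \<Rightarrow> 'a l2 \<Rightarrow> 'a l2" where "minus_l2 x y = x + (-1) *\<^sub>R y"
definition inner_l2 :: "'a l2 \<Rightarrow> 'a l2 \<Rightarrow> real"
  where "inner_l2 x y = infsum (\<lambda>s. inner (l2_fun x s) (l2_fun y s)) UNIV"
definition norm_l2 :: "'a l2 \<Rightarrow> real" where "norm_l2 x = sqrt (inner x x)"
definition dist_l2 :: "'a l2 \<Rightarrow> 'a l2 \<Rightarrow> real" where "dist_l2 x y = norm (x - y)"
definition sgn_l2 :: "'a l2 \<Rightarrow> 'a l2" where "sgn_l2 x = inverse (norm x) *\<^sub>R x"
definition [code del]: "(uniformity :: ('a l2 \<times> 'a l2) filter) = (INF e\<in>{0 <..}. principal {(x, y). dist x y < e})"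
definition open_l2 :: "'a l2 set \<Rightarrow> bool"
  where [code del]: "open_l2 S = (\<forall>x\<in>S. \<forall>\<^sub>F (x', y) in uniformity. x' = x \<longrightarrow> y \<in> S)"
instance
proof
  fix x y z :: "'a l2" and r s :: real
  show "dist x y = norm (x - y)" by (rule dist_l2_def)
  show "sgn x = inverse (norm x) *\<^sub>R x" by (rule sgn_l2_def)
  show "uniformity = (INF e\<in>{0 <..}. principal {(x, y). dist x (y :: 'a l2) < e})"
    by (rule uniformity_l2_def)
  show "open U = (\<forall>x\<in>U. \<forall>\<^sub>F (x', y) in uniformity. x' = x \<longrightarrow> y \<in> U)" for U :: "'a l2 set"
    by (rule open_l2_def)
  show "x + y + z = x + (y + z)" by transfer (simp add: add.assoc)
  show "x + y = y + x" by transfer (simp add: add.commute)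
  show "0 + x = x" by transfer simp
  show "- x + x = 0" unfolding uminus_l2_def by transfer simp
  show "x - y = x + - y" by (simp only: minus_l2_def uminus_l2_def)
  show "r *\<^sub>R (x + y) = r *\<^sub>R x + r *\<^sub>R y" by transfer (simp add: scaleR_add_right)
  show "(r + s) *\<^sub>R x = r *\<^sub>R x + s *\<^sub>R x" by transfer (simp add: scaleR_add_left)
  show "r *\<^sub>R s *\<^sub>R x = (r * s) *\<^sub>R x" by transfer simp
  show "1 *\<^sub>R x = x" by transfer simp
  show "inner x y = inner y x" by (simp add: inner_l2_def inner_commute)
  show "inner (x + y) z = inner x z + inner y z"
    unfolding inner_l2_def plus_l2.rep_eq inner_add_left
    by (intro infsum_add sqsum_inner_summable sqsum_l2_fun)
  show "inner (r *\<^sub>R x) y = r * inner x y"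
    unfolding inner_l2_def scaleR_l2.rep_eq inner_scaleR_left by (rule infsum_cmult_right')
  show "0 \<le> inner x x"
    unfolding inner_l2_def by (rule infsum_nonneg) simp
  show "inner x x = 0 \<longleftrightarrow> x = 0"
  proof
    assume "inner x x = 0"
    then have "inner (l2_fun x s) (l2_fun x s) = 0" for s
      unfolding inner_l2_def
      by (intro nonneg_infsum_le_0D[where f = "\<lambda>s. inner (l2_fun x s) (l2_fun x s)" and A = UNIV])
         (auto intro: sqsum_inner_summable sqsum_l2_fun)
    then show "x = 0" by (intro l2_eqI) (simp add: zero_l2.rep_eq)
  qed (simp add: inner_l2_def zero_l2.rep_eq)
  show "norm x = sqrt (inner x x)" by (rule norm_l2_def)
qed
end

lemma l2_fun_zero [simp]: "l2_fun 0 s = 0"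
  by (simp add: zero_l2.rep_eq)

lemma l2_fun_add [simp]: "l2_fun (x + y) s = l2_fun x s + l2_fun y s"
  by (simp add: plus_l2.rep_eq)

lemma l2_fun_scaleR [simp]: "l2_fun (r *\<^sub>R x) s = r *\<^sub>R l2_fun x s"
  by (simp add: scaleR_l2.rep_eq)

lemma l2_fun_uminus [simp]: "l2_fun (- x) s = - l2_fun x s"
  using l2_fun_scaleR[of "-1" x s] by simp

lemma l2_fun_diff [simp]: "l2_fun (x - y) s = l2_fun x s - l2_fun y s"
  using l2_fun_add[of x "- y" s] by simp

lemma l2_fun_sum: "l2_fun (\<Sum>i\<in>A. f i) s = (\<Sum>i\<in>A. l2_fun (f i) s)"
  by (induction A rule: infinite_finite_induct) auto

lemma norm_l2_square: "(norm x)\<^sup>2 = infsum (\<lambda>s. (cmod (l2_fun x s))\<^sup>2) UNIV"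
  by (simp add: power2_norm_eq_inner inner_l2_def)

lemma sum_le_norm_l2: "finite F \<Longrightarrow> (\<Sum>s\<in>F. (cmod (l2_fun x s))\<^sup>2) \<le> (norm x)\<^sup>2"
  unfolding norm_l2_square using sqsum_l2_fun[of x] unfolding sqsum_def
  by (intro sum_le_infsum_UNIV) auto

lemma cmod_l2_fun_le: "cmod (l2_fun x s) \<le> norm x"
  by (rule power2_le_imp_le) (use sum_le_norm_l2[of "{s}" x] in simp_all)

lemma l2_norm_leI:
  assumes "\<And>F. finite F \<Longrightarrow> (\<Sum>s\<in>F. (cmod (l2_fun x s))\<^sup>2) \<le> K\<^sup>2" "0 \<le> K"
  shows "norm x \<le> K"
proof (rule power2_le_imp_le[OF _ assms(2)])
  show "(norm x)\<^sup>2 \<le> K\<^sup>2"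
    unfolding norm_l2_square by (rule summable_on_if_bounded(2)) (use assms in auto)
qed

definition l2_unit :: "'x \<Rightarrow> 'x l2"
  where "l2_unit s = Abs_l2 (\<lambda>t. if t = s then 1 else 0)"

lemma l2_fun_unit: "l2_fun (l2_unit s) t = (if t = s then 1 else 0)"
proof -
  have "(\<lambda>t. (cmod (if t = s then 1 else 0))\<^sup>2) summable_on UNIV \<longleftrightarrow> (\<lambda>t. 1 :: real) summable_on {s}"
    by (rule summable_on_cong_neutral) auto
  then have "sqsum (\<lambda>t. if t = s then 1 else 0)" by (simp add: sqsum_def)
  then show ?thesis by (simp add: l2_unit_def l2_fun_Abs)
qed

lemma inner_l2_unit: "inner x (l2_unit s) = Re (l2_fun x s)"
proof -
  have "inner x (l2_unit s) = infsum (\<lambda>t. inner (l2_fun x t) (l2_fun (l2_unit s) t)) {s}"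
    unfolding inner_l2_def by (rule infsum_cong_neutral) (auto simp: l2_fun_unit)
  then show ?thesis by (simp add: l2_fun_unit inner_complex_def)
qed

lemma norm_l2_unit: "norm (l2_unit s) = 1"
  by (simp add: norm_eq_sqrt_inner inner_l2_unit l2_fun_unit)

instance l2 :: (type) perfect_space
proof
  fix x :: "'a l2"
  show "\<not> open {x}"
  proof
    assume "open {x}"
    then obtain d where d: "0 < d" "\<And>y. dist y x < d \<Longrightarrow> y \<in> {x}"
      unfolding open_dist by blast
    \<comment> \<open>Types are nonempty, so \<open>undefined\<close> is a legitimate index; any
      other would do.\<close>
    define y where "y = x + (d / 2) *\<^sub>R l2_unit undefined"
    have "dist y x < d" using d(1) by (simp add: y_def dist_norm norm_l2_unit)
    then have "y = x" using d(2) by blast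
    then have "norm (l2_unit (undefined :: 'a)) = 0" using d(1) by (simp add: y_def)
    then show False by (simp add: norm_l2_unit)
  qed
qed

instance l2 :: (type) complete_space
proof
  fix X :: "nat \<Rightarrow> 'a l2"
  assume "Cauchy X"
  have "Cauchy (\<lambda>n. l2_fun (X n) s)" for s
  proof (rule CauchyI)
    fix e :: real assume "0 < e"
    then obtain M where "\<And>m n. m \<ge> M \<Longrightarrow> n \<ge> M \<Longrightarrow> norm (X m - X n) < e"
      using \<open>Cauchy X\<close> by (metis CauchyD)
    then show "\<exists>M. \<forall>m\<ge>M. \<forall>n\<ge>M. norm (l2_fun (X m) s - l2_fun (X n) s) < e"
      by (metis cmod_l2_fun_le l2_fun_diff le_less_trans)
  qed
  then have "\<exists>l. (\<lambda>n. l2_fun (X n) s) \<longlonglongrightarrow> l" for s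
    using Cauchy_convergent convergent_def by blast
  then obtain f where f: "(\<lambda>n. l2_fun (X n) s) \<longlonglongrightarrow> f s" for s
    by metis
  \<comment> \<open>The Cauchy estimate is restricted to a finite set, where the pointwise limit may
    be taken; the bound does not depend on the set.\<close>
  have tail: "(\<Sum>s\<in>F. (cmod (l2_fun (X m) s - f s))\<^sup>2) \<le> e\<^sup>2"
    if "\<And>n. n \<ge> M \<Longrightarrow> norm (X m - X n) < e" "finite F" for M m e F
  proof (rule LIMSEQ_le_const2)
    show "(\<lambda>n. \<Sum>s\<in>F. (cmod (l2_fun (X m) s - l2_fun (X n) s))\<^sup>2) \<longlonglongrightarrow>
        (\<Sum>s\<in>F. (cmod (l2_fun (X m) s - f s))\<^sup>2)"
      by (intro tendsto_intros f)
    show "\<exists>N. \<forall>n\<ge>N. (\<Sum>s\<in>F. (cmod (l2_fun (X m) s - l2_fun (X n) s))\<^sup>2) \<le> e\<^sup>2"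
    proof (intro exI[of _ M] allI impI)
      fix n assume "M \<le> n"
      have "(\<Sum>s\<in>F. (cmod (l2_fun (X m) s - l2_fun (X n) s))\<^sup>2) \<le> (norm (X m - X n))\<^sup>2"
        using sum_le_norm_l2[OF that(2), of "X m - X n"] by simp
      also have "\<dots> \<le> e\<^sup>2" using that(1)[OF \<open>M \<le> n\<close>] by (intro power_mono) auto
      finally show "(\<Sum>s\<in>F. (cmod (l2_fun (X m) s - l2_fun (X n) s))\<^sup>2) \<le> e\<^sup>2" .
    qed
  qed
  have sq: "sqsum (\<lambda>s. l2_fun (X m) s - f s)" if "\<And>n. n \<ge> M \<Longrightarrow> norm (X m - X n) < e" for M m e
    unfolding sqsum_def by (rule summable_on_if_bounded(1)) (use tail[OF that] in auto)
  obtain M where "\<And>m n. m \<ge> M \<Longrightarrow> n \<ge> M \<Longrightarrow> norm (X m - X n) < 1"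
    using CauchyD[OF \<open>Cauchy X\<close>, of 1] by auto
  then have "sqsum (\<lambda>s. l2_fun (X M) s - f s)" by (intro sq[of M M 1]) auto
  from sqsum_add[OF sqsum_l2_fun[of "X M"] sqsum_scaleR[OF this, of "-1"]]
  have "sqsum f" by simp
  define x where "x = Abs_l2 f"
  have x: "l2_fun x = f" unfolding x_def by (rule l2_fun_Abs[OF \<open>sqsum f\<close>])
  have "X \<longlonglongrightarrow> x"
  proof (rule LIMSEQ_I)
    fix e :: real assume "0 < e"
    then obtain M where M: "\<And>m n. m \<ge> M \<Longrightarrow> n \<ge> M \<Longrightarrow> norm (X m - X n) < e / 2"
      using CauchyD[OF \<open>Cauchy X\<close>, of "e / 2"] by auto
    have "norm (X m - x) \<le> e / 2" if "m \<ge> M" for m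
      using tail[of M m "e / 2"] M[OF that] \<open>0 < e\<close> by (intro l2_norm_leI) (auto simp: x)
    then show "\<exists>no. \<forall>n\<ge>no. norm (X n - x) < e"
      using \<open>0 < e\<close> by (intro exI[of _ M]) (auto intro: le_less_trans[of _ "e / 2"])
  qed
  then show "convergent X" by (rule convergentI)
qed

instance l2 :: (type) hilbert_space ..

section \<open>Weighted partial permutations\<close>

text \<open>The common form of phase multiplications, restrictions and translations. A zero weight
  marks the places where the partial permutation is undefined, so injectivity matters only off the
  zeros of \<open>a\<close>.\<close>

definition wcomp :: "('x \<Rightarrow> complex) \<Rightarrow> ('x \<Rightarrow> 'x) \<Rightarrow> 'x l2 endo"
  where "wcomp a \<sigma> = endo (\<lambda>x. Abs_l2 (\<lambda>s. a s * l2_fun x (\<sigma> s)))"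

lemma wcomp_sum_le:
  assumes "inj_on \<sigma> {s. a s \<noteq> 0}" "\<And>s. cmod (a s) \<le> 1" "finite F"
  shows "(\<Sum>s\<in>F. (cmod (a s * l2_fun x (\<sigma> s)))\<^sup>2) \<le> (norm x)\<^sup>2"
proof -
  define F' where "F' = F \<inter> {s. a s \<noteq> 0}"
  have "(\<Sum>s\<in>F. (cmod (a s * l2_fun x (\<sigma> s)))\<^sup>2) = (\<Sum>s\<in>F'. (cmod (a s * l2_fun x (\<sigma> s)))\<^sup>2)"
    using assms(3) by (intro sum.mono_neutral_right) (auto simp: F'_def)
  also have "\<dots> \<le> (\<Sum>s\<in>F'. (cmod (l2_fun x (\<sigma> s)))\<^sup>2)"
  proof (intro sum_mono power_mono)
    fix s
    show "cmod (a s * l2_fun x (\<sigma> s)) \<le> cmod (l2_fun x (\<sigma> s))"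
      using assms(2)[of s] by (simp add: norm_mult mult_left_le_one_le)
  qed simp
  also have "\<dots> = (\<Sum>t\<in>\<sigma> ` F'. (cmod (l2_fun x t))\<^sup>2)"
    using inj_on_subset[OF assms(1), of F'] by (subst sum.reindex) (auto simp: F'_def)
  also have "\<dots> \<le> (norm x)\<^sup>2"
    using assms(3) by (intro sum_le_norm_l2) (simp add: F'_def)
  finally show ?thesis .
qed

lemma wcomp_bounded:
  assumes "inj_on \<sigma> {s. a s \<noteq> 0}" "\<And>s. cmod (a s) \<le> 1"
  shows "l2_fun (app (wcomp a \<sigma>) x) s = a s * l2_fun x (\<sigma> s)" and "norm (wcomp a \<sigma>) \<le> 1"
proof -
  define f where "f x = Abs_l2 (\<lambda>s. a s * l2_fun x (\<sigma> s))" for x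
  have "sqsum (\<lambda>s. a s * l2_fun x (\<sigma> s))" for x
    unfolding sqsum_def
    by (rule summable_on_if_bounded(1)) (use wcomp_sum_le[of \<sigma> a] assms in auto)
  then have f: "l2_fun (f x) s = a s * l2_fun x (\<sigma> s)" for x s
    unfolding f_def by (subst l2_fun_Abs) auto
  have nf: "norm (f x) \<le> norm x" for x
    by (rule l2_norm_leI) (use wcomp_sum_le[of \<sigma> a] assms in \<open>auto simp: f\<close>)
  have "bounded_linear f"
  proof (rule bounded_linear_intro[where K = 1])
    show "f (x + y) = f x + f y" for x y
      by (rule l2_eqI) (simp add: f distrib_left)
    show "f (r *\<^sub>R x) = r *\<^sub>R f x" for r x
      by (rule l2_eqI) (simp add: f)
  qed (simp add: nf)
  then have app: "app (wcomp a \<sigma>) x = f x" for x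
    unfolding wcomp_def f_def[abs_def] by (rule app_endo)
  show "l2_fun (app (wcomp a \<sigma>) x) s = a s * l2_fun x (\<sigma> s)" by (simp add: app f)
  show "norm (wcomp a \<sigma>) \<le> 1" by (rule norm_endo_bound) (simp_all add: app nf)
qed

lemma inner_mult_complex: "inner (a * z) (w :: complex) = inner z (cnj a * w)"
  by (simp add: inner_complex_def algebra_simps)

text \<open>The inner product is reindexed along the bijection between the supports of the two
  weights; the adjoint is the inverse partial permutation with conjugate weights.\<close>

lemma adj_wcomp:
  assumes \<sigma>: "inj_on \<sigma> {s. a s \<noteq> 0}" "\<And>s. cmod (a s) \<le> 1"
    and \<tau>: "inj_on \<tau> {s. c s \<noteq> 0}" "\<And>s. cmod (c s) \<le> 1"
    and bij: "bij_betw \<sigma> {s. a s \<noteq> 0} {s. c s \<noteq> 0}"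
    and inv: "\<And>s. a s \<noteq> 0 \<Longrightarrow> \<tau> (\<sigma> s) = s \<and> c (\<sigma> s) = cnj (a s)"
  shows "adj (wcomp a \<sigma>) = wcomp c \<tau>"
proof (rule adj_eqI)
  fix x y
  have "inner (app (wcomp a \<sigma>) x) y = infsum (\<lambda>s. inner (a s * l2_fun x (\<sigma> s)) (l2_fun y s)) {s. a s \<noteq> 0}"
    unfolding inner_l2_def wcomp_bounded(1)[OF \<sigma>] by (rule infsum_cong_neutral) auto
  also have "\<dots> = infsum (\<lambda>s. inner (l2_fun x (\<sigma> s)) (c (\<sigma> s) * l2_fun y (\<tau> (\<sigma> s)))) {s. a s \<noteq> 0}"
    by (rule infsum_cong) (simp add: inv inner_mult_complex)
  also have "\<dots> = infsum (\<lambda>t. inner (l2_fun x t) (c t * l2_fun y (\<tau> t))) {s. c s \<noteq> 0}"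
    by (rule infsum_reindex_bij_betw[OF bij])
  also have "\<dots> = inner x (app (wcomp c \<tau>) y)"
    unfolding inner_l2_def wcomp_bounded(1)[OF \<tau>] by (rule infsum_cong_neutral) auto
  finally show "inner (app (wcomp a \<sigma>) x) y = inner x (app (wcomp c \<tau>) y)" .
qed

section \<open>The operators attached to a group\<close>

lemma sqsum_mult_summable:
  assumes "sqsum f" "sqsum g"
  shows "(\<lambda>s. f s * cnj (g s)) summable_on S"
proof -
  have "(\<lambda>s. f s * cnj (g s)) summable_on UNIV"
  proof (rule abs_summable_summable, rule summable_on_if_le)
    show "(\<lambda>s. (cmod (f s))\<^sup>2 + (cmod (g s))\<^sup>2) summable_on UNIV"
      using assms unfolding sqsum_def by (intro summable_on_add)
    show "norm (f s * cnj (g s)) \<le> (cmod (f s))\<^sup>2 + (cmod (g s))\<^sup>2" for s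
    proof -
      have "0 \<le> cmod (f s) * cmod (g s)" by simp
      then have "cmod (f s) * cmod (g s) \<le> (cmod (f s))\<^sup>2 + (cmod (g s))\<^sup>2"
        using sum_squares_bound[of "cmod (f s)" "cmod (g s)"] by linarith
      then show ?thesis by (simp add: norm_mult)
    qed
  qed simp
  then show ?thesis by (rule summable_on_subset_banach) simp
qed

lemma app_commute: "S * T = T * S \<Longrightarrow> app S (app T x) = app T (app S x)"
  by (simp flip: app_mult)

locale group_l2 = group G for G :: "('g, 'n) monoid_scheme" (structure) + fixes p :: nat
begin

abbreviation "ix \<equiv> l2_index G p"

definition Jop :: "(nat \<times> 'g) l2 endo" where "Jop = wcomp (\<lambda>_. \<i>) (\<lambda>s. s)"

definition Qop :: "(nat \<times> 'g) l2 endo" where "Qop = wcomp (\<lambda>s. if s \<in> ix then 1 else 0) (\<lambda>s. s)"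

definition Rop :: "'g \<Rightarrow> (nat \<times> 'g) l2 endo"
  where "Rop k = wcomp (\<lambda>s. if s \<in> ix then 1 else 0) (\<lambda>s. (fst s, snd s \<otimes> k))"

text \<open>The matrix unit at row \<open>i\<close> and column \<open>j\<close> times the left
  translation by \<open>g\<close>.\<close>

definition Lop :: "nat \<Rightarrow> nat \<Rightarrow> 'g \<Rightarrow> (nat \<times> 'g) l2 endo"
  where "Lop i j g = wcomp (\<lambda>s. if fst s = i \<and> snd s \<in> carrier G then 1 else 0) (\<lambda>s. (j, inv g \<otimes> snd s))"

text \<open>If \<delta> is a homomorphism, conjugation by this phase multiplies the left translation
  by \<open>g\<close> with the phase of \<open>\<theta> * \<delta> g\<close>.\<close>

definition Wop :: "('g \<Rightarrow> real) \<Rightarrow> real \<Rightarrow> (nat \<times> 'g) l2 endo"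
  where "Wop \<delta> \<theta> = wcomp (\<lambda>s. cis (\<theta> * \<delta> (snd s))) (\<lambda>s. s)"

definition cop :: "complex \<Rightarrow> (nat \<times> 'g) l2 endo"
  where "cop c = Re c *\<^sub>R 1 + Im c *\<^sub>R Jop"

definition ev :: "nat \<Rightarrow> (nat \<times> 'g) l2" where "ev i = l2_unit (i, \<one>)"

text \<open>Commuting with these means being complex linear, respecting the support projection and
  commuting with right translations, the symmetries of Hilbert submodules. \<open>- Jop\<close> is
  listed because it is the adjoint of \<open>Jop\<close>.\<close>

definition symm :: "(nat \<times> 'g) l2 endo set"
  where "symm = {Jop, - Jop, Qop} \<union> Rop ` carrier G"

lemma mem_ix: "s \<in> ix \<longleftrightarrow> fst s < p \<and> snd s \<in> carrier G"
  by (cases s) (auto simp: l2_index_def)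

lemma J_fun: "l2_fun (app Jop x) s = \<i> * l2_fun x s"
  unfolding Jop_def by (rule wcomp_bounded) auto

lemma Q_fun: "l2_fun (app Qop x) s = (if s \<in> ix then l2_fun x s else 0)"
  unfolding Qop_def by (subst wcomp_bounded) (auto intro: inj_onI)

lemma R_inj: "k \<in> carrier G \<Longrightarrow> inj_on (\<lambda>s. (fst s, snd s \<otimes> k)) {s. (if s \<in> ix then 1 else 0 :: complex) \<noteq> 0}"
  by (rule inj_onI) (auto simp: mem_ix split: if_splits)

lemma R_fun:
  "k \<in> carrier G \<Longrightarrow> l2_fun (app (Rop k) x) s = (if s \<in> ix then l2_fun x (fst s, snd s \<otimes> k) else 0)"
  unfolding Rop_def by (subst wcomp_bounded[OF R_inj]) auto

lemma L_inj: "g \<in> carrier G \<Longrightarrow>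
    inj_on (\<lambda>s. (j, inv g \<otimes> snd s)) {s. (if fst s = i \<and> snd s \<in> carrier G then 1 else 0 :: complex) \<noteq> 0}"
  by (rule inj_onI) (auto split: if_splits simp: prod_eq_iff)

lemma L_fun:
  "g \<in> carrier G \<Longrightarrow> l2_fun (app (Lop i j g) x) s =
    (if fst s = i \<and> snd s \<in> carrier G then l2_fun x (j, inv g \<otimes> snd s) else 0)"
  unfolding Lop_def by (subst wcomp_bounded[OF L_inj]) auto

lemma W_fun: "l2_fun (app (Wop \<delta> \<theta>) x) s = cis (\<theta> * \<delta> (snd s)) * l2_fun x s"
  unfolding Wop_def by (rule wcomp_bounded) (auto intro: inj_onI)

lemma cop_fun: "l2_fun (app (cop c) x) s = c * l2_fun x s"
proof -
  have "l2_fun (app (cop c) x) s = (complex_of_real (Re c) + \<i> * complex_of_real (Im c)) * l2_fun x s"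
    by (simp add: cop_def J_fun scaleR_conv_of_real[where 'a = complex] algebra_simps)
  then show ?thesis by (simp flip: complex_eq)
qed

lemma ev_fun: "l2_fun (ev i) s = (if s = (i, \<one>) then 1 else 0)"
  by (simp add: ev_def l2_fun_unit)

lemma endo_l2_eqI: "(\<And>x s. l2_fun (app S x) s = l2_fun (app T x) s) \<Longrightarrow> S = T"
  by (intro endo_eqI l2_eqI)

lemma J_sq: "Jop * Jop = - 1"
  by (rule endo_l2_eqI) (simp add: J_fun)

lemma adj_J: "adj Jop = - Jop"
proof (rule adj_eqI)
  show "inner (app Jop x) y = inner x (app (- Jop) y)" for x y
    unfolding inner_l2_def by (rule infsum_cong) (simp add: J_fun inner_complex_def)
qed

lemma adj_W: "adj (Wop \<delta> \<theta>) = Wop \<delta> (- \<theta>)"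
proof (rule adj_eqI)
  show "inner (app (Wop \<delta> \<theta>) x) y = inner x (app (Wop \<delta> (- \<theta>)) y)" for x y
    unfolding inner_l2_def W_fun inner_mult_complex by (simp add: cis_cnj)
qed

lemma W_inv: "Wop \<delta> \<theta> * Wop \<delta> (- \<theta>) = 1"
  by (rule endo_l2_eqI) (simp add: W_fun cis_mult mult.assoc[symmetric])

lemma adj_Q: "adj Qop = Qop"
proof (rule adj_eqI)
  show "inner (app Qop x) y = inner x (app Qop y)" for x y
    unfolding inner_l2_def by (rule infsum_cong) (simp add: Q_fun)
qed

lemma adj_R:
  assumes k: "k \<in> carrier G"
  shows "adj (Rop k) = Rop (inv k)"
proof -
  have k': "inv k \<in> carrier G" using k by simp
  show ?thesis
    unfolding Rop_def
  proof (rule adj_wcomp[OF R_inj[OF k] _ R_inj[OF k']])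
    have "bij_betw (\<lambda>s. (fst s, snd s \<otimes> k)) ix ix"
      by (rule bij_betwI[where g = "\<lambda>s. (fst s, snd s \<otimes> inv k)"])
         (use k in \<open>auto simp: mem_ix m_assoc\<close>)
    then show "bij_betw (\<lambda>s. (fst s, snd s \<otimes> k)) {s. (if s \<in> ix then 1 else 0 :: complex) \<noteq> 0}
        {s. (if s \<in> ix then 1 else 0 :: complex) \<noteq> 0}" by simp
  qed (use k in \<open>auto simp: mem_ix m_assoc split: if_splits\<close>)
qed

lemma Q_idem: "Qop * Qop = Qop"
  by (rule endo_l2_eqI) (simp add: Q_fun)

lemma adj_symm:
  assumes "u \<in> symm"
  shows "adj u \<in> symm"
proof -
  consider "u = Jop" | "u = - Jop" | "u = Qop" | k where "k \<in> carrier G" "u = Rop k"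
    using assms by (auto simp: symm_def)
  then show ?thesis
  proof cases
    case (4 k)
    then show ?thesis by (simp add: symm_def adj_R)
  qed (simp_all add: symm_def adj_J adj_Q adj_uminus)
qed

lemma Q_symm: "u \<in> symm \<Longrightarrow> u * Qop = Qop * u"
  unfolding symm_def
  by (auto intro!: endo_l2_eqI simp: J_fun Q_fun R_fun mem_ix)

lemma Q_ev: "i < p \<Longrightarrow> app Qop (ev i) = ev i"
  by (rule l2_eqI) (auto simp: Q_fun ev_fun mem_ix)

lemma J_mem: "Jop \<in> symm" and Q_mem: "Qop \<in> symm" and R_mem: "k \<in> carrier G \<Longrightarrow> Rop k \<in> symm"
  by (auto simp: symm_def)

lemma commutant_symmI:
  assumes "T * Jop = Jop * T" "T * Qop = Qop * T" "\<And>k. k \<in> carrier G \<Longrightarrow> T * Rop k = Rop k * T"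
  shows "T \<in> commutant symm"
proof -
  have "T * (- Jop) = (- Jop) * T" using assms(1) by simp
  then show ?thesis using assms by (auto simp: commutant_def symm_def)
qed

lemma J_commutant: "Jop \<in> commutant symm"
  by (rule commutant_symmI) (auto intro!: endo_l2_eqI simp: J_fun Q_fun R_fun)

lemma cop_commutant: "cop c \<in> commutant symm"
  unfolding cop_def by (intro commutant_add commutant_scaleR commutant_one J_commutant)

lemma L_commutant:
  assumes "i < p" "j < p" "g \<in> carrier G"
  shows "Lop i j g \<in> commutant symm"
proof (rule commutant_symmI)
  show "Lop i j g * Jop = Jop * Lop i j g"
    using assms by (intro endo_l2_eqI) (simp add: J_fun L_fun)
  show "Lop i j g * Qop = Qop * Lop i j g"
    using assms by (intro endo_l2_eqI) (simp add: Q_fun L_fun mem_ix)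
  show "Lop i j g * Rop k = Rop k * Lop i j g" if "k \<in> carrier G" for k
    using assms that by (intro endo_l2_eqI) (auto simp: R_fun L_fun mem_ix m_assoc)
qed

lemma inner_J_unit: "inner x (app Jop (l2_unit s)) = Im (l2_fun x s)"
proof -
  have "inner x (app Jop (l2_unit s)) = inner (app (- Jop) x) (l2_unit s)"
    by (simp only: inner_app_right adj_J)
  then show ?thesis by (simp add: inner_l2_unit J_fun)
qed

lemma shift_unit:
  assumes "j < p" "h \<in> carrier G"
  shows "app (Rop (inv h)) (ev j) = l2_unit (j, h)"
proof (rule l2_eqI)
  fix s
  have iff: "x \<otimes> inv h = \<one> \<longleftrightarrow> x = h" if "x \<in> carrier G" for x
    using that assms(2) by (metis inv_closed inv_equality inv_inv r_inv)
  show "l2_fun (app (Rop (inv h)) (ev j)) s = l2_fun (l2_unit (j, h)) s"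
  proof (cases "s \<in> ix")
    case True
    then show ?thesis
      using iff[of "snd s"] assms(2) by (simp add: R_fun ev_fun l2_fun_unit mem_ix prod_eq_iff)
  next
    case False
    then have "s \<noteq> (j, h)" using assms by (auto simp: mem_ix)
    then show ?thesis
      using False assms(2) by (simp add: R_fun l2_fun_unit)
  qed
qed

lemma commutant_unit:
  assumes "T \<in> commutant symm" "j < p" "h \<in> carrier G"
  shows "app T (l2_unit (j, h)) = app (Rop (inv h)) (app T (ev j))"
proof -
  have "T * Rop (inv h) = Rop (inv h) * T"
    using commutantD[OF assms(1) R_mem[of "inv h"]] assms(3) by simp
  then show ?thesis
    unfolding shift_unit[OF assms(2,3), symmetric] by (rule app_commute)
qed

text \<open>Right translation carries \<open>ev j\<close> to every unit vector of the
  \<open>j\<close>-th summand, so coefficients depend only on a quotient of group elements, and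
  passing to the adjoint inverts it. Real and imaginary parts are read off by pairing with a unit
  vector and with its image under \<open>Jop\<close>.\<close>

lemma adj_coefficient:
  assumes T: "T \<in> commutant symm" and i: "i < p" and j: "j < p" and h: "h \<in> carrier G"
  shows "l2_fun (app (adj T) (ev i)) (j, h) = cnj (l2_fun (app T (ev j)) (i, inv h))"
proof (rule complex_eqI)
  define y where "y = app T (l2_unit (j, h))"
  have y: "l2_fun y (i, \<one>) = l2_fun (app T (ev j)) (i, inv h)"
    unfolding y_def commutant_unit[OF T j h] using h i by (simp add: R_fun mem_ix)
  have "Re (l2_fun (app (adj T) (ev i)) (j, h)) = inner (ev i) y"
    by (simp only: inner_l2_unit[symmetric] y_def inner_app_right)
  also have "\<dots> = Re (l2_fun y (i, \<one>))"
    by (simp only: ev_def inner_commute[of _ y] inner_l2_unit)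
  finally show "Re (l2_fun (app (adj T) (ev i)) (j, h)) = Re (cnj (l2_fun (app T (ev j)) (i, inv h)))"
    by (simp add: y)
  have "Im (l2_fun (app (adj T) (ev i)) (j, h)) = inner (ev i) (app T (app Jop (l2_unit (j, h))))"
    by (simp only: inner_J_unit[symmetric] inner_app_right)
  also have "app T (app Jop (l2_unit (j, h))) = app Jop y"
    unfolding y_def by (rule app_commute[OF commutantD[OF T J_mem]])
  also have "inner (ev i) (app Jop y) = Re (l2_fun (app Jop y) (i, \<one>))"
    by (simp only: ev_def inner_commute[of _ "app Jop y"] inner_l2_unit)
  also have "\<dots> = - Im (l2_fun y (i, \<one>))" by (simp add: J_fun)
  finally show "Im (l2_fun (app (adj T) (ev i)) (j, h)) = Im (cnj (l2_fun (app T (ev j)) (i, inv h)))"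
    by (simp add: y)
qed

lemma commutant_supp:
  assumes "T \<in> commutant symm" "i < p" "s \<notin> ix"
  shows "l2_fun (app T (ev i)) s = 0"
proof -
  have "app T (ev i) = app Qop (app T (ev i))"
    using app_commute[OF commutantD[OF assms(1) Q_mem], of "ev i"] Q_ev[OF assms(2)] by simp
  moreover have "l2_fun (app Qop (app T (ev i))) s = 0"
    using assms(3) by (simp add: Q_fun)
  ultimately show ?thesis by simp
qed

text \<open>In this shape the symmetry of the trace amounts to substituting \<open>inv h\<close> for
  \<open>h\<close> and exchanging the two summation indices.\<close>

lemma trace_formula:
  assumes S: "S \<in> commutant symm" and T: "T \<in> commutant symm"
    and S': "adj S \<in> commutant symm"
  shows "op_trace p ev (S * T) = (\<Sum>i<p. \<Sum>j<p. infsum (\<lambda>h.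
    Re (l2_fun (app T (ev i)) (j, h) * l2_fun (app S (ev j)) (i, inv h))) (carrier G))"
  unfolding op_trace_def
proof (rule sum.cong[OF refl])
  fix i assume "i \<in> {..<p}"
  then have i: "i < p" by simp
  define f where "f s = inner (l2_fun (app T (ev i)) s) (l2_fun (app (adj S) (ev i)) s)" for s
  have ix: "ix = Sigma {..<p} (\<lambda>_. carrier G)" by (simp add: l2_index_def)
  have summ: "f summable_on UNIV"
    unfolding f_def by (intro sqsum_inner_summable sqsum_l2_fun)
  have "inner (app (S * T) (ev i)) (ev i) = inner (app T (ev i)) (app (adj S) (ev i))"
    by (simp add: inner_app_left[of S])
  also have "\<dots> = infsum f UNIV"
    unfolding inner_l2_def f_def ..
  also have "\<dots> = infsum f ix"
    by (rule infsum_cong_neutral) (auto simp: f_def commutant_supp[OF T i])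
  also have "\<dots> = infsum (\<lambda>j. infsum (\<lambda>h. f (j, h)) (carrier G)) {..<p}"
    unfolding ix
    by (rule infsum_Sigma_banach[symmetric]) (rule summable_on_subset_banach[OF summ], simp)
  also have "\<dots> = (\<Sum>j<p. infsum (\<lambda>h. f (j, h)) (carrier G))" by simp
  also have "\<dots> = (\<Sum>j<p. infsum (\<lambda>h.
      Re (l2_fun (app T (ev i)) (j, h) * l2_fun (app S (ev j)) (i, inv h))) (carrier G))"
  proof (intro sum.cong refl infsum_cong)
    fix j h assume "j \<in> {..<p}" "h \<in> carrier G"
    then have "l2_fun (app (adj S) (ev i)) (j, h) = cnj (l2_fun (app S (ev j)) (i, inv h))"
      by (intro adj_coefficient[OF S i]) auto
    then show "f (j, h) = Re (l2_fun (app T (ev i)) (j, h) * l2_fun (app S (ev j)) (i, inv h))"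
      by (simp add: f_def inner_complex_def)
  qed
  finally show "inner (app (S * T) (ev i)) (ev i) = (\<Sum>j<p. infsum (\<lambda>h.
      Re (l2_fun (app T (ev i)) (j, h) * l2_fun (app S (ev j)) (i, inv h))) (carrier G))" .
qed

lemma commutant_symm_adj:
  assumes "T \<in> commutant symm"
  shows "adj T \<in> commutant symm"
  unfolding commutant_def
proof safe
  fix u assume "u \<in> symm"
  then have "T * adj u = adj u * T"
    using assms adj_symm by (intro commutantD)
  then have "adj (T * adj u) = adj (adj u * T)" by (rule arg_cong)
  then show "adj T * u = u * adj T" by (simp add: adj_mult)
qed

lemma trace_symmetric:
  assumes S: "S \<in> commutant symm" and T: "T \<in> commutant symm"
  shows "op_trace p ev (S * T) = op_trace p ev (T * S)"
proof -
  have "op_trace p ev (S * T) = (\<Sum>i<p. \<Sum>j<p. infsum (\<lambda>h.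
      Re (l2_fun (app T (ev i)) (j, inv h) * l2_fun (app S (ev j)) (i, inv (inv h)))) (carrier G))"
    unfolding trace_formula[OF S T commutant_symm_adj[OF S]]
  proof (intro sum.cong refl)
    fix i j
    have "bij_betw (\<lambda>h. inv h) (carrier G) (carrier G)"
      by (rule bij_betwI[where g = "\<lambda>h. inv h"]) auto
    from infsum_reindex_bij_betw[OF this, symmetric, of
        "\<lambda>h. Re (l2_fun (app T (ev i)) (j, h) * l2_fun (app S (ev j)) (i, inv h))"]
    show "infsum (\<lambda>h. Re (l2_fun (app T (ev i)) (j, h) * l2_fun (app S (ev j)) (i, inv h))) (carrier G) =
      infsum (\<lambda>h. Re (l2_fun (app T (ev i)) (j, inv h) * l2_fun (app S (ev j)) (i, inv (inv h)))) (carrier G)" .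
  qed
  also have "\<dots> = (\<Sum>j<p. \<Sum>i<p. infsum (\<lambda>h.
      Re (l2_fun (app T (ev i)) (j, inv h) * l2_fun (app S (ev j)) (i, inv (inv h)))) (carrier G))"
    by (rule sum.swap)
  also have "\<dots> = op_trace p ev (T * S)"
    unfolding trace_formula[OF T S commutant_symm_adj[OF T]]
    by (intro sum.cong refl infsum_cong) (simp add: mult.commute)
  finally show ?thesis .
qed

text \<open>By translation \<open>T\<close> kills every unit vector of the index set, so no value of
  the adjoint has a component there.\<close>

lemma commutant_faithful:
  assumes T: "T \<in> commutant symm" and 0: "\<And>i. i < p \<Longrightarrow> app T (ev i) = 0"
  shows "T * Qop = 0"
proof (rule endo_eqI)
  fix x
  have T0: "app T (l2_unit s) = 0" if "s \<in> ix" for s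
    using that commutant_unit[OF T, of "fst s" "snd s"] 0 by (simp add: mem_ix app.zero_right)
  have adj0: "l2_fun (app (adj T) y) s = 0" if "s \<in> ix" for y s
  proof (rule complex_eqI)
    have "Re (l2_fun (app (adj T) y) s) = inner y (app T (l2_unit s))"
      by (simp only: inner_l2_unit[symmetric] inner_app_right)
    then show "Re (l2_fun (app (adj T) y) s) = Re 0" by (simp add: T0[OF that])
    have "Im (l2_fun (app (adj T) y) s) = inner y (app T (app Jop (l2_unit s)))"
      by (simp only: inner_J_unit[symmetric] inner_app_right)
    also have "app T (app Jop (l2_unit s)) = app Jop (app T (l2_unit s))"
      by (rule app_commute[OF commutantD[OF T J_mem]])
    finally show "Im (l2_fun (app (adj T) y) s) = Im 0" by (simp add: T0[OF that] app.zero_right)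
  qed
  have "inner (app (T * Qop) x) y = 0" for y
  proof -
    have "inner (app (T * Qop) x) y = inner (app Qop x) (app (adj T) y)"
      by (simp add: inner_app_left[of T])
    also have "\<dots> = 0"
      unfolding inner_l2_def by (rule infsum_0) (simp add: Q_fun adj0)
    finally show ?thesis .
  qed
  then show "app (T * Qop) x = app 0 x"
    using inner_eq_zero_iff[of "app (T * Qop) x"] by simp
qed

end

sublocale group_l2 \<subseteq> tracial symm p ev Qop
proof unfold_locales
  show "adj u \<in> symm" if "u \<in> symm" for u using that by (rule adj_symm)
  show "op_trace p ev (S * T) = op_trace p ev (T * S)"
    if "S \<in> commutant symm" "T \<in> commutant symm" for S T using that by (rule trace_symmetric)
  show "T * Qop = 0" if "T \<in> commutant symm" "\<And>i. i < p \<Longrightarrow> app T (ev i) = 0" for T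
    using that by (rule commutant_faithful)
  show "norm (ev i) = 1" for i by (simp add: ev_def norm_l2_unit)
  show "u * Qop = Qop * u" if "u \<in> symm" for u using that by (rule Q_symm)
  show "app Qop (ev i) = ev i" if "i < p" for i using that by (rule Q_ev)
qed (rule Q_mem Q_idem adj_Q)+

section \<open>Translation between the operator space and the spaces of the definitions\<close>

context group_l2
begin

lemma ell2_eq: "ell2 ix = l2_fun ` {v. app Qop v = v}"
proof (intro equalityI subsetI)
  fix x assume x: "x \<in> ell2 ix"
  have "(\<lambda>s. (cmod (x s))\<^sup>2) summable_on UNIV \<longleftrightarrow> (\<lambda>s. (cmod (x s))\<^sup>2) summable_on ix"
    using x by (intro summable_on_cong_neutral) (auto simp: ell2_def)
  then have "sqsum x" using x by (simp add: sqsum_def ell2_def)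
  then have f: "l2_fun (Abs_l2 x) = x" by (rule l2_fun_Abs)
  moreover have "app Qop (Abs_l2 x) = Abs_l2 x"
    using x by (intro l2_eqI) (auto simp: Q_fun f ell2_def)
  ultimately show "x \<in> l2_fun ` {v. app Qop v = v}" by force
next
  fix x assume "x \<in> l2_fun ` {v. app Qop v = v}"
  then obtain v where v: "app Qop v = v" "x = l2_fun v" by blast
  have "(\<lambda>s. (cmod (x s))\<^sup>2) summable_on ix"
    using sqsum_l2_fun[of v] unfolding v sqsum_def by (rule summable_on_subset_banach) simp
  moreover have "x s = 0" if "s \<notin> ix" for s
    using that Q_fun[of v s] by (simp add: v)
  ultimately show "x \<in> ell2 ix" by (simp add: ell2_def)
qed

lemma ell2_cases:
  assumes "x \<in> ell2 ix"
  obtains v where "app Qop v = v" "x = l2_fun v"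
  using assms unfolding ell2_eq by blast

lemma ell2_mem: "app Qop v = v \<Longrightarrow> l2_fun v \<in> ell2 ix"
  unfolding ell2_eq by blast

lemma Q_supp: "app Qop v = v \<Longrightarrow> s \<notin> ix \<Longrightarrow> l2_fun v s = 0"
  using Q_fun[of v s] by simp

lemma ell2_norm_l2: 
  assumes "app Qop v = v"
  shows "ell2_norm ix (l2_fun v) = norm v"
proof -
  have "(norm v)\<^sup>2 = infsum (\<lambda>s. (cmod (l2_fun v s))\<^sup>2) ix"
    unfolding norm_l2_square by (rule infsum_cong_neutral) (auto simp: Q_supp[OF assms])
  then show ?thesis by (simp add: ell2_norm_def real_sqrt_unique)
qed

text \<open>The Hermitian product is conjugate-linear in its second argument, so pairing with
  \<open>app Jop w\<close> extracts the imaginary part. In this way complex identities are checked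
  by real inner products.\<close>

lemma ell2_inner_l2:
  assumes "app Qop v = v"
  shows "Re (ell2_inner ix (l2_fun v) (l2_fun w)) = inner v w"
    and "Im (ell2_inner ix (l2_fun v) (l2_fun w)) = inner v (app Jop w)"
proof -
  have summ: "(\<lambda>s. l2_fun v s * cnj (l2_fun w s)) summable_on ix"
    by (intro sqsum_mult_summable sqsum_l2_fun)
  show "Re (ell2_inner ix (l2_fun v) (l2_fun w)) = inner v w"
    unfolding ell2_inner_def infsum_Re[OF summ, symmetric] inner_l2_def
    by (rule infsum_cong_neutral) (auto simp: Q_supp[OF assms] inner_complex_def)
  show "Im (ell2_inner ix (l2_fun v) (l2_fun w)) = inner v (app Jop w)"
    unfolding ell2_inner_def infsum_Im[OF summ, symmetric] inner_l2_def
    by (rule infsum_cong_neutral) (auto simp: Q_supp[OF assms] inner_complex_def J_fun)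
qed

lemma l2_fun_cmult: "l2_fun (app (cop c) v) = (\<lambda>s. c * l2_fun v s)"
  by (rule ext) (rule cop_fun)

lemma l2_fun_plus: "l2_fun (v + w) = (\<lambda>s. l2_fun v s + l2_fun w s)"
  by (rule ext) simp

lemma l2_fun_minus: "l2_fun (v - w) = (\<lambda>s. l2_fun v s - l2_fun w s)"
  by (rule ext) simp

lemma Q_cop: "app Qop v = v \<Longrightarrow> app Qop (app (cop c) v) = app (cop c) v"
  using app_commute[OF commutantD[OF cop_commutant Q_mem], of c v] by simp

lemma right_translate_l2:
  assumes "k \<in> carrier G"
  shows "right_translate G p k (l2_fun v) = l2_fun (app (Rop k) v)"
  using assms by (intro ext) (auto simp: right_translate_def R_fun)

lemma hilbert_submodule_image:
  assumes L: "invariant L" and LQ: "L \<subseteq> range (app Qop)"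
  shows "hilbert_submodule G p (l2_fun ` L)"
proof -
  have cl: "closed L" "subspace L" and inv: "\<And>u v. u \<in> symm \<Longrightarrow> v \<in> L \<Longrightarrow> app u v \<in> L"
    using L by (auto simp: invariant_def)
  have Qv: "app Qop v = v" if "v \<in> L" for v
    using that LQ range_Q by blast
  show ?thesis
    unfolding hilbert_submodule_def closed_subspace_def
  proof (intro conjI ballI allI impI)
    show "l2_fun ` L \<subseteq> ell2 ix" using Qv ell2_mem by blast
    have "0 \<in> L" using cl(2) by (rule subspace_0)
    then have "l2_fun 0 \<in> l2_fun ` L" by (rule imageI)
    moreover have "l2_fun (0 :: (nat \<times> 'g) l2) = (\<lambda>_. 0)" by (rule ext) simp
    ultimately show "(\<lambda>_. 0) \<in> l2_fun ` L" by (simp only:)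
    show "(\<lambda>s. x s + y s) \<in> l2_fun ` L" if "x \<in> l2_fun ` L" "y \<in> l2_fun ` L" for x y
    proof -
      obtain v w where vw: "v \<in> L" "x = l2_fun v" "w \<in> L" "y = l2_fun w"
        using \<open>x \<in> l2_fun ` L\<close> \<open>y \<in> l2_fun ` L\<close> by blast
      have "(\<lambda>s. x s + y s) = l2_fun (v + w)" unfolding vw by (rule l2_fun_plus[symmetric])
      then show ?thesis using subspace_add[OF cl(2) vw(1,3)] by blast
    qed
    show "(\<lambda>s. c * x s) \<in> l2_fun ` L" if "x \<in> l2_fun ` L" for c x
    proof -
      obtain v where v: "v \<in> L" "x = l2_fun v" using \<open>x \<in> l2_fun ` L\<close> by blast
      have "app (cop c) v \<in> L"
        unfolding cop_def app_add app_scaleR app_one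
        using v(1) inv[OF J_mem v(1)] by (intro subspace_add[OF cl(2)] subspace_scale[OF cl(2)])
      moreover have "(\<lambda>s. c * x s) = l2_fun (app (cop c) v)" unfolding v by (rule l2_fun_cmult[symmetric])
      ultimately show ?thesis by blast
    qed
    show "x \<in> l2_fun ` L" if "x \<in> ell2 ix" "\<forall>n. u n \<in> l2_fun ` L"
      "(\<lambda>n. ell2_norm ix (\<lambda>s. u n s - x s)) \<longlonglongrightarrow> 0" for u :: "nat \<Rightarrow> nat \<times> 'g \<Rightarrow> complex" and x
    proof -
      obtain w where w: "app Qop w = w" "x = l2_fun w" using \<open>x \<in> ell2 ix\<close> by (rule ell2_cases)
      have "\<forall>n. \<exists>v. v \<in> L \<and> u n = l2_fun v" using that(2) by blast
      then obtain v where v: "\<And>n. v n \<in> L" "\<And>n. u n = l2_fun (v n)" by metis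
      have "ell2_norm ix (\<lambda>s. u n s - x s) = norm (v n - w)" for n
        unfolding v w l2_fun_minus[symmetric]
        using Qv[OF v(1)] w(1) by (intro ell2_norm_l2) (simp add: app.diff_right)
      then have "(\<lambda>n. norm (v n - w)) \<longlonglongrightarrow> 0" using that(3) by simp
      then have "v \<longlonglongrightarrow> w" by (simp add: tendsto_norm_zero_iff LIM_zero_iff)
      then have "w \<in> L" using cl(1) v(1) closed_sequentially by blast
      then show ?thesis by (simp add: w)
    qed
    show "right_translate G p k x \<in> l2_fun ` L" if "k \<in> carrier G" "x \<in> l2_fun ` L" for k x
      using that inv[OF R_mem] by (auto simp: right_translate_l2)
  qed
qed

text \<open>Complex multiples provide real multiples and invariance under \<open>Jop\<close> at
  once. For closedness the limit must first be recognised as a fixed vector of \<open>Qop\<close>,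
  since closedness of \<open>M\<close> speaks of limits in \<open>ell2 ix\<close> only.\<close>

lemma hilbert_submodule_preimage:
  assumes M: "hilbert_submodule G p M"
  shows "\<exists>L. invariant L \<and> L \<subseteq> range (app Qop) \<and> M = l2_fun ` L"
proof -
  define L where "L = {v. l2_fun v \<in> M}"
  note M' = M[unfolded hilbert_submodule_def closed_subspace_def]
  have Msub: "M \<subseteq> ell2 ix" using M' by blast
  have trans: "right_translate G p k x \<in> M" if "k \<in> carrier G" "x \<in> M" for k x
    using M'[THEN conjunct2] that by blast
  have clos: "x \<in> M" if "x \<in> ell2 ix" "\<forall>n. u n \<in> M" "(\<lambda>n. ell2_norm ix (\<lambda>s. u n s - x s)) \<longlonglongrightarrow> 0"
    for x and u :: "nat \<Rightarrow> nat \<times> 'g \<Rightarrow> complex"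
    using M'[THEN conjunct1, THEN conjunct2, THEN conjunct2, THEN conjunct2, THEN conjunct2] that by blast
  have Qv: "app Qop v = v" if "v \<in> L" for v
  proof -
    have "l2_fun v \<in> ell2 ix" using that Msub by (auto simp: L_def)
    then obtain w where "app Qop w = w" "l2_fun v = l2_fun w" by (rule ell2_cases)
    then show ?thesis by (metis l2_fun_inject)
  qed
  have img: "M = l2_fun ` L"
    using Msub unfolding ell2_eq L_def by blast
  have add: "v + w \<in> L" if "v \<in> L" "w \<in> L" for v w
    using M' that unfolding L_def mem_Collect_eq l2_fun_plus by blast
  have cm: "app (cop c) v \<in> L" if "v \<in> L" for c v
    using M' that unfolding L_def mem_Collect_eq l2_fun_cmult by blast
  have sc: "r *\<^sub>R v \<in> L" if "v \<in> L" for r v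
    using cm[OF that, of "complex_of_real r"] by (simp add: cop_def)
  have Jv: "app Jop v \<in> L" if "v \<in> L" for v
    using cm[OF that, of \<i>] by (simp add: cop_def)
  have "0 \<in> L"
  proof -
    have "l2_fun (0 :: (nat \<times> 'g) l2) = (\<lambda>_. 0)" by (rule ext) simp
    then show ?thesis using M' by (simp only: L_def mem_Collect_eq)
  qed
  have "subspace L"
    using add sc \<open>0 \<in> L\<close> by (simp add: subspace_def)
  moreover have "closed L"
    unfolding closed_sequential_limits
  proof (intro allI impI)
    fix v w assume vw: "(\<forall>n. v n \<in> L) \<and> v \<longlonglongrightarrow> w"
    then have "(\<lambda>n. app Qop (v n)) \<longlonglongrightarrow> app Qop w" by (intro app.tendsto tendsto_const) auto
    then have "v \<longlonglongrightarrow> app Qop w" using vw Qv by simp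
    then have Qw: "app Qop w = w" using vw LIMSEQ_unique by blast
    have "ell2_norm ix (\<lambda>s. l2_fun (v n) s - l2_fun w s) = norm (v n - w)" for n
      unfolding l2_fun_minus[symmetric]
      using Qv[of "v n"] vw Qw by (intro ell2_norm_l2) (simp add: app.diff_right)
    moreover have "(\<lambda>n. norm (v n - w)) \<longlonglongrightarrow> 0"
      using vw by (simp add: tendsto_norm_zero_iff LIM_zero_iff)
    ultimately have "(\<lambda>n. ell2_norm ix (\<lambda>s. l2_fun (v n) s - l2_fun w s)) \<longlonglongrightarrow> 0" by simp
    moreover have "\<forall>n. l2_fun (v n) \<in> M" using vw by (simp add: L_def)
    ultimately have "l2_fun w \<in> M" using clos[OF ell2_mem[OF Qw], of "\<lambda>n. l2_fun (v n)"] by blast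
    then show "w \<in> L" by (simp add: L_def)
  qed
  moreover have "app u v \<in> L" if "u \<in> symm" "v \<in> L" for u v
  proof -
    consider "u = Jop" | "u = - Jop" | "u = Qop" | k where "k \<in> carrier G" "u = Rop k"
      using \<open>u \<in> symm\<close> by (auto simp: symm_def)
    then show ?thesis
    proof cases
      case 2
      then show ?thesis using sc[OF Jv[OF that(2)], of "-1"] by simp
    next
      case (4 k)
      then show ?thesis
      proof -
        have "right_translate G p k (l2_fun v) \<in> M" using trans[OF 4(1)] that(2) by (simp add: L_def)
        then show ?thesis by (simp add: L_def 4(2) right_translate_l2[OF 4(1)])
      qed
    qed (use Jv Qv that in auto)
  qed
  ultimately have "invariant L" by (auto simp: invariant_def)
  moreover have "L \<subseteq> range (app Qop)" using Qv range_Q by blast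
  ultimately show ?thesis using img by blast
qed

text \<open>An invariant \<open>L\<close> is stable under \<open>Jop\<close>, so real orthogonality
  to \<open>L\<close> is complex orthogonality and the real projection is also the one in the
  definition.\<close>

lemma vN_dim_image:
  assumes L: "invariant L" and LQ: "L \<subseteq> range (app Qop)"
  shows "vN_dim G p (l2_fun ` L) = tr (proj L)"
proof -
  have cl: "closed L" "subspace L"
    using L by (auto simp: invariant_def)
  have LJ: "app Jop v \<in> L" if "v \<in> L" for v
    using L J_mem that by (auto simp: invariant_def)
  have Qv: "app Qop v = v" if "v \<in> L" for v
    using that LQ range_Q by blast
  have P: "proj_onto ix (l2_fun ` L) (unit_vec_l2 G i) = l2_fun (app (proj L) (ev i))" if i: "i < p" for i
    unfolding proj_onto_def
  proof (rule the_equality)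
    have u: "unit_vec_l2 G i = l2_fun (ev i)"
      by (rule ext) (simp add: unit_vec_l2_def ev_fun)
    have Qd: "app Qop (ev i - v) = ev i - v" if "v \<in> L" for v
      using Qv[OF that] Q_ev[OF i] by (simp add: app.diff_right)
    show "l2_fun (app (proj L) (ev i)) \<in> l2_fun ` L \<and> (\<forall>z\<in>l2_fun ` L.
        ell2_inner ix (\<lambda>s. unit_vec_l2 G i s - l2_fun (app (proj L) (ev i)) s) z = 0)"
    proof (intro conjI ballI)
      show "l2_fun (app (proj L) (ev i)) \<in> l2_fun ` L" using proj_mem[OF cl] by blast
      fix z assume "z \<in> l2_fun ` L"
      then obtain w where w: "w \<in> L" "z = l2_fun w" by blast
      note Qd' = Qd[OF proj_mem[OF cl, of "ev i"]]
      show "ell2_inner ix (\<lambda>s. unit_vec_l2 G i s - l2_fun (app (proj L) (ev i)) s) z = 0"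
        unfolding u w l2_fun_minus[symmetric]
        by (rule complex_eqI)
           (simp_all add: ell2_inner_l2[OF Qd'] proj_orth[OF cl] w(1) LJ)
    qed
    fix y assume y: "y \<in> l2_fun ` L \<and> (\<forall>z\<in>l2_fun ` L. ell2_inner ix (\<lambda>s. unit_vec_l2 G i s - y s) z = 0)"
    then obtain v where v: "v \<in> L" "y = l2_fun v" by blast
    have "inner (ev i - v) z = 0" if "z \<in> L" for z
    proof -
      have "ell2_inner ix (l2_fun (ev i - v)) (l2_fun z) = 0"
        using y that unfolding u v l2_fun_minus[symmetric] by blast
      then show ?thesis using ell2_inner_l2(1)[OF Qd[OF v(1)], of z] by simp
    qed
    then have "app (proj L) (ev i) = v" by (rule proj_eqI[OF cl v(1)])
    then show "y = l2_fun (app (proj L) (ev i))" by (simp add: v)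
  qed
  have "Re (ell2_inner ix (l2_fun (app (proj L) (ev i))) (unit_vec_l2 G i)) = inner (app (proj L) (ev i)) (ev i)"
    if "i < p" for i
  proof -
    have u: "unit_vec_l2 G i = l2_fun (ev i)"
      by (rule ext) (simp add: unit_vec_l2_def ev_fun)
    show ?thesis unfolding u by (rule ell2_inner_l2(1)) (rule Qv[OF proj_mem[OF cl]])
  qed
  with P show ?thesis by (simp add: vN_dim_def op_trace_def)
qed

text \<open>The density sees an operator only through the norms of its values. This is what permits
  replacing the absolute value by the operator itself.\<close>

lemma spectral_density_eq:
  assumes "\<And>v. app Qop v = v \<Longrightarrow> ell2_norm ix (F (l2_fun v)) = norm (app B v)"
  shows "spectral_density G p F c = density B c"
proof -
  have "{vN_dim G p L | L. hilbert_submodule G p L \<and>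
      (\<forall>x\<in>L. ell2_norm ix (F x) \<le> c * ell2_norm ix x)} =
    {tr (proj L) | L. invariant L \<and> L \<subseteq> range (app Qop) \<and> (\<forall>x\<in>L. norm (app B x) \<le> c * norm x)}"
    (is "?A = ?B")
  proof (intro equalityI subsetI)
    fix d assume "d \<in> ?A"
    then obtain M where M: "d = vN_dim G p M" "hilbert_submodule G p M"
      "\<forall>x\<in>M. ell2_norm ix (F x) \<le> c * ell2_norm ix x" by blast
    obtain L where L: "invariant L" "L \<subseteq> range (app Qop)" "M = l2_fun ` L"
      using hilbert_submodule_preimage[OF M(2)] by blast
    have "norm (app B v) \<le> c * norm v" if "v \<in> L" for v
    proof -
      have Qv: "app Qop v = v" using that L(2) range_Q by blast
      have "ell2_norm ix (F (l2_fun v)) \<le> c * ell2_norm ix (l2_fun v)" using M(3) L(3) that by blast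
      then show ?thesis by (simp add: assms[OF Qv] ell2_norm_l2[OF Qv])
    qed
    then show "d \<in> ?B" using L M(1) vN_dim_image[OF L(1,2)] by blast
  next
    fix d assume "d \<in> ?B"
    then obtain L where L: "d = tr (proj L)" "invariant L" "L \<subseteq> range (app Qop)"
      "\<forall>x\<in>L. norm (app B x) \<le> c * norm x" by blast
    have "ell2_norm ix (F x) \<le> c * ell2_norm ix x" if "x \<in> l2_fun ` L" for x
    proof -
      obtain v where v: "v \<in> L" "x = l2_fun v" using \<open>x \<in> l2_fun ` L\<close> by blast
      have Qv: "app Qop v = v" using v(1) L(3) range_Q by blast
      show ?thesis using L(4) v(1) by (simp add: v assms[OF Qv] ell2_norm_l2[OF Qv])
    qed
    then show "d \<in> ?A"
      using L(1) vN_dim_image[OF L(2,3)] hilbert_submodule_image[OF L(2,3)]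
      by (intro CollectI exI[of _ "l2_fun ` L"]) simp
  qed
  then show ?thesis by (simp only: spectral_density_def density_def)
qed

end

context group_l2
begin

section \<open>Operators on square summable functions\<close>

definition restr :: "(nat \<times> 'g) l2 endo \<Rightarrow> (nat \<times> 'g \<Rightarrow> complex) \<Rightarrow> (nat \<times> 'g \<Rightarrow> complex)"
  where "restr T = (\<lambda>x\<in>ell2 ix. l2_fun (app T (Abs_l2 x)))"

lemma restr_l2: "app Qop v = v \<Longrightarrow> restr T (l2_fun v) = l2_fun (app T v)"
  by (simp add: restr_def ell2_mem l2_fun_inverse)

lemma restr_bounded_ops:
  assumes TQ: "T * Qop = Qop * T" and TJ: "T * Jop = Jop * T"
  shows "restr T \<in> bounded_ops ix"
  unfolding bounded_ops_def
proof (intro CollectI conjI ballI allI)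
  have QT: "app Qop (app T v) = app T v" if "app Qop v = v" for v
    using app_commute[OF TQ, of v] that by simp
  show "restr T \<in> ell2 ix \<rightarrow>\<^sub>E ell2 ix"
  proof (rule PiE_I)
    fix x assume "x \<in> ell2 ix"
    then obtain v where v: "app Qop v = v" "x = l2_fun v" by (rule ell2_cases)
    show "restr T x \<in> ell2 ix"
      unfolding v(2) restr_l2[OF v(1)] by (rule ell2_mem[OF QT[OF v(1)]])
  qed (simp add: restr_def)
  show "restr T (\<lambda>s. x s + y s) = (\<lambda>s. restr T x s + restr T y s)" if "x \<in> ell2 ix" "y \<in> ell2 ix" for x y
  proof -
    obtain v where v: "app Qop v = v" "x = l2_fun v" using \<open>x \<in> ell2 ix\<close> by (rule ell2_cases)
    obtain w where w: "app Qop w = w" "y = l2_fun w" using \<open>y \<in> ell2 ix\<close> by (rule ell2_cases)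
    have vw: "app Qop (v + w) = v + w" using v(1) w(1) by (simp add: app.add_right)
    show ?thesis
      unfolding v(2) w(2) l2_fun_plus[symmetric] restr_l2[OF vw] restr_l2[OF v(1)] restr_l2[OF w(1)]
        app.add_right ..
  qed
  show "restr T (\<lambda>s. c * x s) = (\<lambda>s. c * restr T x s)" if "x \<in> ell2 ix" for c x
  proof -
    obtain v where v: "app Qop v = v" "x = l2_fun v" using \<open>x \<in> ell2 ix\<close> by (rule ell2_cases)
    have "T * cop c = cop c * T" by (simp add: cop_def algebra_simps TJ)
    then show ?thesis
      unfolding v(2) l2_fun_cmult[symmetric] restr_l2[OF v(1)] restr_l2[OF Q_cop[OF v(1)]]
      by (simp only: app_commute)
  qed
  show "\<exists>K. \<forall>x\<in>ell2 ix. ell2_norm ix (restr T x) \<le> K * ell2_norm ix x"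
  proof (intro exI ballI)
    fix x assume "x \<in> ell2 ix"
    then obtain v where v: "app Qop v = v" "x = l2_fun v" by (rule ell2_cases)
    show "ell2_norm ix (restr T x) \<le> norm T * ell2_norm ix x"
      unfolding v(2) restr_l2[OF v(1)] ell2_norm_l2[OF v(1)] ell2_norm_l2[OF QT[OF v(1)]]
      by (rule norm_app_le)
  qed
qed

lemma Q_norm: "norm (app Qop v) \<le> norm v"
proof -
  have "norm Qop \<le> 1" unfolding Qop_def by (rule wcomp_bounded) (auto intro: inj_onI)
  then have "norm Qop * norm v \<le> 1 * norm v" by (intro mult_right_mono) auto
  then show ?thesis using norm_app_le[of Qop v] by simp
qed

text \<open>Precomposition with \<open>Qop\<close> extends the operator by 0 off the index set.
  Every competitor in the unique descriptions of \<open>adjoint_op\<close> and \<open>abs_op\<close>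
  thereby becomes an operator on the whole space.\<close>

lemma bounded_ops_cases:
  assumes F: "F \<in> bounded_ops ix"
  obtains T where "T * Qop = T" "Qop * T = T" "T * Jop = Jop * T" "F = restr T"
proof -
  note F' = F[unfolded bounded_ops_def, simplified]
  obtain K where K: "\<And>x. x \<in> ell2 ix \<Longrightarrow> ell2_norm ix (F x) \<le> K * ell2_norm ix x"
    using F' by blast
  have Fm: "F x \<in> ell2 ix" if "x \<in> ell2 ix" for x using F' that by blast
  have Qm: "l2_fun (app Qop v) \<in> ell2 ix" for v
    using Q_idem by (intro ell2_mem) (simp flip: app_mult)
  have QQ: "app Qop (app Qop v) = app Qop v" for v
    using Q_idem by (simp flip: app_mult)
  define f where "f v = Abs_l2 (F (l2_fun (app Qop v)))" for v
  have lf: "l2_fun (f v) = F (l2_fun (app Qop v))" and Qf: "app Qop (f v) = f v" for v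
  proof -
    obtain w where w: "app Qop w = w" "F (l2_fun (app Qop v)) = l2_fun w"
      using Fm[OF Qm] by (rule ell2_cases)
    then have "f v = w" by (simp add: f_def l2_fun_inverse)
    with w show "l2_fun (f v) = F (l2_fun (app Qop v))" "app Qop (f v) = f v" by simp_all
  qed
  have fadd: "f (v + w) = f v + f w" for v w
  proof -
    have "l2_fun (f (v + w)) = F (\<lambda>s. l2_fun (app Qop v) s + l2_fun (app Qop w) s)"
      by (simp only: lf app.add_right l2_fun_plus)
    also have "\<dots> = (\<lambda>s. F (l2_fun (app Qop v)) s + F (l2_fun (app Qop w)) s)"
      using F' Qm by blast
    also have "\<dots> = l2_fun (f v + f w)" by (simp only: lf l2_fun_plus)
    finally show ?thesis by (simp only: l2_fun_inject)
  qed
  have fc: "f (app (cop c) v) = app (cop c) (f v)" for c v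
  proof -
    have "l2_fun (f (app (cop c) v)) = F (\<lambda>s. c * l2_fun (app Qop v) s)"
      using app_commute[OF commutantD[OF cop_commutant Q_mem], of c v]
      by (simp only: lf l2_fun_cmult[symmetric])
    also have "\<dots> = (\<lambda>s. c * F (l2_fun (app Qop v)) s)"
      using F' Qm by blast
    also have "\<dots> = l2_fun (app (cop c) (f v))" by (simp only: lf l2_fun_cmult)
    finally show ?thesis by (simp only: l2_fun_inject)
  qed
  have fs: "f (r *\<^sub>R v) = r *\<^sub>R f v" for r v
    using fc[of "complex_of_real r" v] by (simp add: cop_def)
  have fJ: "f (app Jop v) = app Jop (f v)" for v
    using fc[of \<i> v] by (simp add: cop_def)
  have fn: "norm (f v) \<le> norm v * \<bar>K\<bar>" for v
  proof -
    have "norm (f v) = ell2_norm ix (F (l2_fun (app Qop v)))"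
      by (simp only: lf[symmetric] ell2_norm_l2[OF Qf])
    also have "\<dots> \<le> K * ell2_norm ix (l2_fun (app Qop v))" by (rule K[OF Qm])
    also have "\<dots> = K * norm (app Qop v)" by (simp only: ell2_norm_l2[OF QQ])
    also have "\<dots> \<le> \<bar>K\<bar> * norm v"
      using Q_norm[of v] by (intro mult_mono) auto
    finally show ?thesis by (simp add: mult.commute)
  qed
  have "bounded_linear f"
    by (rule bounded_linear_intro[OF fadd fs fn])
  then obtain T where T: "\<And>v. app T v = f v" using ex_endo by metis
  show ?thesis
  proof (rule that[of T])
    show "T * Qop = T" by (rule endo_eqI) (simp add: T f_def QQ)
    show "Qop * T = T" by (rule endo_eqI) (simp add: T Qf)
    show "T * Jop = Jop * T" by (rule endo_eqI) (simp add: T fJ)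
    show "F = restr T"
    proof
      fix x
      show "F x = restr T x"
      proof (cases "x \<in> ell2 ix")
        case True
        then obtain v where v: "app Qop v = v" "x = l2_fun v" by (rule ell2_cases)
        show ?thesis unfolding v(2) restr_l2[OF v(1)] T lf v(1) ..
      next
        case False
        have "F \<in> ell2 ix \<rightarrow>\<^sub>E ell2 ix" using F unfolding bounded_ops_def by blast
        then have "F x = undefined" using False by (rule PiE_arb)
        moreover have "restr T x = undefined" using False by (simp add: restr_def)
        ultimately show ?thesis by simp
      qed
    qed
  qed
qed

context
  fixes B :: "(nat \<times> 'g) l2 endo"
  assumes BQ: "B * Qop = Qop * B" and BJ: "B * Jop = Jop * B"
begin

lemma adj_BQ: "adj B * Qop = Qop * adj B"
proof -
  have "adj (B * Qop) = adj (Qop * B)" by (simp only: BQ)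
  then show ?thesis by (simp add: adj_mult adj_Q)
qed

lemma adj_BJ: "adj B * Jop = Jop * adj B"
proof -
  have "adj (B * Jop) = adj (Jop * B)" by (simp only: BJ)
  then show ?thesis by (simp add: adj_mult adj_J)
qed

lemma ell2_inner_eqI:
  assumes "app Qop v = v" "app Qop v' = v'"
    and "inner v w = inner v' w'" "inner v (app Jop w) = inner v' (app Jop w')"
  shows "ell2_inner ix (l2_fun v) (l2_fun w) = ell2_inner ix (l2_fun v') (l2_fun w')"
  by (rule complex_eqI) (simp_all add: ell2_inner_l2 assms)

lemma adjoint_op_restr: "adjoint_op ix (restr B) = restr (adj B)"
  unfolding adjoint_op_def
proof (rule the_equality)
  have QB: "app Qop (app B v) = app B v" if "app Qop v = v" for v
    using app_commute[OF BQ, of v] that by simp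
  have QB': "app Qop (app (adj B) v) = app (adj B) v" if "app Qop v = v" for v
    using app_commute[OF adj_BQ, of v] that by simp
  show "restr (adj B) \<in> bounded_ops ix \<and>
    (\<forall>x\<in>ell2 ix. \<forall>y\<in>ell2 ix. ell2_inner ix (restr B x) y = ell2_inner ix x (restr (adj B) y))"
  proof (intro conjI ballI)
    show "restr (adj B) \<in> bounded_ops ix" by (rule restr_bounded_ops[OF adj_BQ adj_BJ])
    fix x y assume "x \<in> ell2 ix" "y \<in> ell2 ix"
    then obtain v w where v: "app Qop v = v" "x = l2_fun v" and w: "app Qop w = w" "y = l2_fun w"
      by (meson ell2_cases)
    show "ell2_inner ix (restr B x) y = ell2_inner ix x (restr (adj B) y)"
      unfolding v(2) w(2) restr_l2[OF v(1)] restr_l2[OF w(1)]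
    proof (rule ell2_inner_eqI[OF QB[OF v(1)] v(1)])
      show "inner (app B v) w = inner v (app (adj B) w)" by (rule inner_app_left)
      have "inner (app B v) (app Jop w) = inner v (app (adj B) (app Jop w))" by (rule inner_app_left)
      then show "inner (app B v) (app Jop w) = inner v (app Jop (app (adj B) w))"
        by (simp only: app_commute[OF adj_BJ])
    qed
  qed
  fix C assume C: "C \<in> bounded_ops ix \<and>
    (\<forall>x\<in>ell2 ix. \<forall>y\<in>ell2 ix. ell2_inner ix (restr B x) y = ell2_inner ix x (C y))"
  then obtain T where T: "T * Qop = T" "Qop * T = T" "T * Jop = Jop * T" "C = restr T"
    using bounded_ops_cases by blast
  have TB: "app T w = app (adj B) w" if w: "app Qop w = w" for w
  proof -
    have QT: "app Qop (app T w) = app T w" using T(2) by (simp flip: app_mult)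
    have eq: "inner v (app T w) = inner v (app (adj B) w)" if v: "app Qop v = v" for v
    proof -
      have "ell2_inner ix (restr B (l2_fun v)) (l2_fun w) = ell2_inner ix (l2_fun v) (C (l2_fun w))"
        using C ell2_mem v w by blast
      then have "ell2_inner ix (l2_fun (app B v)) (l2_fun w) = ell2_inner ix (l2_fun v) (l2_fun (app T w))"
        by (simp only: T(4) restr_l2[OF v] restr_l2[OF w])
      then have "inner (app B v) w = inner v (app T w)"
        using ell2_inner_l2(1)[OF QB[OF v], of w] ell2_inner_l2(1)[OF v, of "app T w"] by simp
      then show ?thesis by (simp add: inner_app_left)
    qed
    define u where "u = app T w - app (adj B) w"
    have "app Qop u = u" using QT QB'[OF w] by (simp add: u_def app.diff_right)
    from eq[OF this] have "inner u u = 0" by (simp add: u_def inner_diff_right)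
    then show ?thesis by (simp add: u_def)
  qed
  show "C = restr (adj B)"
  proof
    fix x
    show "C x = restr (adj B) x"
    proof (cases "x \<in> ell2 ix")
      case True
      then obtain w where w: "app Qop w = w" "x = l2_fun w" by (rule ell2_cases)
      show ?thesis
        unfolding T(4) w(2) restr_l2[OF w(1)] TB[OF w(1)] ..
    qed (simp add: T(4) restr_def)
  qed
qed

text \<open>An operator with real complex quadratic form is self-adjoint: polarise
  \<open>Im \<langle>P v, v\<rangle> = 0\<close>.\<close>

lemma self_adjoint_if_real_form:
  fixes P :: "(nat \<times> 'g) l2 endo"
  assumes PJ: "P * Jop = Jop * P" and 0: "\<And>v. inner (app P v) (app Jop v) = 0"
  shows "adj P = P"
proof (rule adj_eqI)
  fix v w
  have "inner (app P (v + app Jop w)) (app Jop (v + app Jop w)) = 0" by (rule 0)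
  then have "inner (app P v) (app Jop (app Jop w)) + inner (app P (app Jop w)) (app Jop v) = 0"
    by (simp add: app.add_right inner_add_left inner_add_right 0)
  moreover have "app Jop (app Jop w) = - w" using J_sq by (simp flip: app_mult)
  moreover have "app P (app Jop w) = app Jop (app P w)" by (rule app_commute[OF PJ])
  moreover have "inner (app Jop (app P w)) (app Jop v) = inner (app P w) v"
  proof -
    have "inner (app Jop (app P w)) (app Jop v) = inner (app P w) (app (adj Jop) (app Jop v))"
      by (rule inner_app_left)
    also have "app (adj Jop) (app Jop v) = v"
      using J_sq by (simp add: adj_J flip: app_mult)
    finally show ?thesis .
  qed
  ultimately show "inner (app P v) w = inner v (app P w)"
    by (simp add: inner_commute)
qed

text \<open>The description in \<open>abs_op\<close> is shown to denote a positive square root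
  \<open>S\<close>. A competitor becomes an operator \<open>P\<close>, self-adjoint because its
  complex form is real, and uniqueness of positive roots applies. The form of the common square then
  gives equality of norms.\<close>

lemma ell2_norm_abs_op:
  assumes v: "app Qop v = v"
  shows "ell2_norm ix (abs_op ix (restr B) (l2_fun v)) = norm (app B v)"
proof -
  \<comment> \<open>\<open>Qop\<close> is built in so that \<open>C\<close> vanishes off the range
    of \<open>Qop\<close>, like the square of a competitor extended by 0; the squares can then agree
    on all vectors.\<close>
  define C where "C = adj (B * Qop) * (B * Qop)"
  have CB: "app C v = app (adj B) (app B v)" if "app Qop v = v" for v
    using that app_commute[OF BQ, of v] app_commute[OF adj_BQ, of "app B v"]
    by (simp add: C_def adj_mult adj_Q)
  have "positive C" unfolding C_def by (rule positive_adj_mult_self)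
  then obtain S where S: "positive S" "S * S = C" "\<And>Z. Z * C = C * Z \<Longrightarrow> Z * S = S * Z"
    using positive_sqrt_exists by blast
  have CQ: "Qop * C = C" "C * Qop = C"
    using Q_idem by (simp_all add: C_def adj_mult adj_Q mult.assoc) (simp_all flip: mult.assoc)
  have CJ: "Jop * C = C * Jop"
  proof -
    have "Jop * (adj B * Z) = adj B * (Jop * Z)" "Jop * (B * Z) = B * (Jop * Z)"
      "Jop * (Qop * Z) = Qop * (Jop * Z)" for Z
      using adj_BJ BJ Q_symm[OF J_mem] by (simp_all flip: mult.assoc)
    then show ?thesis using Q_symm[OF J_mem] by (simp add: C_def adj_mult adj_Q mult.assoc)
  qed
  have SQ: "Qop * S = S * Qop" by (rule S(3)) (simp add: CQ)
  have SJ: "Jop * S = S * Jop" by (rule S(3)) (rule CJ)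
  have Sadj: "adj S = S" by (rule positive_adj[OF S(1)])
  have QS: "app Qop (app S v) = app S v" if "app Qop v = v" for v
    using app_commute[OF SQ, of v] that by simp
  have "abs_op ix (restr B) = restr S"
    unfolding abs_op_def adjoint_op_restr
  proof (rule the_equality)
    show "positive_op ix (restr S) \<and> (\<forall>x\<in>ell2 ix. restr S (restr S x) = restr (adj B) (restr B x))"
      unfolding positive_op_def
    proof (intro conjI ballI)
      show "restr S \<in> bounded_ops ix" by (rule restr_bounded_ops[OF SQ[symmetric] SJ[symmetric]])
      fix x assume "x \<in> ell2 ix"
      then obtain v where v: "app Qop v = v" "x = l2_fun v" by (rule ell2_cases)
      have Im0: "inner (app S v) (app Jop v) = 0"
      proof -
        have "inner (app S v) (app Jop v) = inner v (app S (app Jop v))"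
          by (rule self_adjoint_inner[OF Sadj])
        also have "\<dots> = inner (app (adj Jop) v) (app S v)"
          by (simp only: app_commute[OF SJ[symmetric]] inner_app_right)
        finally show ?thesis by (simp add: adj_J inner_commute)
      qed
      show "ell2_inner ix (restr S x) x \<in> \<real>\<^sub>\<ge>\<^sub>0"
        unfolding v(2) restr_l2[OF v(1)]
        using positive_inner[OF S(1), of v] Im0
        by (simp add: complex_nonneg_Reals_iff ell2_inner_l2[OF QS[OF v(1)]])
      have QB: "app Qop (app B v) = app B v" using app_commute[OF BQ, of v] v(1) by simp
      have "app S (app S v) = app (adj B) (app B v)"
        using S(2) CB[OF v(1)] by (metis app_mult)
      then show "restr S (restr S x) = restr (adj B) (restr B x)"
        unfolding v(2) restr_l2[OF v(1)] restr_l2[OF QS[OF v(1)]] restr_l2[OF QB] by simp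
    qed
    fix F assume F: "positive_op ix F \<and> (\<forall>x\<in>ell2 ix. F (F x) = restr (adj B) (restr B x))"
    then have "F \<in> bounded_ops ix" by (simp add: positive_op_def)
    then obtain P where P: "P * Qop = P" "Qop * P = P" "P * Jop = Jop * P" "F = restr P"
      by (rule bounded_ops_cases)
    have QP: "app Qop (app P v) = app P v" for v using P(2) by (simp flip: app_mult)
    have form: "inner (app P v) (app Jop v) = 0 \<and> 0 \<le> inner (app P v) v" for v
    proof -
      define w where "w = app Qop v"
      have w: "app Qop w = w" using Q_idem by (simp add: w_def flip: app_mult)
      have Pw: "app P w = app P v" using P(1) by (simp add: w_def flip: app_mult)
      have "ell2_inner ix (F (l2_fun w)) (l2_fun w) \<in> \<real>\<^sub>\<ge>\<^sub>0"
        using F ell2_mem[OF w] by (simp add: positive_op_def)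
      then have "inner (app P w) (app Jop w) = 0 \<and> 0 \<le> inner (app P w) w"
        unfolding P(4) restr_l2[OF w] by (simp add: complex_nonneg_Reals_iff ell2_inner_l2[OF QP])
      moreover have "inner (app P v) w = inner (app P v) v"
        using self_adjoint_inner[OF adj_Q, of "app P v" v] QP by (simp add: w_def)
      moreover have "inner (app P v) (app Jop w) = inner (app P v) (app Jop v)"
        using self_adjoint_inner[OF adj_Q, of "app P v" "app Jop v"] QP
          app_commute[OF Q_symm[OF J_mem], of v] by (simp add: w_def)
      ultimately show ?thesis by (simp add: Pw)
    qed
    have "adj P = P" using P(3) form by (intro self_adjoint_if_real_form) auto
    then have "positive P" using form by (simp add: positive_def)
    moreover have "P * P = S * S"
    proof (rule endo_eqI)
      fix v
      define w where "w = app Qop v"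
      have w: "app Qop w = w" using Q_idem by (simp add: w_def flip: app_mult)
      have QB: "app Qop (app B w) = app B w" using app_commute[OF BQ, of w] w by simp
      have "F (F (l2_fun w)) = restr (adj B) (restr B (l2_fun w))"
        using F ell2_mem[OF w] by blast
      then have "app P (app P w) = app (adj B) (app B w)"
        unfolding P(4) restr_l2[OF w] restr_l2[OF QP] restr_l2[OF QB] l2_fun_inject .
      also have "\<dots> = app C w" by (rule CB[OF w, symmetric])
      also have "\<dots> = app (C * Qop) v" by (simp add: w_def)
      finally have "app P (app P w) = app (S * S) v" by (simp only: CQ S(2))
      moreover have "app P w = app P v" using P(1) by (simp add: w_def flip: app_mult)
      ultimately show "app (P * P) v = app (S * S) v" by simp
    qed
    ultimately have "P = S" using S(1) positive_sqrt_unique by blast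
    then show "F = restr S" by (simp add: P(4))
  qed
  then have "ell2_norm ix (abs_op ix (restr B) (l2_fun v)) = norm (app S v)"
    by (simp add: restr_l2[OF v] ell2_norm_l2[OF QS[OF v]])
  also have "norm (app S v) = norm (app B v)"
  proof -
    have "(norm (app S v))\<^sup>2 = inner (app (S * S) v) v"
      using self_adjoint_inner[OF Sadj, of "app S v" v] by (simp add: power2_norm_eq_inner)
    also have "\<dots> = inner (app (adj B) (app B v)) v" by (simp only: S(2) CB[OF v])
    also have "\<dots> = (norm (app B v))\<^sup>2" by (simp add: power2_norm_eq_inner inner_app_left[of "adj B"])
    finally show ?thesis by simp
  qed
  finally show ?thesis .
qed

end

section \<open>Matrices over the group ring\<close>

definition elem_op :: "nat \<Rightarrow> nat \<Rightarrow> ('g \<Rightarrow>\<^sub>0 complex) \<Rightarrow> (nat \<times> 'g) l2 endo"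
  where "elem_op i j c = (\<Sum>g\<in>Poly_Mapping.keys c. cop (Poly_Mapping.lookup c g) * Lop i j g)"

definition op_of :: "('g \<Rightarrow>\<^sub>0 complex) mat \<Rightarrow> (nat \<times> 'g) l2 endo"
  where "op_of M = (\<Sum>i<p. \<Sum>j<p. elem_op i j (M $$ (i, j)))"

lemma op_of_commutant:
  assumes "M \<in> group_ring_mat G p"
  shows "op_of M \<in> commutant symm"
  unfolding op_of_def elem_op_def
proof (intro commutant_sum commutant_mult cop_commutant L_commutant)
  fix i j g assume "i \<in> {..<p}" "j \<in> {..<p}" "g \<in> Poly_Mapping.keys (M $$ (i, j))"
  then show "g \<in> carrier G" using assms by (auto simp: group_ring_mat_def)
qed simp_all

lemma mat_op_restr:
  assumes M: "M \<in> group_ring_mat G p"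
  shows "mat_op G p M = restr (op_of M)"
proof
  fix x
  show "mat_op G p M x = restr (op_of M) x"
  proof (cases "x \<in> ell2 ix")
    case True
    then obtain v where v: "app Qop v = v" "x = l2_fun v" by (rule ell2_cases)
    have "mat_op G p M (l2_fun v) (k, h) = l2_fun (app (op_of M) v) (k, h)" for k h
    proof -
      have keys: "g \<in> carrier G" if "i < p" "j < p" "g \<in> Poly_Mapping.keys (M $$ (i, j))" for i j g
        using M that by (auto simp: group_ring_mat_def)
      have "l2_fun (app (op_of M) v) (k, h) = (\<Sum>i<p. \<Sum>j<p. \<Sum>g\<in>Poly_Mapping.keys (M $$ (i, j)).
          Poly_Mapping.lookup (M $$ (i, j)) g *
          (if k = i \<and> h \<in> carrier G then l2_fun v (j, inv g \<otimes> h) else 0))"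
        unfolding op_of_def elem_op_def app_sum_left l2_fun_sum
        by (intro sum.cong refl) (simp add: cop_fun L_fun keys)
      also have "\<dots> = (\<Sum>i<p. if k = i then (if h \<in> carrier G then
          \<Sum>j<p. \<Sum>g\<in>Poly_Mapping.keys (M $$ (i, j)). Poly_Mapping.lookup (M $$ (i, j)) g * l2_fun v (j, inv g \<otimes> h)
          else 0) else 0)"
        by (intro sum.cong refl) auto
      also have "\<dots> = mat_op G p M (l2_fun v) (k, h)"
        using ell2_mem[OF v(1)] by (simp add: mat_op_def mem_ix)
      finally show ?thesis ..
    qed
    then show ?thesis unfolding v(2) restr_l2[OF v(1)] by auto
  qed (simp add: mat_op_def restr_def)
qed

lemma regular_fk_det_limit:
  assumes M: "M \<in> group_ring_mat G p" and "0 < r" and bound: "norm (op_of M) \<le> r"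
  shows "(\<lambda>N. exp (real p * ln r - (\<Sum>n\<le>N. tr ((1 - (1 / r\<^sup>2) *\<^sub>R (adj (op_of M) * op_of M)) ^ n) / real n) / 2))
    \<longlonglongrightarrow> regular_fk_det G p M"
proof -
  define B where "B = op_of M"
  have Bc: "B \<in> commutant symm" unfolding B_def by (rule op_of_commutant[OF M])
  interpret O: tracial_operator symm p ev Qop B r
  proof unfold_locales
    show "norm (app B x) \<le> r * norm x" for x
      using norm_app_le[of B x] mult_right_mono[OF bound, of "norm x"] by (simp add: B_def)
  qed (use Bc assms in auto)
  have BQ: "B * Qop = Qop * B" and BJ: "B * Jop = Jop * B"
    using commutantD[OF Bc] Q_mem J_mem by auto
  have "density_measure G p M = interval_measure (density B)"
    unfolding density_measure_def mat_op_restr[OF M] B_def[symmetric]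
    by (intro arg_cong[of _ _ interval_measure] ext spectral_density_eq ell2_norm_abs_op BQ BJ)
  then have logI: "log_integral G p M =
      enn2ereal (\<integral>\<^sup>+x\<in>{0<..}. ennreal (ln x) \<partial>O.\<mu>) - enn2ereal (\<integral>\<^sup>+x\<in>{0<..}. ennreal (- ln x) \<partial>O.\<mu>)"
    by (simp only: log_integral_def)
  have full: "full_rank G p M \<longleftrightarrow> (\<forall>v. app Qop v = v \<longrightarrow> app B v = 0 \<longrightarrow> v = 0)"
  proof
    assume inj: "full_rank G p M"
    show "\<forall>v. app Qop v = v \<longrightarrow> app B v = 0 \<longrightarrow> v = 0"
    proof (intro allI impI)
      fix v assume v: "app Qop v = v" "app B v = 0"
      have Q0: "app Qop 0 = 0" by (simp add: app.zero_right)
      have "restr B (l2_fun v) = restr B (l2_fun 0)"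
        by (simp add: restr_l2[OF v(1)] restr_l2[OF Q0] v(2) app.zero_right)
      then have "l2_fun v = l2_fun 0"
        using inj ell2_mem[OF v(1)] ell2_mem[OF Q0]
        unfolding full_rank_def mat_op_restr[OF M] B_def[symmetric] by (simp add: inj_on_def)
      then show "v = 0" by (simp only: l2_fun_inject)
    qed
  next
    assume ker: "\<forall>v. app Qop v = v \<longrightarrow> app B v = 0 \<longrightarrow> v = 0"
    show "full_rank G p M"
      unfolding full_rank_def mat_op_restr[OF M] B_def[symmetric]
    proof (rule inj_onI)
      fix x y assume xy: "x \<in> ell2 ix" "y \<in> ell2 ix" "restr B x = restr B y"
      then obtain v w where v: "app Qop v = v" "x = l2_fun v" and w: "app Qop w = w" "y = l2_fun w"
        by (meson ell2_cases)
      have "app B v = app B w"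
        using xy(3) unfolding v(2) w(2) restr_l2[OF v(1)] restr_l2[OF w(1)] l2_fun_inject .
      then have "v - w = 0"
        using ker[rule_format, of "v - w"] v(1) w(1) by (simp add: app.diff_right)
      then show "x = y" by (simp add: v w)
    qed
  qed
  have "regular_fk_det G p M = (if (\<forall>v. app Qop v = v \<longrightarrow> app B v = 0 \<longrightarrow> v = 0) \<and> log_integral G p M > -\<infinity>
      then exp (real_of_ereal (log_integral G p M)) else 0)"
    unfolding regular_fk_det_def determinant_class_def fk_det_def full by auto
  then show ?thesis
    using O.regular_determinant_limit[unfolded O.X_def O.T_def]
    by (simp only: logI B_def)
qed

end

section \<open>Log-convexity of the determinant on the first cohomology\<close>

lemma additive_realD:
  assumes "\<beta> \<in> hom G additive_real" "x \<in> carrier G" "y \<in> carrier G"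
  shows "\<beta> (x \<otimes>\<^bsub>G\<^esub> y) = \<beta> x + \<beta> y"
  using hom_mult[OF assms] by (simp add: additive_real_def)

lemma additive_realI:
  assumes "\<And>x y. x \<in> carrier G \<Longrightarrow> y \<in> carrier G \<Longrightarrow> \<beta> (x \<otimes>\<^bsub>G\<^esub> y) = \<beta> x + \<beta> y"
  shows "\<beta> \<in> hom G additive_real"
  using assms by (intro homI) (simp_all add: additive_real_def)

lemma additive_real_add:
  "\<alpha> \<in> hom G additive_real \<Longrightarrow> \<beta> \<in> hom G additive_real \<Longrightarrow> (\<lambda>g. \<alpha> g + \<beta> g) \<in> hom G additive_real"
  by (rule additive_realI) (simp add: additive_realD)

lemma additive_real_cmult:
  "\<beta> \<in> hom G additive_real \<Longrightarrow> (\<lambda>g. c * \<beta> g) \<in> hom G additive_real"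
  by (rule additive_realI) (simp add: additive_realD distrib_left)

lemma additive_real_diff:
  "\<alpha> \<in> hom G additive_real \<Longrightarrow> \<beta> \<in> hom G additive_real \<Longrightarrow> (\<lambda>g. \<alpha> g - \<beta> g) \<in> hom G additive_real"
  by (rule additive_realI) (simp add: additive_realD)

lemma additive_real_zero: "(\<lambda>_. 0) \<in> hom G additive_real"
  by (rule additive_realI) simp

context group
begin

lemma additive_real_one:
  assumes "\<beta> \<in> hom G additive_real"
  shows "\<beta> \<one> = 0"
  using additive_realD[OF assms one_closed one_closed] by simp

lemma additive_real_inv:
  assumes "\<beta> \<in> hom G additive_real" "x \<in> carrier G"
  shows "\<beta> (inv x) = - \<beta> x"
  using additive_realD[OF assms(1), of "inv x" x] assms(2) additive_real_one[OF assms(1)] by simp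

end

locale kappa_family = group_l2 G p for G :: "('g, 'n) monoid_scheme" (structure) and p +
  fixes \<pi> :: "('a, 'm) monoid_scheme" and \<gamma> :: "'a \<Rightarrow> 'g" and A :: "('a \<Rightarrow>\<^sub>0 complex) mat"
  assumes A: "A \<in> group_ring_mat \<pi> p" and \<gamma>: "\<gamma> \<in> hom \<pi> G"
begin

text \<open>Base \<open>exp 1\<close> turns the power into
  \<open>exp (\<beta> (\<gamma> g))\<close>. The parameter \<open>t\<close> is absorbed as the
  factor \<open>ln t\<close> of \<beta>, so varying \<open>t\<close> is moving along a line of
  homomorphisms.\<close>

definition Kap :: "('g \<Rightarrow> real) \<Rightarrow> ('g \<Rightarrow>\<^sub>0 complex) mat"
  where "Kap \<beta> = kappa (\<lambda>g. \<beta> (\<gamma> g)) \<gamma> (exp 1) A"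

definition \<Phi> :: "('g \<Rightarrow> real) \<Rightarrow> real"
  where "\<Phi> \<beta> = regular_fk_det G p (Kap \<beta>)"

text \<open>Monomials are indexed by elements of \<pi> and not by their images: \<gamma> may
  identify elements, and the coefficients may then cancel.\<close>

definition terms :: "(nat \<times> nat \<times> 'a) set"
  where "terms = (SIGMA i:{..<p}. SIGMA j:{..<p}. Poly_Mapping.keys (A $$ (i, j)))"

definition tm :: "nat \<times> nat \<times> 'a \<Rightarrow> (nat \<times> 'g) l2 endo"
  where "tm k = cop (Poly_Mapping.lookup (A $$ (fst k, fst (snd k))) (snd (snd k))) *
    Lop (fst k) (fst (snd k)) (\<gamma> (snd (snd k)))"

abbreviation el :: "nat \<times> nat \<times> 'a \<Rightarrow> 'g" where "el k \<equiv> \<gamma> (snd (snd k))"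

lemma dims: "A \<in> carrier_mat p p" and keys_A: "i < p \<Longrightarrow> j < p \<Longrightarrow> Poly_Mapping.keys (A $$ (i, j)) \<subseteq> carrier \<pi>"
  using A by (auto simp: group_ring_mat_def)

lemma \<gamma>_closed: "a \<in> carrier \<pi> \<Longrightarrow> \<gamma> a \<in> carrier G"
  using \<gamma> by (auto simp: hom_def)

lemma finite_terms: "finite terms"
  unfolding terms_def by (intro finite_SigmaI) auto

lemma terms_closed: "k \<in> terms \<Longrightarrow> fst k < p \<and> fst (snd k) < p \<and> el k \<in> carrier G"
  using keys_A \<gamma>_closed unfolding terms_def by fastforce

lemma kappa_eq_Kap:
  assumes "0 < t" "\<And>g. g \<in> carrier \<pi> \<Longrightarrow> ln t * \<phi> g = \<beta> (\<gamma> g)"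
  shows "kappa \<phi> \<gamma> t A = Kap \<beta>"
  unfolding kappa_def Kap_def
proof (rule eq_matI)
  fix i j
  assume "i < dim_row (map_mat (kappa_elem (\<lambda>g. \<beta> (\<gamma> g)) \<gamma> (exp 1)) A)"
    "j < dim_col (map_mat (kappa_elem (\<lambda>g. \<beta> (\<gamma> g)) \<gamma> (exp 1)) A)"
  then have ij: "i < p" "j < p" using dims by auto
  have "kappa_elem \<phi> \<gamma> t (A $$ (i, j)) = kappa_elem (\<lambda>g. \<beta> (\<gamma> g)) \<gamma> (exp 1) (A $$ (i, j))"
    unfolding kappa_elem_def
  proof (rule sum.cong[OF refl])
    fix g assume "g \<in> Poly_Mapping.keys (A $$ (i, j))"
    then have "g \<in> carrier \<pi>" using keys_A[OF ij] by blast
    then have "t powr \<phi> g = exp 1 powr \<beta> (\<gamma> g)"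
      using assms by (simp add: powr_def mult.commute flip: assms(2))
    then show "Poly_Mapping.single (\<gamma> g) (Poly_Mapping.lookup (A $$ (i, j)) g * complex_of_real (t powr \<phi> g)) =
        Poly_Mapping.single (\<gamma> g) (Poly_Mapping.lookup (A $$ (i, j)) g * complex_of_real (exp 1 powr \<beta> (\<gamma> g)))"
      by simp
  qed
  then show "map_mat (kappa_elem \<phi> \<gamma> t) A $$ (i, j) =
      map_mat (kappa_elem (\<lambda>g. \<beta> (\<gamma> g)) \<gamma> (exp 1)) A $$ (i, j)"
    using ij dims by simp
qed simp_all

lemma Kap_entry: "i < p \<Longrightarrow> j < p \<Longrightarrow> Kap \<beta> $$ (i, j) = (\<Sum>a\<in>Poly_Mapping.keys (A $$ (i, j)).
    Poly_Mapping.single (\<gamma> a) (Poly_Mapping.lookup (A $$ (i, j)) a * complex_of_real (exp (\<beta> (\<gamma> a)))))"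
  using dims by (simp add: Kap_def kappa_def kappa_elem_def powr_def)

lemma Kap_mem: "Kap \<beta> \<in> group_ring_mat G p"
  unfolding group_ring_mat_def
proof (intro CollectI conjI allI impI)
  show "Kap \<beta> \<in> carrier_mat p p" using dims by (simp add: Kap_def kappa_def)
  fix i j assume ij: "i < p" "j < p"
  show "Poly_Mapping.keys (Kap \<beta> $$ (i, j)) \<subseteq> carrier G"
    unfolding Kap_entry[OF ij]
    by (rule order_trans[OF keys_sum]) (use keys_A[OF ij] \<gamma>_closed in \<open>auto split: if_splits\<close>)
qed

lemma cop_zero: "cop 0 = 0"
  by (simp add: cop_def)

lemma cop_add: "cop (x + y) = cop x + cop y"
  by (simp add: cop_def scaleR_add_left)

lemma cop_mult_real: "cop (x * complex_of_real c) = c *\<^sub>R cop x"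
  by (simp add: cop_def scaleR_add_right mult.commute)

lemma elem_op_add: "elem_op i j (x + y) = elem_op i j x + elem_op i j y"
  unfolding elem_op_def
  by (rule setsum_keys_plus_distrib) (simp_all add: cop_zero cop_add distrib_right)

lemma elem_op_single: "elem_op i j (Poly_Mapping.single g c) = cop c * Lop i j g"
  by (cases "c = 0") (simp_all add: elem_op_def cop_zero)

lemma elem_op_sum: "elem_op i j (\<Sum>a\<in>S. f a) = (\<Sum>a\<in>S. elem_op i j (f a))"
proof (induction S rule: infinite_finite_induct)
  case (insert x F)
  then show ?case by (simp add: elem_op_add)
qed (simp_all add: elem_op_def)

lemma op_of_Kap: "op_of (Kap \<beta>) = (\<Sum>k\<in>terms. exp (\<beta> (el k)) *\<^sub>R tm k)"
proof -
  have "op_of (Kap \<beta>) = (\<Sum>i<p. \<Sum>j<p. \<Sum>a\<in>Poly_Mapping.keys (A $$ (i, j)). exp (\<beta> (\<gamma> a)) *\<^sub>R tm (i, j, a))"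
    unfolding op_of_def
    by (intro sum.cong refl) (simp add: Kap_entry elem_op_sum elem_op_single cop_mult_real tm_def)
  also have "\<dots> = (\<Sum>k\<in>terms. exp (\<beta> (el k)) *\<^sub>R tm k)"
    unfolding terms_def by (simp add: sum.Sigma split_def)
  finally show ?thesis .
qed

lemma tm_commutant: "k \<in> terms \<Longrightarrow> tm k \<in> commutant symm"
  using terms_closed[of k] unfolding tm_def by (intro commutant_mult cop_commutant L_commutant) auto

text \<open>The summand 1 keeps the logarithm meaningful when there are no terms.\<close>

definition total where "total = 1 + (\<Sum>k\<in>terms. norm (tm k))"

lemma total_pos: "0 < total"
  unfolding total_def by (intro add_pos_nonneg sum_nonneg) auto

lemma norm_op_of_Kap:
  assumes "\<And>k. k \<in> terms \<Longrightarrow> \<beta> (el k) \<le> m"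
  shows "norm (op_of (Kap \<beta>)) \<le> total * exp m"
proof -
  have "norm (op_of (Kap \<beta>)) \<le> (\<Sum>k\<in>terms. exp m * norm (tm k))"
    unfolding op_of_Kap
  proof (rule sum_norm_le)
    fix k assume "k \<in> terms"
    then show "norm (exp (\<beta> (el k)) *\<^sub>R tm k) \<le> exp m * norm (tm k)"
      using assms by (simp add: mult_right_mono)
  qed
  also have "\<dots> \<le> exp m * total"
    unfolding total_def sum_distrib_left[symmetric] by (intro mult_left_mono) auto
  finally show ?thesis by (simp add: mult.commute)
qed

lemma \<Phi>_nonneg: "0 \<le> \<Phi> \<beta>"
  by (simp add: \<Phi>_def regular_fk_det_def fk_det_def)

text \<open>The truncated sums only subtract nonnegative traces from \<open>real p * ln r\<close>,
  so the determinant is at most the \<open>p\<close>-th power of any positive bound \<open>r\<close>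
  on the norm.\<close>

lemma \<Phi>_le:
  assumes "\<And>k. k \<in> terms \<Longrightarrow> \<beta> (el k) \<le> m"
  shows "\<Phi> \<beta> \<le> exp (real p * (ln total + m))"
proof -
  define r where "r = total * exp m"
  have r: "0 < r" using total_pos by (simp add: r_def)
  have bound: "norm (op_of (Kap \<beta>)) \<le> r" unfolding r_def by (rule norm_op_of_Kap) (rule assms)
  interpret O: tracial_operator symm p ev Qop "op_of (Kap \<beta>)" r
  proof unfold_locales
    show "norm (app (op_of (Kap \<beta>)) x) \<le> r * norm x" for x
      using norm_app_le[of "op_of (Kap \<beta>)" x] mult_right_mono[OF bound, of "norm x"] by simp
  qed (use r op_of_commutant[OF Kap_mem] in auto)
  have "\<Phi> \<beta> \<le> exp (real p * ln r)"
    unfolding \<Phi>_def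
  proof (rule LIMSEQ_le_const2[OF regular_fk_det_limit[OF Kap_mem r bound]], intro exI allI impI)
    fix N
    have "0 \<le> (\<Sum>n\<le>N. tr (O.X ^ n) / real n)"
      by (intro sum_nonneg divide_nonneg_nonneg O.tr_X_nonneg) auto
    then show "exp (real p * ln r - (\<Sum>n\<le>N. tr ((1 - (1 / r\<^sup>2) *\<^sub>R (adj (op_of (Kap \<beta>)) * op_of (Kap \<beta>))) ^ n) / real n) / 2)
        \<le> exp (real p * ln r)"
      unfolding O.X_def O.T_def by simp
  qed
  also have "ln r = ln total + m" using total_pos by (simp add: r_def ln_mult)
  finally show ?thesis .
qed

text \<open>The phases before and after translation differ by that of \<open>\<delta> h - \<delta>
  (inv (el k) \<otimes> h) = \<delta> (el k)\<close>.\<close>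

lemma W_tm:
  assumes \<delta>: "\<delta> \<in> hom G additive_real" and k: "k \<in> terms"
  shows "Wop \<delta> \<theta> * tm k * Wop \<delta> (- \<theta>) = (cos (\<theta> * \<delta> (el k)) *\<^sub>R 1 + sin (\<theta> * \<delta> (el k)) *\<^sub>R Jop) * tm k"
proof (rule endo_l2_eqI)
  fix x s
  note tc = terms_closed[OF k]
  have rot: "cis (\<theta> * \<delta> h) * (z * (cis (- \<theta> * \<delta> (inv (el k) \<otimes> h)) * y)) =
      cis (\<theta> * \<delta> (el k)) * (z * y)" if h: "h \<in> carrier G" for h z y
  proof -
    have eq: "\<delta> (inv (el k) \<otimes> h) = \<delta> h - \<delta> (el k)"
      using tc h by (simp add: additive_realD[OF \<delta>] additive_real_inv[OF \<delta>])
    have "cis (\<theta> * \<delta> h) * (z * (cis (- \<theta> * \<delta> (inv (el k) \<otimes> h)) * y)) =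
        (cis (\<theta> * \<delta> h) * cis (- \<theta> * \<delta> (inv (el k) \<otimes> h))) * (z * y)"
      by (simp only: mult_ac)
    also have "cis (\<theta> * \<delta> h) * cis (- \<theta> * \<delta> (inv (el k) \<otimes> h)) = cis (\<theta> * \<delta> (el k))"
      unfolding eq cis_mult by (rule arg_cong) (simp add: algebra_simps)
    finally show ?thesis .
  qed
  have "l2_fun (app (Wop \<delta> \<theta> * tm k * Wop \<delta> (- \<theta>)) x) s = cis (\<theta> * \<delta> (el k)) * l2_fun (app (tm k) x) s"
    using tc rot by (simp add: tm_def W_fun cop_fun L_fun)
  also have "\<dots> = l2_fun (app ((cos (\<theta> * \<delta> (el k)) *\<^sub>R 1 + sin (\<theta> * \<delta> (el k)) *\<^sub>R Jop) * tm k) x) s"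
    by (simp add: J_fun complex_eq_iff algebra_simps)
  finally show "l2_fun (app (Wop \<delta> \<theta> * tm k * Wop \<delta> (- \<theta>)) x) s =
      l2_fun (app ((cos (\<theta> * \<delta> (el k)) *\<^sub>R 1 + sin (\<theta> * \<delta> (el k)) *\<^sub>R Jop) * tm k) x) s" .
qed

lemma \<Phi>_log_convex:
  assumes \<alpha>: "\<alpha> \<in> hom G additive_real" and \<delta>: "\<delta> \<in> hom G additive_real" and u: "0 < u" "u < 1"
  shows "\<Phi> (\<lambda>g. \<alpha> g + u * \<delta> g) \<le> \<Phi> \<alpha> powr (1 - u) * \<Phi> (\<lambda>g. \<alpha> g + \<delta> g) powr u"
proof -
  \<comment> \<open>A crude bound on the exponents over the whole segment, so that one
    \<open>r\<close> serves every \<open>s\<close> in \<open>{0..1}\<close>.\<close>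
  define m where "m = (\<Sum>k\<in>terms. \<bar>\<alpha> (el k)\<bar> + \<bar>\<delta> (el k)\<bar>)"
  define r where "r = total * exp m"
  have r: "0 < r" using total_pos by (simp add: r_def)
  define F where "F s = op_of (Kap (\<lambda>g. \<alpha> g + s * \<delta> g))" for s
  have bound: "norm (F s) \<le> r" if s: "s \<in> {0..1}" for s
    unfolding F_def r_def
  proof (rule norm_op_of_Kap)
    fix k assume k: "k \<in> terms"
    have "\<bar>s * \<delta> (el k)\<bar> \<le> 1 * \<bar>\<delta> (el k)\<bar>"
      unfolding abs_mult using s by (intro mult_right_mono) auto
    then have "\<alpha> (el k) + s * \<delta> (el k) \<le> \<bar>\<alpha> (el k)\<bar> + \<bar>\<delta> (el k)\<bar>" by linarith
    also have "\<dots> \<le> m"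
      unfolding m_def using k finite_terms
      by (intro member_le_sum[of k terms "\<lambda>k. \<bar>\<alpha> (el k)\<bar> + \<bar>\<delta> (el k)\<bar>"]) auto
    finally show "\<alpha> (el k) + s * \<delta> (el k) \<le> m" .
  qed
  \<comment> \<open>The starting point \<alpha> and the scaling by \<open>1 / r\<close> go into the
    coefficients; only \<delta> moves with the parameter.\<close>
  interpret fl: tracial_flow symm p ev Qop Jop terms "\<lambda>k. (exp (\<alpha> (el k)) / r) *\<^sub>R tm k"
    "\<lambda>k. \<delta> (el k)" "Wop \<delta>"
  proof unfold_locales
    show "Wop \<delta> \<theta> * ((exp (\<alpha> (el k)) / r) *\<^sub>R tm k) * Wop \<delta> (- \<theta>) =
        (cos (\<theta> * \<delta> (el k)) *\<^sub>R 1 + sin (\<theta> * \<delta> (el k)) *\<^sub>R Jop) * ((exp (\<alpha> (el k)) / r) *\<^sub>R tm k)"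
      if "k \<in> terms" for k \<theta>
      using W_tm[OF \<delta> that, of \<theta>] by simp
    show "app (Wop \<delta> \<theta>) (ev i) = ev i" for \<theta> i
      by (rule l2_eqI) (simp add: W_fun ev_fun additive_real_one[OF \<delta>])
    show "Wop \<delta> \<theta> * Jop = Jop * Wop \<delta> \<theta>" for \<theta>
      by (rule endo_l2_eqI) (simp add: W_fun J_fun)
    show "(exp (\<alpha> (el k)) / r) *\<^sub>R tm k \<in> commutant symm" if "k \<in> terms" for k
      using that by (intro commutant_scaleR tm_commutant)
  qed (simp_all add: J_sq adj_J J_mem J_commutant finite_terms W_inv adj_W)
  have fam: "fl.fam 0 s 0 = (1 / r) *\<^sub>R F s" for s
    unfolding fl.fam_def F_def op_of_Kap scaleR_sum_right
    by (rule sum.cong) (simp_all add: exp_add mult.commute)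
  have Xfam: "fl.X (fl.fam 0 s 0) = 1 - (1 / r\<^sup>2) *\<^sub>R (adj (F s) * F s)" for s
    by (simp add: fl.X_def fam adj_scaleR power2_eq_square)
  define c where "c N s = - (\<Sum>n\<le>N. tr ((1 - (1 / r\<^sup>2) *\<^sub>R (adj (F s) * F s)) ^ n) / real n)" for N s
  have conv: "convex_on {0..1} (c N)" if "even N" for N
  proof -
    have "norm (fl.fam 0 s 0) \<le> 1" if "s \<in> {0..1}" for s
      using bound[OF that] r by (simp add: fam)
    from fl.log_partial_sums_convex[OF \<open>even N\<close> this] show ?thesis
      unfolding Xfam c_def[abs_def] .
  qed
  have lim: "(\<lambda>N. exp (real p * ln r + c (2 * N) s / 2)) \<longlonglongrightarrow> \<Phi> (\<lambda>g. \<alpha> g + s * \<delta> g)" if "s \<in> {0..1}" for s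
  proof -
    have "(\<lambda>N. exp (real p * ln r - (\<Sum>n\<le>N. tr ((1 - (1 / r\<^sup>2) *\<^sub>R (adj (F s) * F s)) ^ n) / real n) / 2))
        \<longlonglongrightarrow> \<Phi> (\<lambda>g. \<alpha> g + s * \<delta> g)"
      unfolding \<Phi>_def F_def
      by (rule regular_fk_det_limit[OF Kap_mem r]) (rule bound[OF that, unfolded F_def])
    \<comment> \<open>Convexity is known for even lengths of the partial sums, so the limit is taken
      along them.\<close>
    from LIMSEQ_subseq_LIMSEQ[OF this, of "\<lambda>N. 2 * N"] show ?thesis
      by (simp add: strict_mono_def o_def c_def)
  qed
  have "\<Phi> (\<lambda>g. \<alpha> g + u * \<delta> g) \<le> \<Phi> (\<lambda>g. \<alpha> g + 0 * \<delta> g) powr (1 - u) * \<Phi> (\<lambda>g. \<alpha> g + 1 * \<delta> g) powr u"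
  proof (rule LIMSEQ_le)
    show "(\<lambda>N. exp (real p * ln r + c (2 * N) u / 2)) \<longlonglongrightarrow> \<Phi> (\<lambda>g. \<alpha> g + u * \<delta> g)"
      using u by (intro lim) auto
    \<comment> \<open>Powers with positive exponent are continuous on the nonnegative reals
      including 0, which covers vanishing determinants.\<close>
    show "(\<lambda>N. exp (real p * ln r + c (2 * N) 0 / 2) powr (1 - u) * exp (real p * ln r + c (2 * N) 1 / 2) powr u)
        \<longlonglongrightarrow> \<Phi> (\<lambda>g. \<alpha> g + 0 * \<delta> g) powr (1 - u) * \<Phi> (\<lambda>g. \<alpha> g + 1 * \<delta> g) powr u"
      using u by (intro tendsto_mult tendsto_powr2 lim tendsto_const) (auto intro!: always_eventually)
    have "exp (real p * ln r + c (2 * N) u / 2) \<le>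
        exp (real p * ln r + c (2 * N) 0 / 2) powr (1 - u) * exp (real p * ln r + c (2 * N) 1 / 2) powr u" for N
    proof -
      have "c (2 * N) ((1 - u) *\<^sub>R 0 + u *\<^sub>R 1) \<le> (1 - u) * c (2 * N) 0 + u * c (2 * N) 1"
        using u by (intro convex_onD[OF conv]) auto
      then have "real p * ln r + c (2 * N) u / 2 \<le>
          (1 - u) * (real p * ln r + c (2 * N) 0 / 2) + u * (real p * ln r + c (2 * N) 1 / 2)"
        by (simp add: field_simps)
      then show ?thesis by (simp add: powr_def mult.commute flip: exp_add)
    qed
    then show "\<exists>M. \<forall>N\<ge>M. exp (real p * ln r + c (2 * N) u / 2) \<le>
        exp (real p * ln r + c (2 * N) 0 / 2) powr (1 - u) * exp (real p * ln r + c (2 * N) 1 / 2) powr u"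
      by blast
  qed
  then show ?thesis by simp
qed

text \<open>The target \<eta> is the midpoint of \<beta> and its reflection in \<eta>; the vanishing
  factor at \<beta> forces the bound at the midpoint to be 0.\<close>

lemma \<Phi>_zero_everywhere:
  assumes "\<beta> \<in> hom G additive_real" "\<Phi> \<beta> = 0" "\<eta> \<in> hom G additive_real"
  shows "\<Phi> \<eta> = 0"
proof -
  have "(\<lambda>g. 2 * (\<eta> g - \<beta> g)) \<in> hom G additive_real"
    using assms by (intro additive_real_cmult additive_real_diff)
  from \<Phi>_log_convex[OF assms(1) this, of "1/2"]
  have "\<Phi> (\<lambda>g. \<beta> g + 1/2 * (2 * (\<eta> g - \<beta> g))) \<le> 0"
    by (simp add: assms(2))
  moreover have "(\<lambda>g. \<beta> g + 1/2 * (2 * (\<eta> g - \<beta> g))) = \<eta>" by (rule ext) (simp add: field_simps)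
  ultimately have "\<Phi> \<eta> \<le> 0" by simp
  with \<Phi>_nonneg[of \<eta>] show ?thesis by simp
qed

end

section \<open>Growth bound degrees of log-convex functions\<close>

text \<open>For convex \<open>W\<close> the quotients increase in \<open>s\<close>, so the supremum
  is their limit, the growth rate of \<open>W\<close>.\<close>

definition asymptotic_slope :: "(real \<Rightarrow> real) \<Rightarrow> real"
  where "asymptotic_slope W = (SUP s\<in>{0<..}. (W s - W 0) / s)"

lemma convex_slope_mono:
  fixes W :: "real \<Rightarrow> real"
  assumes "convex_on UNIV W" "0 < s" "s \<le> s'"
  shows "(W s - W 0) / s \<le> (W s' - W 0) / s'"
proof -
  define u where "u = s / s'"
  have u: "0 \<le> u" "u \<le> 1" "s = u * s'" using assms by (auto simp: u_def)
  have "W ((1 - u) *\<^sub>R 0 + u *\<^sub>R s') \<le> (1 - u) * W 0 + u * W s'"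
    by (rule convex_onD[OF assms(1)]) (use u in auto)
  then have "W s - W 0 \<le> u * (W s' - W 0)" using u by (simp add: algebra_simps)
  then have "(W s - W 0) / s \<le> u * (W s' - W 0) / s"
    using assms by (intro divide_right_mono) auto
  also have "u * (W s' - W 0) / s = (W s' - W 0) / s'" using assms by (simp add: u_def)
  finally show ?thesis .
qed

locale convex_linear_growth =
  fixes W :: "real \<Rightarrow> real" and a c :: real
  assumes conv: "convex_on UNIV W" and growth: "0 < s \<Longrightarrow> W s \<le> a + c * s"
begin

text \<open>By monotonicity a quotient may be compared with one at arbitrarily large
  \<open>s'\<close>, where the additive constants in the growth bound are negligible.\<close>

lemma slope_le_rate: "0 < s \<Longrightarrow> (W s - W 0) / s \<le> c"
proof -
  assume "0 < s"
  have "(W s - W 0) / s \<le> c + \<bar>a - W 0\<bar> / real (Suc n)" for n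
  proof -
    define s' where "s' = max s (real (Suc n))"
    have s': "s \<le> s'" "real (Suc n) \<le> s'" "0 < s'" using \<open>0 < s\<close> by (auto simp: s'_def)
    have "(W s - W 0) / s \<le> (W s' - W 0) / s'"
      by (rule convex_slope_mono[OF conv \<open>0 < s\<close> s'(1)])
    also have "\<dots> \<le> (c * s' + \<bar>a - W 0\<bar>) / s'"
      using growth[OF s'(3)] s'(3) by (intro divide_right_mono) auto
    also have "\<dots> = c + \<bar>a - W 0\<bar> / s'" using s'(3) by (simp add: add_divide_distrib)
    also have "\<dots> \<le> c + \<bar>a - W 0\<bar> / real (Suc n)"
      using s' by (intro add_left_mono divide_left_mono) auto
    finally show ?thesis .
  qed
  moreover have "(\<lambda>n. c + \<bar>a - W 0\<bar> / real (Suc n)) \<longlonglongrightarrow> c + 0"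
    using tendsto_mult[OF tendsto_const[of "\<bar>a - W 0\<bar>"] LIMSEQ_inverse_real_of_nat]
    by (intro tendsto_add tendsto_const) (simp add: divide_inverse)
  ultimately show ?thesis
    using LIMSEQ_le_const[of "\<lambda>n. c + \<bar>a - W 0\<bar> / real (Suc n)" "c + 0"] by auto
qed

lemma slope_le: "0 < s \<Longrightarrow> (W s - W 0) / s \<le> asymptotic_slope W"
  unfolding asymptotic_slope_def
  by (rule cSUP_upper) (auto intro!: bdd_aboveI[of _ c] slope_le_rate)

lemma W_le: "0 < s \<Longrightarrow> W s \<le> W 0 + asymptotic_slope W * s"
  using slope_le[of s] by (simp add: field_simps)

lemma asymptotic_slope_le: "asymptotic_slope W \<le> c"
  unfolding asymptotic_slope_def by (rule cSUP_least) (auto intro: slope_le_rate)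

lemma tendsto_if_gt:
  assumes "asymptotic_slope W < D"
  shows "((\<lambda>t. exp (W (ln t)) * t powr (- D)) \<longlongrightarrow> 0) at_top"
proof (rule tendsto_sandwich)
  define m where "m = asymptotic_slope W"
  show "eventually (\<lambda>t. 0 \<le> exp (W (ln t)) * t powr (- D)) at_top" by simp
  show "eventually (\<lambda>t. exp (W (ln t)) * t powr (- D) \<le> exp (W 0) * t powr (m - D)) at_top"
    using eventually_gt_at_top[of 1]
  proof eventually_elim
    case (elim t)
    have "exp (W (ln t)) * t powr (- D) = exp (W (ln t) - D * ln t)"
      using elim by (simp add: powr_def exp_diff exp_minus divide_inverse)
    also have "\<dots> \<le> exp (W 0 + (m - D) * ln t)"
      using W_le[of "ln t"] elim by (simp add: m_def algebra_simps)
    also have "\<dots> = exp (W 0) * t powr (m - D)"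
      using elim by (simp add: powr_def exp_add)
    finally show ?case .
  qed
  have "((\<lambda>t. t powr (m - D)) \<longlongrightarrow> 0) at_top"
    using assms by (intro tendsto_neg_powr filterlim_ident) (simp add: m_def)
  then show "((\<lambda>t. exp (W 0) * t powr (m - D)) \<longlongrightarrow> 0) at_top"
    by (rule tendsto_mult_right_zero)
qed simp

text \<open>If some quotient exceeds \<open>D\<close>, all later ones do. Then
  \<open>W s - D * s\<close> stays at least \<open>W 0\<close> from there on, which rules out decay
  to 0.\<close>

lemma ge_if_tendsto:
  assumes "((\<lambda>t. exp (W (ln t)) * t powr (- D)) \<longlongrightarrow> 0) at_top"
  shows "asymptotic_slope W \<le> D"
proof (rule ccontr)
  assume "\<not> asymptotic_slope W \<le> D"
  then have "D < (SUP s\<in>{0<..}. (W s - W 0) / s)" by (simp add: asymptotic_slope_def)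
  then obtain s where s: "0 < s" "D < (W s - W 0) / s"
    by (subst (asm) less_cSUP_iff) (auto intro!: bdd_aboveI[of _ c] slope_le_rate)
  have 1: "eventually (\<lambda>t. exp (W (ln t)) * t powr (- D) < exp (W 0)) at_top"
    using assms by (rule order_tendstoD) simp
  have 2: "eventually (\<lambda>t. exp (W 0) \<le> exp (W (ln t)) * t powr (- D)) at_top"
    using eventually_ge_at_top[of "exp s"]
  proof eventually_elim
    case (elim t)
    have "0 < t" using elim exp_gt_zero[of s] by linarith
    then have t: "0 < t" "s \<le> ln t" using elim by (auto simp: ln_ge_iff)
    have "D \<le> (W (ln t) - W 0) / ln t"
      using convex_slope_mono[OF conv s(1) t(2)] s(2) by linarith
    then have "W 0 \<le> W (ln t) - D * ln t"
      using less_le_trans[OF s(1) t(2)] by (simp add: pos_le_divide_eq)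
    then have "exp (W 0) \<le> exp (W (ln t) - D * ln t)" by simp
    also have "\<dots> = exp (W (ln t)) * t powr (- D)"
      using t by (simp add: powr_def exp_diff exp_minus divide_inverse)
    finally show ?case .
  qed
  have "eventually (\<lambda>t :: real. False) at_top"
    by (rule eventually_mono[OF eventually_conj[OF 1 2]]) auto
  then show False by simp
qed

end

lemma degb_infinity_exp:
  assumes "convex_linear_growth W a c" and V: "\<And>t. 0 < t \<Longrightarrow> V t = exp (W (ln t))"
  shows "degb_infinity V = ereal (asymptotic_slope W)"
proof -
  interpret convex_linear_growth W a c by fact
  have iff: "((\<lambda>t. V t * t powr (- D)) \<longlongrightarrow> 0) at_top \<longleftrightarrow>
      ((\<lambda>t. exp (W (ln t)) * t powr (- D)) \<longlongrightarrow> 0) at_top" for D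
    by (rule tendsto_cong) (use eventually_gt_at_top[of 0] in \<open>eventually_elim, simp add: V\<close>)
  show ?thesis
    unfolding degb_infinity_def iff
  proof (rule antisym)
    show "ereal (asymptotic_slope W) \<le> Inf {ereal D | D. ((\<lambda>t. exp (W (ln t)) * t powr (- D)) \<longlongrightarrow> 0) at_top}"
      by (rule Inf_greatest) (auto intro: ge_if_tendsto)
    show "Inf {ereal D | D. ((\<lambda>t. exp (W (ln t)) * t powr (- D)) \<longlongrightarrow> 0) at_top} \<le> ereal (asymptotic_slope W)"
    proof (rule ereal_le_epsilon2)
      fix \<epsilon> :: real assume "0 < \<epsilon>"
      then have "((\<lambda>t. exp (W (ln t)) * t powr (- (asymptotic_slope W + \<epsilon>))) \<longlongrightarrow> 0) at_top"
        by (intro tendsto_if_gt) simp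
      then show "Inf {ereal D | D. ((\<lambda>t. exp (W (ln t)) * t powr (- D)) \<longlongrightarrow> 0) at_top}
          \<le> ereal (asymptotic_slope W) + ereal \<epsilon>"
        by (intro Inf_lower) auto
    qed
  qed
qed

text \<open>Replacing \<open>t\<close> by its inverse reflects \<open>W\<close> and reverses the
  sign of \<open>D\<close>, so this end reduces to the behaviour at infinity.\<close>

lemma degb_zero_exp:
  assumes "convex_linear_growth (\<lambda>s. W (- s)) a c" and V: "\<And>t. 0 < t \<Longrightarrow> V t = exp (W (ln t))"
  shows "degb_zero V = ereal (- asymptotic_slope (\<lambda>s. W (- s)))"
proof -
  define W' where "W' s = W (- s)" for s
  interpret convex_linear_growth W' a c unfolding W'_def by fact
  have iff: "((\<lambda>t. V t * t powr (- D)) \<longlongrightarrow> 0) (at_right 0) \<longleftrightarrow>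
      ((\<lambda>t. exp (W' (ln t)) * t powr (- (- D))) \<longlongrightarrow> 0) at_top" for D
    unfolding filterlim_at_right_to_top
  proof (rule tendsto_cong)
    show "eventually (\<lambda>t. V (inverse t) * inverse t powr (- D) = exp (W' (ln t)) * t powr (- (- D))) at_top"
      using eventually_gt_at_top[of 0]
      by eventually_elim (simp add: V W'_def ln_inverse powr_def)
  qed
  have "degb_zero V = ereal (- asymptotic_slope W')"
    unfolding degb_zero_def iff
  proof (rule antisym)
    show "Sup {ereal D | D. ((\<lambda>t. exp (W' (ln t)) * t powr (- (- D))) \<longlongrightarrow> 0) at_top} \<le> ereal (- asymptotic_slope W')"
    proof (rule Sup_least)
      fix x assume "x \<in> {ereal D | D. ((\<lambda>t. exp (W' (ln t)) * t powr (- (- D))) \<longlongrightarrow> 0) at_top}"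
      then obtain D where D: "x = ereal D" "((\<lambda>t. exp (W' (ln t)) * t powr (- (- D))) \<longlongrightarrow> 0) at_top" by blast
      from ge_if_tendsto[OF D(2)] show "x \<le> ereal (- asymptotic_slope W')" by (simp add: D(1))
    qed
    show "ereal (- asymptotic_slope W') \<le> Sup {ereal D | D. ((\<lambda>t. exp (W' (ln t)) * t powr (- (- D))) \<longlongrightarrow> 0) at_top}"
    proof (rule ereal_le_epsilon2)
      fix \<epsilon> :: real assume "0 < \<epsilon>"
      then have "((\<lambda>t. exp (W' (ln t)) * t powr (- (- (- asymptotic_slope W' - \<epsilon>)))) \<longlongrightarrow> 0) at_top"
        by (intro tendsto_if_gt) simp
      then have "ereal (- asymptotic_slope W' - \<epsilon>) \<le>
          Sup {ereal D | D. ((\<lambda>t. exp (W' (ln t)) * t powr (- (- D))) \<longlongrightarrow> 0) at_top}"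
        by (intro Sup_upper) blast
      then have "ereal (- asymptotic_slope W' - \<epsilon>) + ereal \<epsilon> \<le>
          Sup {ereal D | D. ((\<lambda>t. exp (W' (ln t)) * t powr (- (- D))) \<longlongrightarrow> 0) at_top} + ereal \<epsilon>"
        by (rule add_right_mono)
      then show "ereal (- asymptotic_slope W') \<le>
          Sup {ereal D | D. ((\<lambda>t. exp (W' (ln t)) * t powr (- (- D))) \<longlongrightarrow> 0) at_top} + ereal \<epsilon>"
        by simp
    qed
  qed
  then show ?thesis by (simp add: W'_def[abs_def])
qed

section \<open>Degrees of the determinants as sums of asymptotic slopes\<close>

context kappa_family
begin

definition M :: "('g \<Rightarrow> real) \<Rightarrow> real"
  where "M \<beta> = asymptotic_slope (\<lambda>s. ln (\<Phi> (\<lambda>g. s * \<beta> g)))"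

lemma mat_support_eq: "mat_support p A = (\<lambda>k. snd (snd k)) ` terms"
proof (intro equalityI subsetI)
  fix g assume "g \<in> mat_support p A"
  then have "coeff_mat A g \<noteq> 0\<^sub>m p p" by (simp add: mat_support_def)
  then obtain i j where ij: "i < p" "j < p" "coeff_mat A g $$ (i, j) \<noteq> 0"
    using dims by (metis (no_types, lifting) carrier_matD coeff_mat_def eq_matI index_map_mat(2,3) index_zero_mat)
  then have "g \<in> Poly_Mapping.keys (A $$ (i, j))"
    using dims by (simp add: coeff_mat_def in_keys_iff)
  then show "g \<in> (\<lambda>k. snd (snd k)) ` terms"
    using ij by (auto simp: terms_def intro!: image_eqI[of _ _ "(i, j, g)"])
next
  fix g assume "g \<in> (\<lambda>k. snd (snd k)) ` terms"
  then obtain i j where ij: "i < p" "j < p" "g \<in> Poly_Mapping.keys (A $$ (i, j))"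
    by (auto simp: terms_def)
  then have "coeff_mat A g $$ (i, j) \<noteq> 0"
    using dims by (simp add: coeff_mat_def in_keys_iff)
  then show "g \<in> mat_support p A"
    using ij by (auto simp: mat_support_def)
qed

context
  assumes nonzero: "\<And>\<beta>. \<beta> \<in> hom G additive_real \<Longrightarrow> \<Phi> \<beta> \<noteq> 0"
begin

lemma \<Phi>_pos: "\<beta> \<in> hom G additive_real \<Longrightarrow> 0 < \<Phi> \<beta>"
  using nonzero[of \<beta>] \<Phi>_nonneg[of \<beta>] by simp

lemma ln_\<Phi>_convex:
  assumes \<alpha>: "\<alpha> \<in> hom G additive_real" and \<beta>: "\<beta> \<in> hom G additive_real" and u: "0 < u" "u < 1"
  shows "ln (\<Phi> (\<lambda>g. (1 - u) * \<alpha> g + u * \<beta> g)) \<le> (1 - u) * ln (\<Phi> \<alpha>) + u * ln (\<Phi> \<beta>)"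
proof -
  have \<delta>: "(\<lambda>g. \<beta> g - \<alpha> g) \<in> hom G additive_real" using \<alpha> \<beta> by (intro additive_real_diff)
  have h: "(\<lambda>g. (1 - u) * \<alpha> g + u * \<beta> g) \<in> hom G additive_real"
    using \<alpha> \<beta> by (intro additive_real_add additive_real_cmult)
  have "\<Phi> (\<lambda>g. (1 - u) * \<alpha> g + u * \<beta> g) \<le> \<Phi> \<alpha> powr (1 - u) * \<Phi> \<beta> powr u"
    using \<Phi>_log_convex[OF \<alpha> \<delta> u] by (simp add: algebra_simps)
  then have "ln (\<Phi> (\<lambda>g. (1 - u) * \<alpha> g + u * \<beta> g)) \<le> ln (\<Phi> \<alpha> powr (1 - u) * \<Phi> \<beta> powr u)"
    using \<Phi>_pos[OF h] by (intro ln_mono) auto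
  also have "\<dots> = (1 - u) * ln (\<Phi> \<alpha>) + u * ln (\<Phi> \<beta>)"
    using \<Phi>_pos[OF \<alpha>] \<Phi>_pos[OF \<beta>] by (simp add: ln_mult ln_powr)
  finally show ?thesis .
qed

lemma line_growth:
  assumes \<beta>: "\<beta> \<in> hom G additive_real" and c: "\<And>k. k \<in> terms \<Longrightarrow> \<beta> (el k) \<le> c"
  shows "convex_linear_growth (\<lambda>s. ln (\<Phi> (\<lambda>g. s * \<beta> g))) (real p * ln total) (real p * c)"
proof
  show "convex_on UNIV (\<lambda>s. ln (\<Phi> (\<lambda>g. s * \<beta> g)))"
  proof (rule convex_onI)
    fix u x y :: real assume u: "0 < u" "u < 1"
    have "ln (\<Phi> (\<lambda>g. (1 - u) * (x * \<beta> g) + u * (y * \<beta> g))) \<le>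
        (1 - u) * ln (\<Phi> (\<lambda>g. x * \<beta> g)) + u * ln (\<Phi> (\<lambda>g. y * \<beta> g))"
      using u \<beta> by (intro ln_\<Phi>_convex additive_real_cmult)
    then show "ln (\<Phi> (\<lambda>g. ((1 - u) *\<^sub>R x + u *\<^sub>R y) * \<beta> g)) \<le>
        (1 - u) * ln (\<Phi> (\<lambda>g. x * \<beta> g)) + u * ln (\<Phi> (\<lambda>g. y * \<beta> g))"
      by (simp add: algebra_simps)
  qed simp
  fix s :: real assume "0 < s"
  have "\<Phi> (\<lambda>g. s * \<beta> g) \<le> exp (real p * (ln total + s * c))"
    using c \<open>0 < s\<close> by (intro \<Phi>_le) simp
  moreover have "0 < \<Phi> (\<lambda>g. s * \<beta> g)" using \<beta> by (intro \<Phi>_pos additive_real_cmult)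
  ultimately have "ln (\<Phi> (\<lambda>g. s * \<beta> g)) \<le> real p * (ln total + s * c)"
    using ln_mono[of "\<Phi> (\<lambda>g. s * \<beta> g)"] by fastforce
  then show "ln (\<Phi> (\<lambda>g. s * \<beta> g)) \<le> real p * ln total + real p * c * s"
    by (simp add: algebra_simps)
qed

lemma line_growth_exists:
  assumes "\<beta> \<in> hom G additive_real"
  shows "\<exists>a c. convex_linear_growth (\<lambda>s. ln (\<Phi> (\<lambda>g. s * \<beta> g))) a c"
proof -
  have "\<beta> (el k) \<le> (\<Sum>k\<in>terms. \<bar>\<beta> (el k)\<bar>)" if "k \<in> terms" for k
    using member_le_sum[OF that, of "\<lambda>k. \<bar>\<beta> (el k)\<bar>"] finite_terms by fastforce
  then show ?thesis using line_growth[OF assms] by blast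
qed

lemma M_le: "\<beta> \<in> hom G additive_real \<Longrightarrow> (\<And>k. k \<in> terms \<Longrightarrow> \<beta> (el k) \<le> c) \<Longrightarrow> M \<beta> \<le> real p * c"
  unfolding M_def by (rule convex_linear_growth.asymptotic_slope_le[OF line_growth])

lemma ln_\<Phi>_le_M:
  assumes "\<beta> \<in> hom G additive_real" "0 < s"
  shows "ln (\<Phi> (\<lambda>g. s * \<beta> g)) \<le> ln (\<Phi> (\<lambda>_. 0)) + M \<beta> * s"
proof -
  obtain a c where "convex_linear_growth (\<lambda>s. ln (\<Phi> (\<lambda>g. s * \<beta> g))) a c"
    using line_growth_exists[OF assms(1)] by blast
  from convex_linear_growth.W_le[OF this assms(2)] show ?thesis by (simp add: M_def)
qed

text \<open>\<open>s * (\<alpha> g + \<beta> g)\<close> is the midpoint of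
  \<open>2 * s * \<alpha> g\<close> and \<open>2 * s * \<beta> g\<close>; the factors 1/2 and 2
  cancel in the slopes.\<close>

lemma M_add:
  assumes \<alpha>: "\<alpha> \<in> hom G additive_real" and \<beta>: "\<beta> \<in> hom G additive_real"
  shows "M (\<lambda>g. \<alpha> g + \<beta> g) \<le> M \<alpha> + M \<beta>"
  unfolding M_def[of "\<lambda>g. \<alpha> g + \<beta> g"] asymptotic_slope_def
proof (rule cSUP_least)
  fix s :: real assume "s \<in> {0<..}"
  then have s: "0 < s" by simp
  have "ln (\<Phi> (\<lambda>g. (1 - 1/2) * (2 * s * \<alpha> g) + (1/2) * (2 * s * \<beta> g))) \<le>
      (1 - 1/2) * ln (\<Phi> (\<lambda>g. 2 * s * \<alpha> g)) + (1/2) * ln (\<Phi> (\<lambda>g. 2 * s * \<beta> g))"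
    using \<alpha> \<beta> by (intro ln_\<Phi>_convex additive_real_cmult) auto
  moreover have "(\<lambda>g. (1 - 1/2) * (2 * s * \<alpha> g) + (1/2) * (2 * s * \<beta> g)) = (\<lambda>g. s * (\<alpha> g + \<beta> g))"
    by (rule ext) (simp add: distrib_left)
  moreover have "ln (\<Phi> (\<lambda>g. 2 * s * \<alpha> g)) \<le> ln (\<Phi> (\<lambda>_. 0)) + M \<alpha> * (2 * s)"
    "ln (\<Phi> (\<lambda>g. 2 * s * \<beta> g)) \<le> ln (\<Phi> (\<lambda>_. 0)) + M \<beta> * (2 * s)"
    using s by (intro ln_\<Phi>_le_M \<alpha> \<beta>; simp)+
  ultimately have "ln (\<Phi> (\<lambda>g. s * (\<alpha> g + \<beta> g))) \<le> ln (\<Phi> (\<lambda>_. 0)) + (M \<alpha> + M \<beta>) * s"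
    by (simp add: algebra_simps)
  then show "(ln (\<Phi> (\<lambda>g. s * (\<alpha> g + \<beta> g))) - ln (\<Phi> (\<lambda>g. 0 * (\<alpha> g + \<beta> g)))) / s \<le> M \<alpha> + M \<beta>"
    using s by (simp add: field_simps)
qed simp

lemma M_zero: "M (\<lambda>_. 0) = 0"
  unfolding M_def asymptotic_slope_def by (simp add: cSUP_const[of "{0::real<..}" "0::real"])

text \<open>The two ends of the line through 0 in direction \<beta> are rays in directions \<beta>
  and its negative, each contributing its slope. Nonnegativity is subadditivity applied to these
  two, whose sum is 0.\<close>

lemma degree_formula:
  assumes \<beta>: "\<beta> \<in> hom G additive_real" and V: "\<And>t. 0 < t \<Longrightarrow> V t = \<Phi> (\<lambda>g. ln t * \<beta> g)"
  shows "has_degb V" "degb V = M \<beta> + M (\<lambda>g. - \<beta> g)" "0 \<le> degb V"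
proof -
  have n\<beta>: "(\<lambda>g. - \<beta> g) \<in> hom G additive_real"
    using additive_real_cmult[OF \<beta>, of "-1"] by simp
  obtain a c where 1: "convex_linear_growth (\<lambda>s. ln (\<Phi> (\<lambda>g. s * \<beta> g))) a c"
    using line_growth_exists[OF \<beta>] by blast
  obtain a' c' where "convex_linear_growth (\<lambda>s. ln (\<Phi> (\<lambda>g. s * - \<beta> g))) a' c'"
    using line_growth_exists[OF n\<beta>] by blast
  then have 2: "convex_linear_growth (\<lambda>s. ln (\<Phi> (\<lambda>g. (- s) * \<beta> g))) a' c'" by simp
  have V': "V t = exp (ln (\<Phi> (\<lambda>g. ln t * \<beta> g)))" if "0 < t" for t
    using V[OF that] \<Phi>_pos[OF additive_real_cmult[OF \<beta>]] by simp
  have inf: "degb_infinity V = ereal (M \<beta>)"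
    unfolding M_def by (rule degb_infinity_exp[OF 1 V'])
  have zero: "degb_zero V = ereal (- M (\<lambda>g. - \<beta> g))"
    using degb_zero_exp[where W = "\<lambda>s. ln (\<Phi> (\<lambda>g. s * \<beta> g))", OF 2 V'] by (simp add: M_def)
  show "has_degb V" by (simp add: has_degb_def inf zero)
  show deg: "degb V = M \<beta> + M (\<lambda>g. - \<beta> g)" by (simp add: degb_def inf zero)
  show "0 \<le> degb V"
    using M_add[OF \<beta> n\<beta>] by (simp add: deg M_zero)
qed

lemma M_width:
  assumes \<delta>: "\<delta> \<in> hom G additive_real"
  shows "M \<delta> + M (\<lambda>g. - \<delta> g) \<le> R_width p A (\<lambda>g. \<delta> (\<gamma> g))"
proof -
  have n\<delta>: "(\<lambda>g. - \<delta> g) \<in> hom G additive_real"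
    using additive_real_cmult[OF \<delta>, of "-1"] by simp
  have fin: "finite (mat_support p A)" by (simp add: mat_support_eq finite_terms)
  show ?thesis
  proof (cases "mat_support p A = {}")
    case True
    then have "terms = {}" by (simp add: mat_support_eq)
    \<comment> \<open>With no terms every bound holds vacuously; 0 matches the default value of
      \<open>R_width\<close>.\<close>
    then have "M \<delta> \<le> real p * 0" "M (\<lambda>g. - \<delta> g) \<le> real p * 0"
      by (intro M_le \<delta> n\<delta>; simp)+
    then show ?thesis by (simp add: R_width_def True)
  next
    case False
    define f where "f = (\<lambda>g. \<delta> (\<gamma> g))"
    have "M \<delta> \<le> real p * Max (f ` mat_support p A)"
    proof (rule M_le[OF \<delta>])
      fix k assume "k \<in> terms"
      then show "\<delta> (el k) \<le> Max (f ` mat_support p A)"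
        using fin by (intro Max_ge) (auto simp: mat_support_eq f_def)
    qed
    moreover have "M (\<lambda>g. - \<delta> g) \<le> real p * (- Min (f ` mat_support p A))"
    proof (rule M_le[OF n\<delta>])
      fix k assume "k \<in> terms"
      then have "Min (f ` mat_support p A) \<le> \<delta> (el k)"
        using fin by (intro Min_le) (auto simp: mat_support_eq f_def)
      then show "- \<delta> (el k) \<le> - Min (f ` mat_support p A)" by simp
    qed
    ultimately show ?thesis
      using False by (simp add: R_width_def f_def algebra_simps)
  qed
qed

text \<open>Each of the two slopes of \<alpha> exceeds the corresponding one of \<beta> by at most a
  slope of the difference, with opposite signs. So the two errors add up to exactly what
  \<open>M_width\<close> bounds, and a single width suffices.\<close>

lemma degree_difference:
  assumes \<alpha>: "\<alpha> \<in> hom G additive_real" and \<beta>: "\<beta> \<in> hom G additive_real"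
  shows "\<bar>(M \<alpha> + M (\<lambda>g. - \<alpha> g)) - (M \<beta> + M (\<lambda>g. - \<beta> g))\<bar> \<le> R_width p A (\<lambda>g. \<alpha> (\<gamma> g) - \<beta> (\<gamma> g))"
proof -
  have neg: "(\<lambda>g. - \<xi> g) \<in> hom G additive_real" if "\<xi> \<in> hom G additive_real" for \<xi>
    using additive_real_cmult[OF that, of "-1"] by simp
  have \<delta>: "(\<lambda>g. \<alpha> g - \<beta> g) \<in> hom G additive_real" using \<alpha> \<beta> by (rule additive_real_diff)
  have \<delta>': "(\<lambda>g. \<beta> g - \<alpha> g) \<in> hom G additive_real" using \<beta> \<alpha> by (rule additive_real_diff)
  have "M \<alpha> \<le> M \<beta> + M (\<lambda>g. \<alpha> g - \<beta> g)" "M \<beta> \<le> M \<alpha> + M (\<lambda>g. \<beta> g - \<alpha> g)"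
    "M (\<lambda>g. - \<alpha> g) \<le> M (\<lambda>g. - \<beta> g) + M (\<lambda>g. \<beta> g - \<alpha> g)"
    "M (\<lambda>g. - \<beta> g) \<le> M (\<lambda>g. - \<alpha> g) + M (\<lambda>g. \<alpha> g - \<beta> g)"
    using M_add[OF \<beta> \<delta>] M_add[OF \<alpha> \<delta>'] M_add[OF neg[OF \<beta>] \<delta>'] M_add[OF neg[OF \<alpha>] \<delta>]
    by (simp_all add: algebra_simps)
  moreover have "M (\<lambda>g. \<alpha> g - \<beta> g) + M (\<lambda>g. \<beta> g - \<alpha> g) \<le> R_width p A (\<lambda>g. \<alpha> (\<gamma> g) - \<beta> (\<gamma> g))"
    using M_width[OF \<delta>] by simp
  ultimately show ?thesis by linarith
qed

end

end

section \<open>Norms on finite-dimensional spaces of functions\<close>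

text \<open>The Lipschitz claim concerns an arbitrary norm on cohomology. It is reduced to bounding
  point evaluations by that norm, a form of the equivalence of norms in finite dimension.\<close>

locale function_norm =
  fixes E :: "('g \<Rightarrow> real) set" and N :: "('g \<Rightarrow> real) \<Rightarrow> real"
  assumes zero_mem: "(\<lambda>_. 0) \<in> E"
    and add_mem: "x \<in> E \<Longrightarrow> y \<in> E \<Longrightarrow> (\<lambda>g. x g + y g) \<in> E"
    and cmult_mem: "x \<in> E \<Longrightarrow> (\<lambda>g. c * x g) \<in> E"
    and N_nonneg: "x \<in> E \<Longrightarrow> 0 \<le> N x"
    and N_zero: "x \<in> E \<Longrightarrow> N x = 0 \<longleftrightarrow> x = (\<lambda>_. 0)"
    and N_cmult: "x \<in> E \<Longrightarrow> N (\<lambda>g. c * x g) = \<bar>c\<bar> * N x"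
    and N_add: "x \<in> E \<Longrightarrow> y \<in> E \<Longrightarrow> N (\<lambda>g. x g + y g) \<le> N x + N y"
begin

lemma diff_mem:
  assumes "x \<in> E" "y \<in> E"
  shows "(\<lambda>g. x g - y g) \<in> E"
  using add_mem[OF assms(1) cmult_mem[OF assms(2), of "-1"]] by simp

lemma N_diff:
  assumes "x \<in> E" "y \<in> E"
  shows "N (\<lambda>g. x g - y g) \<le> N x + N y"
  using N_add[OF assms(1) cmult_mem[OF assms(2), of "-1"]] N_cmult[OF assms(2), of "-1"] by simp

lemma sum_mem: "finite T \<Longrightarrow> (\<And>t. t \<in> T \<Longrightarrow> e t \<in> E) \<Longrightarrow> (\<lambda>g. \<Sum>t\<in>T. a t * e t g) \<in> E"
proof (induction T rule: finite_induct)
  case empty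
  then show ?case by (simp add: zero_mem)
next
  case (insert s T)
  have "(\<lambda>g. a s * e s g + (\<Sum>t\<in>T. a t * e t g)) \<in> E"
    using insert by (intro add_mem cmult_mem) auto
  with insert show ?case by simp
qed

lemma N_sum:
  "finite T \<Longrightarrow> (\<And>t. t \<in> T \<Longrightarrow> e t \<in> E) \<Longrightarrow> N (\<lambda>g. \<Sum>t\<in>T. a t * e t g) \<le> (\<Sum>t\<in>T. \<bar>a t\<bar> * N (e t))"
proof (induction T rule: finite_induct)
  case empty
  then show ?case using N_zero[OF zero_mem] by simp
next
  case (insert s T)
  have "N (\<lambda>g. a s * e s g + (\<Sum>t\<in>T. a t * e t g)) \<le> N (\<lambda>g. a s * e s g) + N (\<lambda>g. \<Sum>t\<in>T. a t * e t g)"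
    using insert by (intro N_add cmult_mem sum_mem) auto
  with insert N_cmult[of "e s" "a s"] show ?case by simp
qed

end

text \<open>The points of \<open>T\<close> serve as coordinates, \<open>e\<close> is the dual basis.\<close>

definition bounded_coordinates :: "('g \<Rightarrow> real) set \<Rightarrow> (('g \<Rightarrow> real) \<Rightarrow> real) \<Rightarrow> 'g set \<Rightarrow> ('g \<Rightarrow> 'g \<Rightarrow> real) \<Rightarrow> real \<Rightarrow> bool"
  where "bounded_coordinates E N T e C \<longleftrightarrow> finite T \<and> 0 \<le> C \<and> (\<forall>t\<in>T. e t \<in> E) \<and>
    (\<forall>x\<in>E. (\<forall>g. x g = (\<Sum>t\<in>T. x t * e t g)) \<and> (\<forall>t\<in>T. \<bar>x t\<bar> \<le> C * N x))"

lemma bounded_coordinatesD: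
  assumes "bounded_coordinates E N T e C"
  shows "finite T" "0 \<le> C" "t \<in> T \<Longrightarrow> e t \<in> E"
    "x \<in> E \<Longrightarrow> x g = (\<Sum>t\<in>T. x t * e t g)" "x \<in> E \<Longrightarrow> t \<in> T \<Longrightarrow> \<bar>x t\<bar> \<le> C * N x"
  using assms unfolding bounded_coordinates_def by blast+

context function_norm
begin

text \<open>Otherwise members of \<open>E'\<close> approximate \<open>f\<close>. Their coordinates
  are Cauchy by the coordinate bounds, and the element \<open>z\<close> of \<open>E'\<close> with
  the limiting coordinates has distance 0 from \<open>f\<close>, so that
  \<open>f = z\<close>.\<close>

lemma distance_to_coordinate_subspace:
  assumes sub: "E' \<subseteq> E" and E': "function_norm E' N" and co: "bounded_coordinates E' N T e C"
    and f: "f \<in> E" "f \<notin> E'"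
  shows "\<exists>c>0. \<forall>y\<in>E'. c \<le> N (\<lambda>g. f g - y g)"
proof (rule ccontr)
  interpret E': function_norm E' N by fact
  note co' = bounded_coordinatesD[OF co]
  note T = co'(1,2) and e = co'(3)
  assume "\<not> ?thesis"
  moreover have "0 < 1 / (real n + 1)" for n :: nat by simp
  ultimately have "\<exists>y\<in>E'. N (\<lambda>g. f g - y g) < 1 / (real n + 1)" for n :: nat
    by (meson not_le)
  then obtain y where y: "\<And>n. y n \<in> E'" "\<And>n. N (\<lambda>g. f g - y n g) < 1 / (real n + 1)"
    by metis
  have yE: "y n \<in> E" for n using y(1) sub by blast
  have "convergent (\<lambda>n. y n t)" if t: "t \<in> T" for t
  proof (intro Cauchy_convergent metric_CauchyI)
    fix \<epsilon> :: real assume \<epsilon>: "0 < \<epsilon>"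
    obtain M :: nat where M: "(2 * C) / \<epsilon> < real M" using reals_Archimedean2 by blast
    have "dist (y m t) (y n t) < \<epsilon>" if mn: "M \<le> m" "M \<le> n" for m n
    proof -
      have bd: "1 / (real k + 1) \<le> 1 / (real M + 1)" if "M \<le> k" for k
        using that by (intro divide_left_mono) auto
      have "\<bar>y m t - y n t\<bar> \<le> C * N (\<lambda>g. y m g - y n g)"
        by (rule co'(5)[OF E'.diff_mem[OF y(1) y(1)] t])
      also have "N (\<lambda>g. y m g - y n g) = N (\<lambda>g. (f g - y n g) - (f g - y m g))" by simp
      also have "\<dots> \<le> N (\<lambda>g. f g - y n g) + N (\<lambda>g. f g - y m g)"
        using f yE by (intro N_diff diff_mem)
      also have "\<dots> \<le> 2 * (1 / (real M + 1))"
        using y(2)[of m] y(2)[of n] bd[OF mn(1)] bd[OF mn(2)] by linarith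
      finally have "\<bar>y m t - y n t\<bar> \<le> C * (2 * (1 / (real M + 1)))"
        using T(2) by (simp add: mult_left_mono)
      also have "\<dots> < \<epsilon>"
      proof -
        have "2 * C < \<epsilon> * real M" using M \<epsilon> by (simp add: pos_divide_less_eq mult.commute)
        then show ?thesis using \<epsilon> by (simp add: pos_divide_less_eq algebra_simps)
      qed
      finally show ?thesis by (simp add: dist_real_def)
    qed
    then show "\<exists>M. \<forall>m\<ge>M. \<forall>n\<ge>M. dist (y m t) (y n t) < \<epsilon>" by blast
  qed
  then have "\<exists>l. \<forall>t\<in>T. (\<lambda>n. y n t) \<longlonglongrightarrow> l t" by (meson convergent_LIMSEQ_iff)
  then obtain l where l: "\<And>t. t \<in> T \<Longrightarrow> (\<lambda>n. y n t) \<longlonglongrightarrow> l t" by blast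
  define z where "z = (\<lambda>g. \<Sum>t\<in>T. l t * e t g)"
  have z: "z \<in> E'" unfolding z_def using T e by (intro E'.sum_mem)
  have bound: "N (\<lambda>g. f g - z g) \<le> 1 / (real n + 1) + (\<Sum>t\<in>T. \<bar>y n t - l t\<bar> * N (e t))" for n
  proof -
    have expand: "y n g - z g = (\<Sum>t\<in>T. (y n t - l t) * e t g)" for g
    proof -
      have "y n g = (\<Sum>t\<in>T. y n t * e t g)" by (rule co'(4)[OF y(1)])
      then show ?thesis by (simp add: z_def left_diff_distrib sum_subtractf)
    qed
    have "N (\<lambda>g. f g - z g) = N (\<lambda>g. (f g - y n g) + (y n g - z g))" by simp
    also have "\<dots> \<le> N (\<lambda>g. f g - y n g) + N (\<lambda>g. y n g - z g)"
      using f yE z sub by (intro N_add diff_mem) auto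
    also have "N (\<lambda>g. y n g - z g) \<le> (\<Sum>t\<in>T. \<bar>y n t - l t\<bar> * N (e t))"
      unfolding expand using T e by (intro E'.N_sum)
    finally show ?thesis using y(2)[of n] by linarith
  qed
  have "(\<lambda>n. 1 / (real n + 1) + (\<Sum>t\<in>T. \<bar>y n t - l t\<bar> * N (e t)))
      \<longlonglongrightarrow> 0 + (\<Sum>t\<in>T. \<bar>l t - l t\<bar> * N (e t))"
  proof (intro tendsto_intros l)
    show "(\<lambda>n. 1 / (real n + 1)) \<longlonglongrightarrow> 0"
      using LIMSEQ_inverse_real_of_nat by (simp add: inverse_eq_divide add.commute)
  qed
  then have "(\<lambda>n. 1 / (real n + 1) + (\<Sum>t\<in>T. \<bar>y n t - l t\<bar> * N (e t))) \<longlonglongrightarrow> 0" by simp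
  from LIMSEQ_le_const[OF this, of "N (\<lambda>g. f g - z g)"] bound
  have "N (\<lambda>g. f g - z g) \<le> 0" by blast
  moreover have "(\<lambda>g. f g - z g) \<in> E" using f z sub by (intro diff_mem) auto
  ultimately have "(\<lambda>g. f g - z g) = (\<lambda>_. 0)" using N_nonneg N_zero by (metis order_antisym)
  then have "f = z" by (simp add: fun_eq_iff)
  with z f show False by simp
qed

end

text \<open>Requiring \<open>x s = 0\<close> passes to a subspace separated by one point less. If it
  is proper, the positive distance of a vector \<open>f\<close> with \<open>f s = 1\<close> from it
  controls the new coordinate \<open>x s\<close>, and subtracting \<open>x s\<close> times
  \<open>f\<close> leads back to the subspace.\<close>

lemma bounded_coordinates_exist:
  assumes "finite S" "function_norm E N" "\<And>x. x \<in> E \<Longrightarrow> (\<And>s. s \<in> S \<Longrightarrow> x s = 0) \<Longrightarrow> x = (\<lambda>_. 0)"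
  shows "\<exists>T e C. bounded_coordinates E N T e C"
  using assms
proof (induction S arbitrary: E rule: finite_induct)
  case empty
  then interpret function_norm E N by simp
  have "x g = 0" if "x \<in> E" for x g using empty(2)[OF that] by simp
  then have "bounded_coordinates E N {} (\<lambda>_ _. 0) 0" by (simp add: bounded_coordinates_def)
  then show ?case by blast
next
  case (insert s S)
  interpret function_norm E N by fact
  define E' where "E' = {x \<in> E. x s = 0}"
  have sub: "E' \<subseteq> E" by (auto simp: E'_def)
  have E': "function_norm E' N"
    by unfold_locales
      (auto simp: E'_def zero_mem add_mem cmult_mem N_nonneg N_zero N_cmult N_add)
  have "\<exists>T e C. bounded_coordinates E' N T e C"
    using insert.prems(2) by (intro insert.IH E') (auto simp: E'_def)
  then obtain T e C where co: "bounded_coordinates E' N T e C" by blast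
  show ?case
  proof (cases "E' = E")
    case True
    with co show ?thesis by blast
  next
    case False
    then obtain f0 where f0: "f0 \<in> E" "f0 s \<noteq> 0" by (auto simp: E'_def)
    define f where "f = (\<lambda>g. (1 / f0 s) * f0 g)"
    have f: "f \<in> E" unfolding f_def by (rule cmult_mem[OF f0(1)])
    have fs: "f s = 1" using f0 by (simp add: f_def)
    from fs have "f \<notin> E'" by (simp add: E'_def)
    from distance_to_coordinate_subspace[OF sub E' co f this]
    obtain c where c: "0 < c" "\<And>y. y \<in> E' \<Longrightarrow> c \<le> N (\<lambda>g. f g - y g)" by blast
    note co' = bounded_coordinatesD[OF co]
    define R where "R = T - {s}"
    have R: "finite R" "s \<notin> R" "R \<subseteq> T" using co'(1) by (auto simp: R_def)
    note C = co'(2)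
    have coord: "y g = (\<Sum>t\<in>R. y t * e t g)" if "y \<in> E'" for y g
    proof -
      have "y g = (\<Sum>t\<in>T. y t * e t g)" by (rule co'(4)[OF that])
      also have "\<dots> = (\<Sum>t\<in>R. y t * e t g)"
        unfolding R_def using co'(1) that by (intro sum.mono_neutral_right) (auto simp: E'_def)
      finally show ?thesis .
    qed
    \<comment> \<open>The total coefficient of \<open>x s\<close> once the coordinates of
      \<open>x\<close> minus \<open>x s\<close> times \<open>f\<close> are written as
      \<open>x t - x s * f t\<close>.\<close>
    define b where "b = (\<lambda>g. f g - (\<Sum>t\<in>R. f t * e t g))"
    have eE: "e t \<in> E" if "t \<in> R" for t using co'(3) that R sub by blast
    have b: "b \<in> E" unfolding b_def using R eE f by (intro diff_mem sum_mem)
    \<comment> \<open>The vector \<open>y\<close> below lies in \<open>E'\<close> and differs from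
      \<open>f\<close> by \<open>x\<close> divided by \<open>x s\<close>, so the distance bound
      \<open>c\<close> applies to this quotient.\<close>
    have s_bound: "\<bar>x s\<bar> \<le> N x / c" if x: "x \<in> E" for x
    proof (cases "x s = 0")
      case True
      then show ?thesis using c N_nonneg[OF x] by simp
    next
      case False
      define y where "y = (\<lambda>g. f g - (1 / x s) * x g)"
      have "y \<in> E" unfolding y_def by (intro diff_mem cmult_mem f x)
      then have y: "y \<in> E'" using fs False by (simp add: E'_def y_def)
      have "c \<le> N (\<lambda>g. (1 / x s) * x g)" using c(2)[OF y] by (simp add: y_def)
      also have "\<dots> = N x / \<bar>x s\<bar>" using N_cmult[OF x, of "1 / x s"] by simp
      finally show ?thesis using c(1) False by (simp add: field_simps)
    qed
    \<comment> \<open>The first summand bounds the coordinates of the part in \<open>E'\<close>, the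
      second the correction by \<open>f\<close>, and \<open>1 / c\<close> the coordinate at
      \<open>s\<close>.\<close>
    define K where "K = C * (1 + N f / c) + (\<Sum>t\<in>R. \<bar>f t\<bar>) / c + 1 / c"
    have pos: "0 \<le> C * (1 + N f / c)" "0 \<le> (\<Sum>t\<in>R. \<bar>f t\<bar>) / c" "0 \<le> 1 / c"
      using C c N_nonneg[OF f] by (auto intro!: mult_nonneg_nonneg divide_nonneg_nonneg sum_nonneg add_nonneg_nonneg)
    have "bounded_coordinates E N (insert s R) (e(s := b)) K"
      unfolding bounded_coordinates_def
    proof (intro conjI ballI allI)
      show "finite (insert s R)" using R by simp
      show "0 \<le> K" unfolding K_def using pos by linarith
      show "(e(s := b)) t \<in> E" if "t \<in> insert s R" for t using that b eE by auto
    next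
      fix x g assume x: "x \<in> E"
      define y where "y = (\<lambda>g. x g - x s * f g)"
      have y: "y \<in> E'" using f fs x unfolding y_def by (simp add: E'_def diff_mem cmult_mem)
      have "x g = x s * f g + y g" by (simp add: y_def)
      also have "y g = (\<Sum>t\<in>R. y t * e t g)" by (rule coord[OF y])
      also have "\<dots> = (\<Sum>t\<in>R. x t * e t g) - x s * (\<Sum>t\<in>R. f t * e t g)"
        by (simp add: y_def left_diff_distrib sum_subtractf sum_distrib_left mult.assoc)
      also have "(\<Sum>t\<in>R. x t * e t g) = (\<Sum>t\<in>R. x t * (e(s := b)) t g)"
        using R by (intro sum.cong) auto
      finally show "x g = (\<Sum>t\<in>insert s R. x t * (e(s := b)) t g)"
        using R by (simp add: b_def right_diff_distrib)
    next
      fix x t assume x: "x \<in> E" and t: "t \<in> insert s R"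
      have Nx: "0 \<le> N x" using x by (rule N_nonneg)
      show "\<bar>x t\<bar> \<le> K * N x"
      proof (cases "t = s")
        case True
        have "\<bar>x s\<bar> \<le> 1 / c * N x" using s_bound[OF x] by simp
        also have "\<dots> \<le> K * N x" using pos Nx by (intro mult_right_mono) (auto simp: K_def)
        finally show ?thesis using True by simp
      next
        case False
        then have tR: "t \<in> R" using t by simp
        define y where "y = (\<lambda>g. x g - x s * f g)"
        have y: "y \<in> E'" using f fs x unfolding y_def by (simp add: E'_def diff_mem cmult_mem)
        have "N y \<le> N x + N (\<lambda>g. x s * f g)"
          unfolding y_def using x f by (intro N_diff cmult_mem)
        also have "\<dots> \<le> N x + N x / c * N f"
          using mult_right_mono[OF s_bound[OF x] N_nonneg[OF f]] N_cmult[OF f, of "x s"] by simp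
        finally have Ny: "N y \<le> (1 + N f / c) * N x" by (simp add: algebra_simps)
        have "\<bar>y t\<bar> \<le> C * N y" using tR R by (intro co'(5)[OF y]) auto
        also have "\<dots> \<le> C * ((1 + N f / c) * N x)" using Ny C by (rule mult_left_mono)
        finally have 1: "\<bar>y t\<bar> \<le> C * (1 + N f / c) * N x" by simp
        have "\<bar>f t\<bar> \<le> (\<Sum>t\<in>R. \<bar>f t\<bar>)" using R tR by (intro member_le_sum) auto
        then have "\<bar>x s\<bar> * \<bar>f t\<bar> \<le> N x / c * (\<Sum>t\<in>R. \<bar>f t\<bar>)"
          using s_bound[OF x] c Nx by (intro mult_mono) auto
        then have 2: "\<bar>x s * f t\<bar> \<le> (\<Sum>t\<in>R. \<bar>f t\<bar>) / c * N x" by (simp add: abs_mult mult.commute)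
        have "x t = y t + x s * f t" by (simp add: y_def)
        then have "\<bar>x t\<bar> \<le> \<bar>y t\<bar> + \<bar>x s * f t\<bar>" by linarith
        also have "\<dots> \<le> C * (1 + N f / c) * N x + (\<Sum>t\<in>R. \<bar>f t\<bar>) / c * N x + 1 / c * N x"
          using 1 2 mult_nonneg_nonneg[OF pos(3) Nx] by linarith
        also have "\<dots> = K * N x" unfolding K_def by (simp add: distrib_right)
        finally show ?thesis .
      qed
    qed
    then show ?thesis by blast
  qed
qed

lemma evaluation_bounded:
  assumes "finite S" "function_norm E N" "\<And>x. x \<in> E \<Longrightarrow> (\<And>s. s \<in> S \<Longrightarrow> x s = 0) \<Longrightarrow> x = (\<lambda>_. 0)"
  shows "\<exists>C\<ge>0. \<forall>x\<in>E. \<bar>x g\<bar> \<le> C * N x"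
proof -
  obtain T e C where co: "bounded_coordinates E N T e C" using bounded_coordinates_exist[OF assms] by blast
  have "\<bar>x g\<bar> \<le> (C * (\<Sum>t\<in>T. \<bar>e t g\<bar>)) * N x" if x: "x \<in> E" for x
  proof -
    have "x g = (\<Sum>t\<in>T. x t * e t g)" by (rule bounded_coordinatesD(4)[OF co x])
    then have "\<bar>x g\<bar> \<le> (\<Sum>t\<in>T. \<bar>x t * e t g\<bar>)" by simp
    also have "\<dots> \<le> (\<Sum>t\<in>T. (C * N x) * \<bar>e t g\<bar>)"
      unfolding abs_mult using co x by (intro sum_mono mult_right_mono) (auto simp: bounded_coordinates_def)
    finally show ?thesis by (simp add: sum_distrib_left mult_ac)
  qed
  moreover have "0 \<le> C * (\<Sum>t\<in>T. \<bar>e t g\<bar>)"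
    using co by (auto simp: bounded_coordinates_def intro!: mult_nonneg_nonneg sum_nonneg)
  ultimately show ?thesis by blast
qed

section \<open>The first cohomology and the Lipschitz bound\<close>

lemma H1_eq_zero_if_zero_on_generators:
  assumes G: "group G" and gen: "generate G S = carrier G" and S: "S \<subseteq> carrier G"
    and x: "x \<in> H1 G" "\<And>s. s \<in> S \<Longrightarrow> x s = 0"
  shows "x = (\<lambda>_. 0)"
proof
  fix g
  interpret group G by fact
  have hom: "x \<in> hom G additive_real" using x by (simp add: H1_def)
  show "x g = 0"
  proof (cases "g \<in> carrier G")
    case True
    then have "g \<in> generate G S" by (simp add: gen)
    then show ?thesis
    proof (induction rule: generate.induct)
      case one
      then show ?case by (rule additive_real_one[OF hom])
    next
      case (incl h)
      then show ?case by (rule x)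
    next
      case (inv h)
      then show ?case using additive_real_inv[OF hom, of h] x(2) S by auto
    next
      case (eng h1 h2)
      then show ?case using gen by (simp add: additive_realD[OF hom])
    qed
  next
    case False
    then show ?thesis using x by (simp add: H1_def)
  qed
qed

lemma function_norm_H1:
  assumes "norm_on_H1 G N"
  shows "function_norm (H1 G) N"
proof
  show "(\<lambda>_. 0) \<in> H1 G" by (simp add: H1_def additive_real_zero)
  show "(\<lambda>g. x g + y g) \<in> H1 G" if "x \<in> H1 G" "y \<in> H1 G" for x y
    using that by (auto simp: H1_def intro: additive_real_add)
  show "(\<lambda>g. c * x g) \<in> H1 G" if "x \<in> H1 G" for x c
    using that by (auto simp: H1_def intro: additive_real_cmult)
qed (use assms in \<open>auto simp: norm_on_H1_def\<close>)

lemma R_width_nonneg: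
  assumes "finite (mat_support p A)"
  shows "0 \<le> R_width p A \<psi>"
proof (cases "mat_support p A = {}")
  case False
  have "Min (\<psi> ` mat_support p A) \<le> Max (\<psi> ` mat_support p A)"
    using assms False by (meson Max_ge Min_in finite_imageI image_is_empty)
  then show ?thesis using False by (simp add: R_width_def)
qed (simp add: R_width_def)

lemma R_width_le:
  assumes "finite (mat_support p A)" "\<And>a. a \<in> mat_support p A \<Longrightarrow> \<bar>\<psi> a\<bar> \<le> c" "0 \<le> c"
  shows "R_width p A \<psi> \<le> real p * (2 * c)"
proof (cases "mat_support p A = {}")
  case False
  have "Max (\<psi> ` mat_support p A) \<le> c"
    using assms(1) False by (intro Max.boundedI) (auto dest!: assms(2))
  moreover have "- c \<le> Min (\<psi> ` mat_support p A)"
    using assms(1) False by (intro Min.boundedI) (auto dest!: assms(2))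
  ultimately show ?thesis using False by (auto simp: R_width_def intro!: mult_left_mono)
qed (use assms in \<open>simp add: R_width_def\<close>)

theorem theorem6p1:
  fixes \<pi> :: "('a, 'm) monoid_scheme" and G :: "('g, 'n) monoid_scheme"
    and \<phi> :: "'a \<Rightarrow> real" and \<gamma> :: "'a \<Rightarrow> 'g"
    and p :: nat and A :: "('a \<Rightarrow>\<^sub>0 complex) mat"
    and V :: "('g \<Rightarrow> real) \<Rightarrow> real \<Rightarrow> real"
  assumes "admissible_triple \<pi> \<phi> G \<gamma>"
    and "A \<in> group_ring_mat \<pi> p"
    and V_def: "\<And>\<xi> t. V \<xi> t = regular_fk_det G p (kappa (\<lambda>g. \<phi> g + \<xi> (\<gamma> g)) \<gamma> t A)"
    and "finitely_generated_group G"
    and "residually_finite_group G"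
  shows "((\<exists>\<xi>\<in>H1 G. \<forall>t>0. V \<xi> t = 0) \<longrightarrow> (\<forall>\<xi>\<in>H1 G. \<forall>t>0. V \<xi> t = 0)) \<and>
    (\<not> (\<exists>\<xi>\<in>H1 G. \<forall>t>0. V \<xi> t = 0) \<longrightarrow>
      (\<forall>\<xi>\<in>H1 G. has_degb (V \<xi>) \<and> 0 \<le> degb (V \<xi>)) \<and>
      (\<forall>\<xi>\<in>H1 G. \<forall>\<eta>\<in>H1 G.
         \<bar>degb (V \<xi>) - degb (V \<eta>)\<bar> \<le> 2 * R_width p A (\<lambda>g. \<xi> (\<gamma> g) - \<eta> (\<gamma> g))) \<and>
      (\<forall>N. norm_on_H1 G N \<longrightarrow>
         (\<exists>C\<ge>0. \<forall>\<xi>\<in>H1 G. \<forall>\<eta>\<in>H1 G.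
            \<bar>degb (V \<xi>) - degb (V \<eta>)\<bar> \<le> C * N (\<lambda>g. \<xi> g - \<eta> g))))"
proof -
  have "group G" and \<gamma>: "\<gamma> \<in> hom \<pi> G"
    using assms(1) by (simp_all add: admissible_triple_def)
  obtain \<psi> where \<psi>: "\<psi> \<in> hom G additive_real" "\<And>g. g \<in> carrier \<pi> \<Longrightarrow> \<phi> g = \<psi> (\<gamma> g)"
    using assms(1) by (auto simp: admissible_triple_def)
  interpret group G by fact
  interpret kappa_family G p \<pi> \<gamma> A by unfold_locales (rule assms(2) \<gamma>)+
  have fin: "finite (mat_support p A)" by (simp add: mat_support_eq finite_terms)
  \<comment> \<open>Admissibility lifts \<phi> to \<psi> on the target group, so the twisted
    exponent is the composition of \<gamma> with this single homomorphism.\<close>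
  define S where "S \<xi> = (\<lambda>g. \<psi> g + \<xi> g)" for \<xi>
  have S: "S \<xi> \<in> hom G additive_real" if "\<xi> \<in> H1 G" for \<xi>
    unfolding S_def using that \<psi>(1) by (intro additive_real_add) (auto simp: H1_def)
  have V: "V \<xi> t = \<Phi> (\<lambda>g. ln t * S \<xi> g)" if "0 < t" for \<xi> t
    unfolding V_def \<Phi>_def S_def
    by (subst kappa_eq_Kap[OF that, of _ "\<lambda>g. ln t * (\<psi> g + \<xi> g)"]) (simp_all add: \<psi>(2))
  have scaled: "(\<lambda>g. ln t * S \<xi> g) \<in> hom G additive_real" if "\<xi> \<in> H1 G" for \<xi> t
    by (rule additive_real_cmult[OF S[OF that]])
  have zero: "V \<eta> t = 0" if "\<xi> \<in> H1 G" "\<forall>t>0. V \<xi> t = 0" "\<eta> \<in> H1 G" "0 < t" for \<xi> \<eta> t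
  proof -
    \<comment> \<open>At \<open>t = 1\<close> the exponent is the zero homomorphism; its vanishing
      determinant suffices for all others.\<close>
    have "\<Phi> (\<lambda>g. ln 1 * S \<xi> g) = 0" using that(2) V[of 1 \<xi>] by simp
    then show ?thesis
      unfolding V[OF that(4)] by (rule \<Phi>_zero_everywhere[OF scaled[OF that(1)] _ scaled[OF that(3)]])
  qed
  have part1: "(\<exists>\<xi>\<in>H1 G. \<forall>t>0. V \<xi> t = 0) \<longrightarrow> (\<forall>\<xi>\<in>H1 G. \<forall>t>0. V \<xi> t = 0)"
    using zero by blast
  have part2: "(\<forall>\<xi>\<in>H1 G. has_degb (V \<xi>) \<and> 0 \<le> degb (V \<xi>)) \<and>
      (\<forall>\<xi>\<in>H1 G. \<forall>\<eta>\<in>H1 G.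
         \<bar>degb (V \<xi>) - degb (V \<eta>)\<bar> \<le> 2 * R_width p A (\<lambda>g. \<xi> (\<gamma> g) - \<eta> (\<gamma> g))) \<and>
      (\<forall>N. norm_on_H1 G N \<longrightarrow>
         (\<exists>C\<ge>0. \<forall>\<xi>\<in>H1 G. \<forall>\<eta>\<in>H1 G.
            \<bar>degb (V \<xi>) - degb (V \<eta>)\<bar> \<le> C * N (\<lambda>g. \<xi> g - \<eta> g)))"
    if non: "\<not> (\<exists>\<xi>\<in>H1 G. \<forall>t>0. V \<xi> t = 0)"
  proof -
    have nonzero: "\<Phi> \<beta> \<noteq> 0" if \<beta>: "\<beta> \<in> hom G additive_real" for \<beta>
    proof
      assume "\<Phi> \<beta> = 0"
      have Z: "(\<lambda>_. 0) \<in> H1 G" by (simp add: H1_def additive_real_zero)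
      have "V (\<lambda>_. 0) t = 0" if "0 < t" for t
        unfolding V[OF that] by (rule \<Phi>_zero_everywhere[OF \<beta> \<open>\<Phi> \<beta> = 0\<close> scaled[OF Z]])
      with Z non show False by blast
    qed
    have deg: "has_degb (V \<xi>)" "degb (V \<xi>) = M (S \<xi>) + M (\<lambda>g. - S \<xi> g)" "0 \<le> degb (V \<xi>)"
      if "\<xi> \<in> H1 G" for \<xi>
      by (rule degree_formula[OF nonzero S[OF that] V]; assumption)+
    have diff: "\<bar>degb (V \<xi>) - degb (V \<eta>)\<bar> \<le> R_width p A (\<lambda>g. \<xi> (\<gamma> g) - \<eta> (\<gamma> g))"
      if "\<xi> \<in> H1 G" "\<eta> \<in> H1 G" for \<xi> \<eta>
      using degree_difference[OF nonzero S[OF that(1)] S[OF that(2)]] that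
      by (simp add: deg S_def)
    have lip: "\<exists>C\<ge>0. \<forall>\<xi>\<in>H1 G. \<forall>\<eta>\<in>H1 G. \<bar>degb (V \<xi>) - degb (V \<eta>)\<bar> \<le> C * N (\<lambda>g. \<xi> g - \<eta> g)"
      if N: "norm_on_H1 G N" for N
    proof -
      interpret H: function_norm "H1 G" N by (rule function_norm_H1[OF N])
      \<comment> \<open>A homomorphism vanishing on the generators is 0, so the finite set
        \<open>X\<close> separates cohomology classes and evaluations are bounded.\<close>
      obtain X where X: "finite X" "X \<subseteq> carrier G" "generate G X = carrier G"
        using assms(4) by (auto simp: finitely_generated_group_def)
      have "\<exists>C\<ge>0. \<forall>x\<in>H1 G. \<bar>x g\<bar> \<le> C * N x" for g
        by (rule evaluation_bounded[OF X(1) H.function_norm_axioms])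
          (rule H1_eq_zero_if_zero_on_generators[OF \<open>group G\<close> X(3,2)])
      then obtain C where C: "\<And>g. 0 \<le> C g" "\<And>g x. x \<in> H1 G \<Longrightarrow> \<bar>x g\<bar> \<le> C g * N x" by metis
      \<comment> \<open>The width depends only on the values at the images of the finite support, so
        the sum of the bounds for these evaluations serves for all of them.\<close>
      define K where "K = (\<Sum>a\<in>mat_support p A. C (\<gamma> a))"
      have K: "0 \<le> K" unfolding K_def using C by (intro sum_nonneg)
      have "\<bar>degb (V \<xi>) - degb (V \<eta>)\<bar> \<le> (2 * real p * K) * N (\<lambda>g. \<xi> g - \<eta> g)"
        if "\<xi> \<in> H1 G" "\<eta> \<in> H1 G" for \<xi> \<eta>
      proof -
        have mem: "(\<lambda>g. \<xi> g - \<eta> g) \<in> H1 G" using that by (rule H.diff_mem)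
        have "R_width p A (\<lambda>g. \<xi> (\<gamma> g) - \<eta> (\<gamma> g)) \<le> real p * (2 * (K * N (\<lambda>g. \<xi> g - \<eta> g)))"
        proof (rule R_width_le[OF fin])
          fix a assume a: "a \<in> mat_support p A"
          have "\<bar>\<xi> (\<gamma> a) - \<eta> (\<gamma> a)\<bar> \<le> C (\<gamma> a) * N (\<lambda>g. \<xi> g - \<eta> g)" using C(2)[OF mem] by simp
          also have "\<dots> \<le> K * N (\<lambda>g. \<xi> g - \<eta> g)"
            unfolding K_def using fin a C(1) H.N_nonneg[OF mem] by (intro mult_right_mono member_le_sum) auto
          finally show "\<bar>\<xi> (\<gamma> a) - \<eta> (\<gamma> a)\<bar> \<le> K * N (\<lambda>g. \<xi> g - \<eta> g)" .
        qed (use K H.N_nonneg[OF mem] in simp)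
        with diff[OF that] show ?thesis by (simp add: mult_ac)
      qed
      moreover have "0 \<le> 2 * real p * K" using K by simp
      ultimately show ?thesis by blast
    qed
    \<comment> \<open>One width is at most two, because widths are nonnegative.\<close>
    have "\<bar>degb (V \<xi>) - degb (V \<eta>)\<bar> \<le> 2 * R_width p A (\<lambda>g. \<xi> (\<gamma> g) - \<eta> (\<gamma> g))"
      if "\<xi> \<in> H1 G" "\<eta> \<in> H1 G" for \<xi> \<eta>
      using diff[OF that] R_width_nonneg[OF fin, of "\<lambda>g. \<xi> (\<gamma> g) - \<eta> (\<gamma> g)"] by linarith
    with deg lip show ?thesis by blast
  qed
  from part1 part2 show ?thesis by blast
qed

end
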